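(* Let $(V,\mathcal F,\mu)$ be a $\sigma$-finite measure space, $K$ a $(1,\infty)$-bounded kernel on $V$, $d\in L^\infty(V)$, and let $S\subseteq V$ be a structural set of type B for $K$. Let $\mathscr A=\mathscr A_{d,K}$ and let $\mathscr R_S(\lambda)$, $\lambda\in\mathbb C\setminus\Sigma_d$, be the reduced operators. Then: (1) $\operatorname{sp}(\mathscr A)\setminus\Sigma_d\subseteq \operatorname{sp}(\mathscr R_S)$. (2) Given $\lambda_0\in\mathbb C\setminus\Sigma_d$, $\lambda_0$ is an eigenvalue of $\mathscr A$ if and only if $\lambda_0$ is an eigenvalue of $\mathscr R_S(\lambda_0)$. (3) If $\lambda_0\in\mathbb C\setminus\Sigma_d$ is an eigenvalue of $\mathscr A$ and $u\in L^1(V)$ is an associated eigenfunction, $\mathscr A u=\lambda_0 u$, then $\mathscr R_S(\lambda_0)u_S=\lambda_0u_S$, i.e. $u_S$ is the corresponding eigenfunction for $\mathscr R_S(\lambda_0)$, where $u_S$ is the restriction of $u$ to $S$. (4) If $\lambda_0\in\mathbb C\setminus\Sigma_d$ is an eigenvalue of $\mathscr R_S(\lambda_0)$ and $v\in L^1(S)$ is an associated eigenfunction, $\mathscr R_S(\lambda_0)v=\lambda_0v$, then the recursive relations $$u(x)=v(x)\ \text{ for } x\in S_0=S,\qquad u(z)=\int_{S_{n-1}}\frac{K(z,dy)}{\lambda_0-d(z)}\,u(y)\ \text{ for all } z\in S_n\setminus S_{n-1},\ n\ge 1,$$ uniquely determine an eigenfunction $u\in L^1(V)$ such that $\mathscr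 A u=\lambda_0u$.
   Context: Function spaces: $L^1(V)=L^1(V,\mu)$ is the space of complex $\mu$-integrable functions with norm $\|f\|_1=\int_V|f|\,d\mu$; $L^\infty(V)$ is the space of bounded complex $\mathcal F$-measurable functions with the sup norm; $L^{1,\infty}(V\times V,\mu)$ is the space of measurable $f:V\times V\to\mathbb C$ with $\|f\|_{1,\infty}:=\sup_{y\in V}\int_V|f(x,y)|\,\mu(dx)<\infty$. Kernels: a kernel on $V$ is a function $K:V\times\mathcal F\to\mathbb C$ such that $B\mapsto K(x,B)$ is a complex measure $K_x$ for each $x\in V$, and $x\mapsto K(x,B)$ is $\mathcal F$-measurable for each $B\in\mathcal F$. $|K|(x,B)$ is the total variation of $K_x$ on $B$. $K$ is $(1,\infty)$-bounded if there is $h\in L^{1,\infty}(V\times V,\mu)$ with $K(x,B)=\int_Bh(x,y)\,\mu(dy)$ for all $x\in V,B\in\mathcal F$; $h$ is denoted $dK/d\mu$ and $\|K\|:=\|h\|_{1,\infty}$. Operator: $\mathscr A=\mathscr A_{d,K}:L^1(V)\to L^1(V)$, $(\mathscr Af)(x)=d(x)f(x)+\int_Vf(y)\,K(x,dy)$, a bounded operator; $\operatorname{sp}(\mathscr A)$ is its spectrum. Reduced operators: $S\subseteq V$ is measurable, $S^c=V\setminus S$, $\Sigma_d=\overline{d(V\setminus S)}$ (closure in $\mathbb C$), $\mathcal F_S=\{S\cap B:B\in\mathcal F\}$, $L^1(S)=L^1(S,\mu|_S)$. For $\lambda\in\mathbb C\setminus\Sigma_d$, $x\in S$, $B\in\mathcal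 F_S$ put $K^{(1)}_{S,\lambda}(x,B)=K(x,B)$ and, for $n\ge2$, $$K^{(n)}_{S,\lambda}(x,B)=\int_{S^c}\cdots\int_{S^c}\frac{K(x,dz_1)K(z_1,dz_2)\cdots K(z_{n-1},B)}{\prod_{p=1}^{n-1}(\lambda-d(z_p))},$$ $R_{S,\lambda}(x,B)=\sum_{n\ge1}K^{(n)}_{S,\lambda}(x,B)$, and $\mathscr R_S(\lambda):L^1(S)\to L^1(S)$, $(\mathscr R_S(\lambda)f)(x)=d(x)f(x)+\int_Sf(y)\,R_{S,\lambda}(x,dy)$ (the paper shows these are well-defined bounded operators for type B structural sets). $\operatorname{sp}(\mathscr R_S)$ is the set of $\lambda\in\mathbb C\setminus\Sigma_d$ such that $\mathscr R_S(\lambda)-\lambda I$ is not invertible on $L^1(S)$. Structural set of type B for $K$: a nonempty $S\subseteq V$ for which there is a measurable $M:S^c\to[0,+\infty)$ such that, with the point-set map $\varphi_{S^c}(x):=S^c\cap\operatorname{supp}(K_x)$ for $x\in S^c$, where $\operatorname{supp}(K_x)=\{y\in V: (dK/d\mu)(x,y)\neq0\}$, and iterates $\varphi_{S^c}^0(x)=\{x\}$, $\varphi_{S^c}^n(x)=\bigcup\{\varphi_{S^c}(y):y\in\varphi_{S^c}^{n-1}(x)\}$, one has: (1) for all $x\in S^c$ there is $n\in\mathbb N$ with $\varphi_{S^c}^n(x)=\emptyset$; (2) $|K(x,B)|\le M(x)\mu(B)$ for all $x\in S^c$ and $B\in\mathcal F$, $B\subseteq S^c$; (3) with $n_S(x):=\min\{k\in\mathbb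 N:\varphi_{S^c}^k(x)=\emptyset\}$, $\int_{S^c}n_S(x)M(x)\,\mu(dx)<+\infty$. Depth sets: $S_0:=S$ and $S_n:=\{x\in V:|K|(x,V\setminus S_{n-1})=0\}\cup S_{n-1}$ for $n\ge1$. *)

theory Defs
  imports "HOL-Analysis.Analysis"
begin

section \<open>Complex measures, total variation, integration\<close>

definition complex_measure :: "'a measure \<Rightarrow> ('a set \<Rightarrow> complex) \<Rightarrow> bool" where
  "complex_measure N \<nu> \<longleftrightarrow>
     (\<forall>E :: nat \<Rightarrow> 'a set. range E \<subseteq> sets N \<longrightarrow> disjoint_family E \<longrightarrow>
        (\<lambda>i. \<nu> (E i)) sums \<nu> (\<Union>i. E i))"

definition total_variation :: "'a measure \<Rightarrow> ('a set \<Rightarrow> complex) \<Rightarrow> 'a set \<Rightarrow> ennreal" where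
  "total_variation N \<nu> B =
     (SUP E \<in> {E :: nat \<Rightarrow> 'a set. range E \<subseteq> sets N \<and> disjoint_family E \<and> (\<Union>i. E i) = B}.
        (\<Sum>i. ennreal (cmod (\<nu> (E i)))))"

definition total_variation_measure :: "'a measure \<Rightarrow> ('a set \<Rightarrow> complex) \<Rightarrow> 'a measure" where
  "total_variation_measure N \<nu> = measure_of (space N) (sets N) (total_variation N \<nu>)"

text \<open>
  Upper variation \<open>B \<mapsto> sup {\<rho>(A) | A \<subseteq> B}\<close> of a real set function, the positive part in its
  Jordan decomposition. The family \<open>D\<close> is the domain of \<open>\<rho>\<close>: it is \<open>sets N\<close> for a finite signed
  measure, and an ideal of measurable sets for a set function that is finite only on that ideal.
  Negative values are cut off by \<open>ennreal\<close>, which is harmless because of \<open>A = {}\<close>.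
\<close>
definition upper_variation :: "'a measure \<Rightarrow> 'a set set \<Rightarrow> ('a set \<Rightarrow> real) \<Rightarrow> 'a measure" where
  "upper_variation N D \<rho> =
     measure_of (space N) (sets N) (\<lambda>B. SUP A \<in> {A \<in> D. A \<subseteq> B}. ennreal (\<rho> A))"

text \<open>
  The integral of \<open>f\<close> against a complex measure \<open>\<nu>\<close> with domain \<open>D\<close>, by the Jordan decompositions of
  the real and imaginary parts of \<open>\<nu>\<close>.
\<close>
definition cm_integral ::
    "'a measure \<Rightarrow> 'a set set \<Rightarrow> ('a set \<Rightarrow> complex) \<Rightarrow> ('a \<Rightarrow> complex) \<Rightarrow> complex" where
  "cm_integral N D \<nu> f =
     ((\<integral>y. f y \<partial>upper_variation N D (\<lambda>A. Re (\<nu> A)))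
       - (\<integral>y. f y \<partial>upper_variation N D (\<lambda>A. - Re (\<nu> A))))
     + \<i> * ((\<integral>y. f y \<partial>upper_variation N D (\<lambda>A. Im (\<nu> A)))
       - (\<integral>y. f y \<partial>upper_variation N D (\<lambda>A. - Im (\<nu> A))))"


section \<open>Function spaces and operators on \<open>L\<^sup>1\<close>\<close>

text \<open>
  Elements of \<open>L\<^sup>1\<close> are represented by integrable functions, and equality in \<open>L\<^sup>1\<close> is equality almost
  everywhere. Operators act on representatives.
\<close>
definition L1 :: "'a measure \<Rightarrow> ('a \<Rightarrow> complex) set" where
  "L1 N = {f. integrable N f}"

definition L1_norm :: "'a measure \<Rightarrow> ('a \<Rightarrow> complex) \<Rightarrow> real" where
  "L1_norm N f = (\<integral>x. cmod (f x) \<partial>N)"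

definition Linf :: "'a measure \<Rightarrow> ('a \<Rightarrow> complex) set" where
  "Linf N = {f \<in> borel_measurable N. bounded (f ` space N)}"

definition L1inf :: "'a measure \<Rightarrow> ('a \<Rightarrow> 'a \<Rightarrow> complex) set" where
  "L1inf N = {h. case_prod h \<in> borel_measurable (N \<Otimes>\<^sub>M N) \<and>
     (SUP y \<in> space N. \<integral>\<^sup>+ x. ennreal (cmod (h x y)) \<partial>N) < \<infinity>}"

type_synonym 'a op = "('a \<Rightarrow> complex) \<Rightarrow> 'a \<Rightarrow> complex"

definition bounded_L1_operator :: "'a measure \<Rightarrow> 'a op \<Rightarrow> bool" where
  "bounded_L1_operator N T \<longleftrightarrow>
     (\<forall>f \<in> L1 N. T f \<in> L1 N) \<and>
     (\<forall>f \<in> L1 N. \<forall>g \<in> L1 N. (AE x in N. f x = g x) \<longrightarrow> (AE x in N. T f x = T g x)) \<and>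
     (\<forall>f \<in> L1 N. \<forall>g \<in> L1 N. AE x in N. T (\<lambda>y. f y + g y) x = T f x + T g x) \<and>
     (\<forall>c. \<forall>f \<in> L1 N. AE x in N. T (\<lambda>y. c * f y) x = c * T f x) \<and>
     (\<exists>C. \<forall>f \<in> L1 N. L1_norm N (T f) \<le> C * L1_norm N f)"

definition L1_invertible :: "'a measure \<Rightarrow> 'a op \<Rightarrow> bool" where
  "L1_invertible N T \<longleftrightarrow>
     (\<exists>Q. bounded_L1_operator N Q \<and>
        (\<forall>f \<in> L1 N. (AE x in N. T (Q f) x = f x) \<and> (AE x in N. Q (T f) x = f x)))"

definition shifted :: "'a op \<Rightarrow> complex \<Rightarrow> 'a op" where
  "shifted T z f x = T f x - z * f x"

definition L1_spectrum :: "'a measure \<Rightarrow> 'a op \<Rightarrow> complex set" where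
  "L1_spectrum N T = {z. \<not> L1_invertible N (shifted T z)}"

definition eigenfunction :: "'a measure \<Rightarrow> 'a op \<Rightarrow> complex \<Rightarrow> ('a \<Rightarrow> complex) \<Rightarrow> bool" where
  "eigenfunction N T z f \<longleftrightarrow>
     f \<in> L1 N \<and> \<not> (AE x in N. f x = 0) \<and> (AE x in N. T f x = z * f x)"

definition eigenvalue :: "'a measure \<Rightarrow> 'a op \<Rightarrow> complex \<Rightarrow> bool" where
  "eigenvalue N T z \<longleftrightarrow> (\<exists>f. eigenfunction N T z f)"


section \<open>Kernels and the operator \<open>A\<close>\<close>

type_synonym 'a kern = "'a \<Rightarrow> 'a set \<Rightarrow> complex"

definition is_kernel :: "'a measure \<Rightarrow> 'a kern \<Rightarrow> bool" where
  "is_kernel N K \<longleftrightarrow>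
     (\<forall>x \<in> space N. complex_measure N (K x)) \<and>
     (\<forall>B \<in> sets N. (\<lambda>x. K x B) \<in> borel_measurable N)"

text \<open>
  \<open>h\<close> is (a version of) \<open>dK/d\<mu>\<close>; thus \<open>K\<close> is \<open>(1,\<infinity>)\<close>-bounded iff such an \<open>h\<close> exists. Integrability
  of \<open>h x\<close> has to be demanded, since a divergent Bochner integral has the value 0.
\<close>
definition kernel_density :: "'a measure \<Rightarrow> 'a kern \<Rightarrow> ('a \<Rightarrow> 'a \<Rightarrow> complex) \<Rightarrow> bool" where
  "kernel_density N K h \<longleftrightarrow>
     h \<in> L1inf N \<and>
     (\<forall>x \<in> space N. integrable N (h x) \<and>
        (\<forall>B \<in> sets N. K x B = (LINT y:B|N. h x y)))"

definition opA :: "'a measure \<Rightarrow> ('a \<Rightarrow> complex) \<Rightarrow> 'a kern \<Rightarrow> 'a op" where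
  "opA N d K f x = d x * f x + cm_integral N (sets N) (K x) f"


section \<open>Structural sets of type B\<close>

definition kernel_supp :: "'a measure \<Rightarrow> ('a \<Rightarrow> 'a \<Rightarrow> complex) \<Rightarrow> 'a \<Rightarrow> 'a set" where
  "kernel_supp N h x = {y \<in> space N. h x y \<noteq> 0}"

definition phi :: "'a measure \<Rightarrow> ('a \<Rightarrow> 'a \<Rightarrow> complex) \<Rightarrow> 'a set \<Rightarrow> 'a \<Rightarrow> 'a set" where
  "phi N h S x = (space N - S) \<inter> kernel_supp N h x"

primrec phi_iter ::
    "'a measure \<Rightarrow> ('a \<Rightarrow> 'a \<Rightarrow> complex) \<Rightarrow> 'a set \<Rightarrow> nat \<Rightarrow> 'a \<Rightarrow> 'a set" where
  "phi_iter N h S 0 x = {x}"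
| "phi_iter N h S (Suc n) x = (\<Union>y \<in> phi_iter N h S n x. phi N h S y)"

definition nS :: "'a measure \<Rightarrow> ('a \<Rightarrow> 'a \<Rightarrow> complex) \<Rightarrow> 'a set \<Rightarrow> 'a \<Rightarrow> nat" where
  "nS N h S x = (LEAST k. phi_iter N h S k x = {})"

text \<open>
  The last condition includes measurability of \<open>n\<^sub>S M\<close>, without which its integral is meaningless.
\<close>
definition structural_type_B ::
    "'a measure \<Rightarrow> 'a kern \<Rightarrow> ('a \<Rightarrow> 'a \<Rightarrow> complex) \<Rightarrow> 'a set \<Rightarrow> bool" where
  "structural_type_B N K h S \<longleftrightarrow>
     S \<in> sets N \<and> S \<noteq> {} \<and>
     (\<exists>M :: 'a \<Rightarrow> real.
        M \<in> borel_measurable (restrict_space N (space N - S)) \<and>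
        (\<forall>x \<in> space N - S. 0 \<le> M x) \<and>
        (\<forall>x \<in> space N - S. \<exists>n. phi_iter N h S n x = {}) \<and>
        (\<forall>x \<in> space N - S. \<forall>B \<in> sets N. B \<subseteq> space N - S \<longrightarrow>
           ennreal (cmod (K x B)) \<le> ennreal (M x) * emeasure N B) \<and>
        integrable (restrict_space N (space N - S)) (\<lambda>x. real (nS N h S x) * M x))"


section \<open>Reduced operators\<close>

definition Sigma_d :: "'a measure \<Rightarrow> ('a \<Rightarrow> complex) \<Rightarrow> 'a set \<Rightarrow> complex set" where
  "Sigma_d N d S = closure (d ` (space N - S))"

text \<open>
  \<open>K_term N d K S z n\<close> is \<open>K\<^sup>(\<^sup>n\<^sup>+\<^sup>1\<^sup>)\<close> for the parameter \<open>z\<close>: the multiple integral is read as an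
  iterated one, and its outermost integration gives the recursion. The recursion evaluates it at
  points outside \<open>S\<close> as well.
\<close>
primrec K_term ::
    "'a measure \<Rightarrow> ('a \<Rightarrow> complex) \<Rightarrow> 'a kern \<Rightarrow> 'a set \<Rightarrow> complex \<Rightarrow> nat \<Rightarrow> 'a kern" where
  "K_term N d K S z 0 x B = K x B"
| "K_term N d K S z (Suc n) x B =
     cm_integral N (sets N) (K x)
       (\<lambda>y. indicator (space N - S) y * (K_term N d K S z n y B / (z - d y)))"

text \<open>The same iterated integrals with absolute values throughout.\<close>
primrec K_abs_term ::
    "'a measure \<Rightarrow> ('a \<Rightarrow> complex) \<Rightarrow> 'a kern \<Rightarrow> 'a set \<Rightarrow> complex \<Rightarrow> nat \<Rightarrow> 'a \<Rightarrow> 'a set \<Rightarrow> ennreal"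
where
  "K_abs_term N d K S z 0 x B = total_variation N (K x) B"
| "K_abs_term N d K S z (Suc n) x B =
     (\<integral>\<^sup>+ y. indicator (space N - S) y * (K_abs_term N d K S z n y B / ennreal (cmod (z - d y)))
        \<partial>total_variation_measure N (K x))"

definition R_kernel ::
    "'a measure \<Rightarrow> ('a \<Rightarrow> complex) \<Rightarrow> 'a kern \<Rightarrow> 'a set \<Rightarrow> complex \<Rightarrow> 'a kern" where
  "R_kernel N d K S z x B = (\<Sum>n. K_term N d K S z n x B)"

text \<open>
  The measurable subsets \<open>B\<close> of \<open>S\<close> for which all integrals and the series defining \<open>R(x,B)\<close>
  converge absolutely. If \<open>\<mu>(V) = \<infinity>\<close> this may fail for \<open>B = S\<close>, even for \<open>x\<close> in a set of positive
  measure, because \<open>|K|(y,S)\<close> need not be an integrable function of \<open>y\<close>: then \<open>R(x,\<cdot>)\<close> is only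
  \<open>\<sigma>\<close>-finite, like the measure \<open>r(x,y) \<mu>(dy)\<close> with \<open>r(x,\<cdot>)\<close> not integrable. The sets below form
  an ideal that, for almost every \<open>x\<close>, contains a sequence of sets exhausting \<open>S\<close>; they determine
  \<open>R(x,\<cdot>)\<close>. If \<open>S\<close> itself belongs to the ideal, it is all of \<open>sets (restrict_space N S)\<close>.
\<close>
definition R_domain ::
    "'a measure \<Rightarrow> ('a \<Rightarrow> complex) \<Rightarrow> 'a kern \<Rightarrow> 'a set \<Rightarrow> complex \<Rightarrow> 'a \<Rightarrow> 'a set set" where
  "R_domain N d K S z x =
     {B \<in> sets (restrict_space N S). (\<Sum>n. K_abs_term N d K S z n x B) < \<infinity>}"

definition opR ::
    "'a measure \<Rightarrow> ('a \<Rightarrow> complex) \<Rightarrow> 'a kern \<Rightarrow> 'a set \<Rightarrow> complex \<Rightarrow> 'a op" where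
  "opR N d K S z f x =
     d x * f x +
     cm_integral (restrict_space N S) (R_domain N d K S z x) (R_kernel N d K S z x) f"

definition R_spectrum ::
    "'a measure \<Rightarrow> ('a \<Rightarrow> complex) \<Rightarrow> 'a kern \<Rightarrow> 'a set \<Rightarrow> complex set" where
  "R_spectrum N d K S =
     {z. z \<notin> Sigma_d N d S \<and> \<not> L1_invertible (restrict_space N S) (shifted (opR N d K S z) z)}"


section \<open>Depth sets and the recursive relations\<close>

primrec depth_set :: "'a measure \<Rightarrow> 'a kern \<Rightarrow> 'a set \<Rightarrow> nat \<Rightarrow> 'a set" where
  "depth_set N K S 0 = S"
| "depth_set N K S (Suc n) =
     {x \<in> space N. total_variation N (K x) (space N - depth_set N K S n) = 0} \<union> depth_set N K S n"

text \<open>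
  The recursive relation between \<open>v\<close> (on \<open>S\<close>) and \<open>u\<close> (on \<open>V\<close>), at the point \<open>x\<close>.
\<close>
definition depth_relation ::
    "'a measure \<Rightarrow> ('a \<Rightarrow> complex) \<Rightarrow> 'a kern \<Rightarrow> 'a set \<Rightarrow> complex \<Rightarrow>
      ('a \<Rightarrow> complex) \<Rightarrow> ('a \<Rightarrow> complex) \<Rightarrow> 'a \<Rightarrow> bool" where
  "depth_relation N d K S z v u x \<longleftrightarrow>
     (x \<in> depth_set N K S 0 \<longrightarrow> u x = v x) \<and>
     (\<forall>n \<ge> 1. x \<in> depth_set N K S n - depth_set N K S (n - 1) \<longrightarrow>
        u x = cm_integral N (sets N) (K x)
                (\<lambda>y. indicator (depth_set N K S (n - 1)) y * (u y / (z - d x))))"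

end

theory Submission
  imports Defs
begin

text \<open>
  The reduced operator is a Schur complement. Write \<open>H u (x) = \<integral> u(y) K(x, dy)\<close>, let \<open>q = 1 / (z0 - d)\<close> off \<open>S\<close>
  and \<open>q = 0\<close> on \<open>S\<close>, and put \<open>L g = H (q g)\<close>. If \<open>(A - z0) u = 0\<close> off \<open>S\<close>, then \<open>u = q H u\<close> there, so \<open>\<phi> = H u\<close> solves
  \<open>\<phi> = H (1\<^sub>S u) + L \<phi>\<close>. On \<open>S\<close> the operator \<open>A\<close> acts on \<open>u\<close> as \<open>d u + \<phi>\<close>, and substituting the Neumann series
  \<open>\<phi> = \<Sum>n. L\<^sup>n (H (1\<^sub>S u))\<close> turns this into the reduced operator, because \<open>L\<^sup>n (H 1\<^sub>B) (x)\<close> is the \<open>n\<close>-th term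
  of the reduced kernel. The series converges absolutely in \<open>L\<^sup>1\<close>: on the \<open>n\<close>-th depth set \<open>L\<^sup>n g\<close> vanishes off \<open>S\<close>,
  so each step multiplies the norm by the mass of the integrable majorant \<open>M\<close> outside that set, which
  tends to 0. The homogeneous equation \<open>\<phi> = L \<phi>\<close> has only the zero solution, by induction on the depth.
\<close>

section \<open>Integration against set functions with a density\<close>

text \<open>The definitions speak at every point and through Jordan parts, while the Schur
  complement argument lives in \<open>L1\<close>. The reduced kernel need not have finite total
  mass, so it cannot be handled as a complex measure. It is represented by a density that need not
  be integrable, and an integral against it is the combination \<open>dens_int\<close> of four
  Bochner integrals, each with the default value 0 when it diverges. For measurable integrands this
  agrees with \<open>cm_integral\<close> at every point and depends measurably on a parameter.
  Additivity and the exchange of integrals with series are claimed only where an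
  \<open>ennreal\<close> integral is finite, which is almost everywhere by Tonelli and the column
  bound on \<open>h\<close>. The equation \<open>\<phi> = g + L \<phi>\<close> then carries all four
  assertions: solvability with a norm bound gives the inverse, and uniqueness shows that a function
  satisfying the equation off \<open>S\<close> is determined by its values on
  \<open>S\<close>.\<close>

definition dens_int :: "'a measure \<Rightarrow> ('a \<Rightarrow> complex) \<Rightarrow> ('a \<Rightarrow> complex) \<Rightarrow> complex" where
  "dens_int N g f =
     ((\<integral>y. max 0 (Re (g y)) *\<^sub>R f y \<partial>N) - (\<integral>y. max 0 (- Re (g y)) *\<^sub>R f y \<partial>N))
     + \<i> * ((\<integral>y. max 0 (Im (g y)) *\<^sub>R f y \<partial>N) - (\<integral>y. max 0 (- Im (g y)) *\<^sub>R f y \<partial>N))"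

lemma dens_int_eq_integral:
  assumes [measurable]: "g \<in> borel_measurable N" "f \<in> borel_measurable N"
    and int: "integrable N (\<lambda>y. g y * f y)"
  shows "dens_int N g f = (\<integral>y. g y * f y \<partial>N)"
proof -
  have 1: "integrable N (\<lambda>y. max 0 (p (g y)) *\<^sub>R f y)"
    if "\<And>w. \<bar>p w\<bar> \<le> cmod w" and [measurable]: "p \<in> borel_measurable borel" for p :: "complex \<Rightarrow> real"
  proof (rule Bochner_Integration.integrable_bound[OF int])
    show "AE y in N. norm (max 0 (p (g y)) *\<^sub>R f y) \<le> norm (g y * f y)"
      using that(1) by (auto simp: norm_mult intro!: AE_I2 mult_right_mono order_trans[OF _ that(1)])
  qed measurable
  have m: "(\<lambda>w. - Re w) \<in> borel_measurable borel" "(\<lambda>w. - Im w) \<in> borel_measurable borel" by measurable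
  have i: "integrable N (\<lambda>y. max 0 (Re (g y)) *\<^sub>R f y)" "integrable N (\<lambda>y. max 0 (- Re (g y)) *\<^sub>R f y)"
    "integrable N (\<lambda>y. max 0 (Im (g y)) *\<^sub>R f y)" "integrable N (\<lambda>y. max 0 (- Im (g y)) *\<^sub>R f y)"
    using 1[of Re] 1[of "\<lambda>w. - Re w"] 1[of Im] 1[of "\<lambda>w. - Im w"] m by (auto simp: abs_Re_le_cmod abs_Im_le_cmod)
  have "dens_int N g f = (\<integral>y. (max 0 (Re (g y)) *\<^sub>R f y - max 0 (- Re (g y)) *\<^sub>R f y)
     + \<i> * (max 0 (Im (g y)) *\<^sub>R f y - max 0 (- Im (g y)) *\<^sub>R f y) \<partial>N)"
    unfolding dens_int_def using i by simp
  also have "\<dots> = (\<integral>y. g y * f y \<partial>N)"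
  proof (rule Bochner_Integration.integral_cong[OF refl])
    fix y
    have "max 0 (Re (g y)) *\<^sub>R f y - max 0 (- Re (g y)) *\<^sub>R f y = Re (g y) *\<^sub>R f y"
      "max 0 (Im (g y)) *\<^sub>R f y - max 0 (- Im (g y)) *\<^sub>R f y = Im (g y) *\<^sub>R f y"
      by (auto simp: max_def scaleR_left_distrib[symmetric] simp flip: scaleR_left_diff_distrib)
    then show "(max 0 (Re (g y)) *\<^sub>R f y - max 0 (- Re (g y)) *\<^sub>R f y)
      + \<i> * (max 0 (Im (g y)) *\<^sub>R f y - max 0 (- Im (g y)) *\<^sub>R f y) = g y * f y"
      by (simp add: complex_eq_iff algebra_simps)
  qed
  finally show ?thesis .
qed

text \<open>The four integrals are recombined before the absolute value is taken, so the constant is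
  1. An infinite right-hand side makes the bound trivial.\<close>

lemma dens_int_bound:
  assumes [measurable]: "g \<in> borel_measurable N" "f \<in> borel_measurable N"
  shows "ennreal (cmod (dens_int N g f)) \<le> (\<integral>\<^sup>+y. ennreal (cmod (g y)) * ennreal (cmod (f y)) \<partial>N)"
proof (cases "(\<integral>\<^sup>+y. ennreal (cmod (g y)) * ennreal (cmod (f y)) \<partial>N) < \<infinity>")
  case True
  then have "integrable N (\<lambda>y. g y * f y)"
    by (intro integrableI_bounded) (auto simp: norm_mult ennreal_mult)
  then show ?thesis
    using integral_norm_bound_ennreal[of N "\<lambda>y. g y * f y"]
    by (simp add: dens_int_eq_integral norm_mult ennreal_mult)
next
  case False
  then show ?thesis by (simp add: top_unique not_less)
qed

text \<open>Agreement is asked for only where the density is nonzero. In this form, vanishing of the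
  kernel outside a depth set allows the integrand to be changed there.\<close>

lemma dens_int_cong_AE:
  assumes [measurable]: "g \<in> borel_measurable N" "f \<in> borel_measurable N" "f' \<in> borel_measurable N"
    and eq: "AE y in N. g y = 0 \<or> f y = f' y"
  shows "dens_int N g f = dens_int N g f'"
proof -
  have "(\<integral>y. max 0 (p (g y)) *\<^sub>R f y \<partial>N) = (\<integral>y. max 0 (p (g y)) *\<^sub>R f' y \<partial>N)"
    if "p 0 = 0" and [measurable]: "p \<in> borel_measurable borel" for p :: "complex \<Rightarrow> real"
    by (rule integral_cong_AE) (use eq that(1) in \<open>auto elim!: eventually_mono\<close>)
  note 1 = this[of Re] this[of "\<lambda>w. - Re w"] this[of Im] this[of "\<lambda>w. - Im w"]
  show ?thesis unfolding dens_int_def using 1 by simp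
qed

lemma dens_int_cmult: "dens_int N g (\<lambda>y. c * f y) = c * dens_int N g f"
proof -
  have "(\<integral>y. a y *\<^sub>R (c * f y) \<partial>N) = c * (\<integral>y. a y *\<^sub>R f y \<partial>N)" for a :: "'a \<Rightarrow> real"
    by (simp flip: integral_mult_right_zero add: mult_scaleR_right)
  then show ?thesis unfolding dens_int_def by (simp add: algebra_simps)
qed

lemma dens_int_restrict_space:
  assumes "S \<inter> space N \<in> sets N"
  shows "dens_int (restrict_space N S) g f = dens_int N g (\<lambda>y. indicator S y * f y)"
proof -
  have "indicator S y *\<^sub>R (a *\<^sub>R w) = a *\<^sub>R (indicator S y * w)" for y a and w :: complex
    by (simp split: split_indicator)
  then show ?thesis
    unfolding dens_int_def by (simp only: integral_restrict_space[OF assms])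
qed

lemma measurable_dens_int:
  assumes "sigma_finite_measure N"
    and [measurable]: "(\<lambda>(x, y). g x y) \<in> borel_measurable (M \<Otimes>\<^sub>M N)"
      "(\<lambda>(x, y). f x y) \<in> borel_measurable (M \<Otimes>\<^sub>M N)"
  shows "(\<lambda>x. dens_int N (g x) (f x)) \<in> borel_measurable M"
proof -
  interpret sigma_finite_measure N by fact
  show ?thesis unfolding dens_int_def by measurable
qed

text \<open>
  The sets \<open>C n\<close> make the ideal \<open>D\<close> rich enough to see \<open>g\<close>; nothing is required where \<open>g\<close> vanishes,
  and \<open>g\<close> itself need not be integrable.
\<close>
lemma upper_variation_eq_density:
  fixes g :: "'a \<Rightarrow> real"
  assumes D: "D \<subseteq> sets N" and down: "\<And>A B. A \<in> D \<Longrightarrow> B \<in> sets N \<Longrightarrow> B \<subseteq> A \<Longrightarrow> B \<in> D"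
    and rho: "\<And>A. A \<in> D \<Longrightarrow> set_integrable N A g \<and> \<rho> A = (LINT y:A|N. g y)"
    and C: "range C \<subseteq> D" "incseq C" "\<And>y. y \<in> space N \<Longrightarrow> g y \<noteq> 0 \<Longrightarrow> y \<in> (\<Union>n. C n)"
    and [measurable]: "g \<in> borel_measurable N"
  shows "upper_variation N D \<rho> = density N (\<lambda>y. ennreal (max 0 (g y)))"
proof -
  have eq: "(SUP A \<in> {A \<in> D. A \<subseteq> B}. ennreal (\<rho> A)) = emeasure (density N (\<lambda>y. ennreal (max 0 (g y)))) B"
    if B[measurable]: "B \<in> sets N" for B
  proof -
    have e: "emeasure (density N (\<lambda>y. ennreal (max 0 (g y)))) B
        = (\<integral>\<^sup>+y. ennreal (max 0 (g y)) * indicator B y \<partial>N)"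
      by (simp add: emeasure_density)
    show ?thesis unfolding e
    proof (rule antisym)
      show "(SUP A \<in> {A \<in> D. A \<subseteq> B}. ennreal (\<rho> A)) \<le> (\<integral>\<^sup>+y. ennreal (max 0 (g y)) * indicator B y \<partial>N)"
      proof (rule SUP_least)
        fix A assume "A \<in> {A \<in> D. A \<subseteq> B}"
        then have A: "A \<in> D" "A \<subseteq> B" and [measurable]: "A \<in> sets N" using D by auto
        have i: "integrable N (\<lambda>y. indicator A y * g y)" and r: "\<rho> A = (\<integral>y. indicator A y * g y \<partial>N)"
          using rho[OF A(1)] by (auto simp: set_integrable_def set_lebesgue_integral_def)
        have "ennreal (\<rho> A) \<le> ennreal (\<integral>y. max 0 (indicator A y * g y) \<partial>N)"
          unfolding r using i by (intro ennreal_leI integral_mono) auto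
        also have "\<dots> = (\<integral>\<^sup>+y. ennreal (max 0 (indicator A y * g y)) \<partial>N)"
          using i by (intro nn_integral_eq_integral[symmetric]) auto
        also have "\<dots> \<le> (\<integral>\<^sup>+y. ennreal (max 0 (g y)) * indicator B y \<partial>N)"
          using A(2) by (intro nn_integral_mono) (auto split: split_indicator)
        finally show "ennreal (\<rho> A) \<le> (\<integral>\<^sup>+y. ennreal (max 0 (g y)) * indicator B y \<partial>N)" .
      qed
      \<comment> \<open>near-maximisers: the positive part of a Hahn decomposition, cut down to \<open>D\<close>\<close>
      define A where "A n = B \<inter> C n \<inter> {y \<in> space N. 0 < g y}" for n
      have Cs[measurable]: "C n \<in> sets N" for n using C(1) D by auto
      have Am[measurable]: "A n \<in> sets N" for n unfolding A_def by measurable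
      have AD: "A n \<in> D" for n
        by (rule down[of "C n"]) (use C(1) in \<open>auto simp: A_def\<close>)
      have val: "ennreal (\<rho> (A n)) = (\<integral>\<^sup>+y. ennreal (g y) * indicator (A n) y \<partial>N)" for n
      proof -
        have i: "integrable N (\<lambda>y. indicator (A n) y * g y)" and r: "\<rho> (A n) = (\<integral>y. indicator (A n) y * g y \<partial>N)"
          using rho[OF AD] by (auto simp: set_integrable_def set_lebesgue_integral_def)
        have "ennreal (\<rho> (A n)) = (\<integral>\<^sup>+y. ennreal (indicator (A n) y * g y) \<partial>N)"
          unfolding r using i
          by (intro nn_integral_eq_integral[symmetric]) (auto simp: A_def split: split_indicator)
        then show ?thesis by (simp add: ennreal_mult'' ennreal_indicator mult.commute)
      qed
      have "(\<integral>\<^sup>+y. ennreal (max 0 (g y)) * indicator B y \<partial>N)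
          = (\<integral>\<^sup>+y. (SUP n. ennreal (g y) * indicator (A n) y) \<partial>N)"
      proof (rule nn_integral_cong)
        fix y assume y: "y \<in> space N"
        show "ennreal (max 0 (g y)) * indicator B y = (SUP n. ennreal (g y) * indicator (A n) y)"
        proof (cases "0 < g y \<and> y \<in> B")
          case True
          then obtain m where "y \<in> C m" using C(3)[OF y] by auto
          then have m: "y \<in> A m" using True y by (auto simp: A_def)
          have "(SUP n. ennreal (g y) * indicator (A n) y) = ennreal (g y)"
          proof (rule antisym)
            show "ennreal (g y) \<le> (SUP n. ennreal (g y) * indicator (A n) y)"
              by (rule SUP_upper2[of m]) (use m in auto)
          qed (auto intro!: SUP_least split: split_indicator)
          then show ?thesis using True by (simp add: max_def)
        next
          case False
          then have "ennreal (g y) * indicator (A n) y = 0" for n by (auto simp: A_def split: split_indicator)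
          then have "(SUP n. ennreal (g y) * indicator (A n) y) = 0" by (simp only: SUP_const) simp
          then show ?thesis using False by (auto simp: max_def split: split_indicator)
        qed
      qed
      also have "\<dots> = (SUP n. \<integral>\<^sup>+y. ennreal (g y) * indicator (A n) y \<partial>N)"
      proof (rule nn_integral_monotone_convergence_SUP)
        show "incseq (\<lambda>n y. ennreal (g y) * indicator (A n) y)"
          using C(2) by (auto simp: incseq_def le_fun_def A_def split: split_indicator)
      qed measurable
      also have "\<dots> \<le> (SUP A \<in> {A \<in> D. A \<subseteq> B}. ennreal (\<rho> A))"
      proof (rule SUP_least)
        fix n
        show "(\<integral>\<^sup>+y. ennreal (g y) * indicator (A n) y \<partial>N) \<le> (SUP A \<in> {A \<in> D. A \<subseteq> B}. ennreal (\<rho> A))"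
          unfolding val[symmetric] by (rule SUP_upper) (use AD in \<open>auto simp: A_def\<close>)
      qed
      finally show "(\<integral>\<^sup>+y. ennreal (max 0 (g y)) * indicator B y \<partial>N) \<le> (SUP A \<in> {A \<in> D. A \<subseteq> B}. ennreal (\<rho> A))" .
    qed
  qed
  have "upper_variation N D \<rho>
      = measure_of (space N) (sets N) (emeasure (density N (\<lambda>y. ennreal (max 0 (g y)))))"
    unfolding upper_variation_def
    by (rule measure_of_eq) (auto simp: sets.space_closed sets.sigma_sets_eq eq)
  also have "\<dots> = density N (\<lambda>y. ennreal (max 0 (g y)))"
    using measure_of_of_measure[of "density N (\<lambda>y. ennreal (max 0 (g y)))"] by simp
  finally show ?thesis .
qed

text \<open>Each of the four upper variations has a density, the positive part of
  \<open>Re g\<close>, \<open>- Re g\<close>, \<open>Im g\<close> or \<open>- Im g\<close>. These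
  are integrated separately, so \<open>g\<close> may have infinite mass although
  \<open>\<nu>\<close> is controlled only on sets where \<open>g\<close> is integrable.\<close>

lemma cm_integral_eq_dens_int:
  assumes D: "D \<subseteq> sets N" and down: "\<And>A B. A \<in> D \<Longrightarrow> B \<in> sets N \<Longrightarrow> B \<subseteq> A \<Longrightarrow> B \<in> D"
    and nu: "\<And>A. A \<in> D \<Longrightarrow> set_integrable N A g \<and> \<nu> A = (LINT y:A|N. g y)"
    and C: "range C \<subseteq> D" "incseq C" "\<And>y. y \<in> space N \<Longrightarrow> g y \<noteq> 0 \<Longrightarrow> y \<in> (\<Union>n. C n)"
    and [measurable]: "g \<in> borel_measurable N" "f \<in> borel_measurable N"
  shows "cm_integral N D \<nu> f = dens_int N g f"
proof -
  have nu': "integrable N (\<lambda>y. indicator A y *\<^sub>R g y)" "\<nu> A = (\<integral>y. indicator A y *\<^sub>R g y \<partial>N)" if "A \<in> D" for A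
    using nu[OF that] by (auto simp: set_integrable_def set_lebesgue_integral_def)
  have r: "set_integrable N A (\<lambda>y. Re (g y)) \<and> Re (\<nu> A) = (LINT y:A|N. Re (g y))"
    "set_integrable N A (\<lambda>y. Im (g y)) \<and> Im (\<nu> A) = (LINT y:A|N. Im (g y))" if "A \<in> D" for A
    using integrable_Re[OF nu'(1)[OF that]] integrable_Im[OF nu'(1)[OF that]] nu'(1)[OF that]
    by (auto simp: set_integrable_def set_lebesgue_integral_def nu'(2)[OF that] simp flip: integral_Re integral_Im)
  have rm: "set_integrable N A (\<lambda>y. - Re (g y)) \<and> - Re (\<nu> A) = (LINT y:A|N. - Re (g y))"
    "set_integrable N A (\<lambda>y. - Im (g y)) \<and> - Im (\<nu> A) = (LINT y:A|N. - Im (g y))" if "A \<in> D" for A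
    using r[OF that] by (auto simp: set_integrable_def set_lebesgue_integral_def)
  have cov: "Re (g y) \<noteq> 0 \<Longrightarrow> y \<in> (\<Union>n. C n)" "- Re (g y) \<noteq> 0 \<Longrightarrow> y \<in> (\<Union>n. C n)"
    "Im (g y) \<noteq> 0 \<Longrightarrow> y \<in> (\<Union>n. C n)" "- Im (g y) \<noteq> 0 \<Longrightarrow> y \<in> (\<Union>n. C n)"
    if "y \<in> space N" for y
    using C(3)[OF that] by (cases "g y = 0"; simp)+
  have u: "upper_variation N D (\<lambda>A. Re (\<nu> A)) = density N (\<lambda>y. ennreal (max 0 (Re (g y))))"
    "upper_variation N D (\<lambda>A. - Re (\<nu> A)) = density N (\<lambda>y. ennreal (max 0 (- Re (g y))))"
    "upper_variation N D (\<lambda>A. Im (\<nu> A)) = density N (\<lambda>y. ennreal (max 0 (Im (g y))))"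
    "upper_variation N D (\<lambda>A. - Im (\<nu> A)) = density N (\<lambda>y. ennreal (max 0 (- Im (g y))))"
    by (rule upper_variation_eq_density[OF D down r(1) C(1,2) cov(1)]
          upper_variation_eq_density[OF D down rm(1) C(1,2) cov(2)]
          upper_variation_eq_density[OF D down r(2) C(1,2) cov(3)]
          upper_variation_eq_density[OF D down rm(2) C(1,2) cov(4)]; (assumption | measurable))+
  show ?thesis unfolding cm_integral_def u dens_int_def
    by (simp add: integral_density)
qed

section \<open>Total variation of a complex density\<close>

lemma emeasure_density_norm:
  fixes h :: "'a \<Rightarrow> complex"
  assumes h: "integrable N h" and B[measurable]: "B \<in> sets N"
  shows "emeasure (density N (\<lambda>y. ennreal (cmod (h y)))) B = ennreal (LINT y:B|N. cmod (h y))"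
proof -
  have [measurable]: "h \<in> borel_measurable N" using h by auto
  have i: "integrable N (\<lambda>y. indicator B y * cmod (h y))"
    using integrable_mult_indicator[OF B integrable_norm[OF h]] by simp
  have "emeasure (density N (\<lambda>y. ennreal (cmod (h y)))) B = (\<integral>\<^sup>+y. ennreal (indicator B y * cmod (h y)) \<partial>N)"
    by (simp add: emeasure_density) (auto intro!: nn_integral_cong split: split_indicator)
  then show ?thesis
    using nn_integral_eq_integral[OF i] by (simp add: set_lebesgue_integral_def)
qed

text \<open>The integral of \<open>h\<close> differs from \<open>c\<close> times the integral of
  \<open>cmod h\<close> by at most the share \<open>\<delta>\<close> of the latter. The number
  \<open>c\<close> need not have modulus 1, but a point of \<open>E\<close> with
  \<open>h y \<noteq> 0\<close> forces \<open>cmod c \<ge> 1 - \<delta>\<close>. The two losses make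
  up the factor \<open>1 - 2 * \<delta>\<close>.\<close>

lemma norm_set_integral_ge_of_nearly_constant_argument:
  fixes h :: "'a \<Rightarrow> complex" and c :: complex
  assumes h: "integrable N h" and E[measurable]: "E \<in> sets N" and "0 \<le> \<delta>"
    and close: "\<And>y. y \<in> E \<Longrightarrow> cmod (h y - c * cmod (h y)) \<le> \<delta> * cmod (h y)"
  shows "(1 - 2 * \<delta>) * (LINT y:E|N. cmod (h y)) \<le> cmod (LINT y:E|N. h y)"
proof (cases "\<forall>y\<in>E. h y = 0")
  case True
  then have "(LINT y:E|N. cmod (h y)) = (LINT y:E|N. 0)"
    by (intro set_lebesgue_integral_cong) auto
  then show ?thesis by simp
next
  case False
  then obtain y where y: "y \<in> E" "h y \<noteq> 0" by auto
  have "cmod (h y) \<le> cmod (h y - c * cmod (h y)) + cmod (c * cmod (h y))"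
    using norm_triangle_ineq[of "h y - c * cmod (h y)" "c * cmod (h y)"] by simp
  also have "\<dots> \<le> \<delta> * cmod (h y) + cmod c * cmod (h y)"
    using close[OF y(1)] by (simp add: norm_mult)
  finally have c: "1 \<le> \<delta> + cmod c"
    using y(2) by (metis (no_types, opaque_lifting) distrib_right mult.commute mult.right_neutral mult_le_cancel_left_pos zero_less_norm_iff)
  have hs: "set_integrable N E h" "set_integrable N E (\<lambda>y. cmod (h y))"
    using integrable_mult_indicator[OF E h] integrable_mult_indicator[OF E integrable_norm[OF h]]
    by (simp_all add: set_integrable_def)
  have hs2: "set_integrable N E (\<lambda>y. complex_of_real (cmod (h y)))"
    using hs(2) unfolding set_integrable_def by (auto dest!: integrable_of_real[where 'a=complex] simp: scaleR_conv_of_real)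
  define a where "a = (LINT y:E|N. cmod (h y))"
  have a0: "0 \<le> a" unfolding a_def set_lebesgue_integral_def by (intro integral_nonneg_AE) auto
  have "(LINT y:E|N. h y) - c * a = (LINT y:E|N. h y - c * cmod (h y))"
    using hs(1) hs2 unfolding a_def by (simp add: set_integral_complex_of_real)
  also have "cmod \<dots> \<le> (LINT y:E|N. cmod (h y - c * cmod (h y)))"
    by (rule set_integral_norm_bound) (use hs(1) hs2 in auto)
  also have "\<dots> \<le> (LINT y:E|N. \<delta> * cmod (h y))"
    by (rule set_integral_mono) (use hs hs2 close in \<open>auto intro!: set_integrable_norm\<close>)
  also have "\<dots> = \<delta> * a" by (simp add: a_def)
  finally have 1: "cmod ((LINT y:E|N. h y) - c * a) \<le> \<delta> * a" .
  have "cmod c * a = cmod (c * a)" using a0 by (simp add: norm_mult)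
  also have "\<dots> \<le> cmod (LINT y:E|N. h y) + cmod ((LINT y:E|N. h y) - c * a)"
    by (metis norm_minus_commute norm_triangle_sub add.commute)
  finally have "cmod c * a - \<delta> * a \<le> cmod (LINT y:E|N. h y)" using 1 by simp
  moreover have "(1 - 2 * \<delta>) * a \<le> cmod c * a - \<delta> * a"
    using mult_right_mono[OF c a0] by (simp add: algebra_simps)
  ultimately show ?thesis unfolding a_def by linarith
qed

text \<open>
  The lower bound comes from partitions into sets on which \<open>h\<close> has almost constant argument, the
  directions being approximated by a countable dense subset of the plane.
\<close>
lemma total_variation_eq_nn_integral:
  fixes h :: "'a \<Rightarrow> complex"
  assumes h: "integrable N h" and nu: "\<And>A. A \<in> sets N \<Longrightarrow> \<nu> A = (LINT y:A|N. h y)"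
    and B[measurable]: "B \<in> sets N"
  shows "total_variation N \<nu> B = (\<integral>\<^sup>+y. ennreal (cmod (h y)) * indicator B y \<partial>N)"
proof -
  have [measurable]: "h \<in> borel_measurable N" using h by auto
  let ?d = "density N (\<lambda>y. ennreal (cmod (h y)))"
  have sum_d: "(\<Sum>i. emeasure ?d (E i)) = emeasure ?d B"
    if "range E \<subseteq> sets N" "disjoint_family E" "(\<Union>i. E i) = B" for E :: "nat \<Rightarrow> 'a set"
    using suminf_emeasure[of E ?d] that by simp
  have up: "total_variation N \<nu> B \<le> emeasure ?d B"
    unfolding total_variation_def
  proof (rule SUP_least, clarify)
    fix E :: "nat \<Rightarrow> 'a set" assume E: "range E \<subseteq> sets N" "disjoint_family E" "B = (\<Union>i. E i)"
    have "ennreal (cmod (\<nu> (E i))) \<le> emeasure ?d (E i)" for i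
    proof -
      have [measurable]: "E i \<in> sets N" using E by auto
      have "set_integrable N (E i) h" using integrable_mult_indicator[of "E i", OF _ h] by (simp add: set_integrable_def)
      then show ?thesis
        by (simp add: nu emeasure_density_norm[OF h] set_integral_norm_bound ennreal_leI)
    qed
    then have "(\<Sum>i. ennreal (cmod (\<nu> (E i)))) \<le> (\<Sum>i. emeasure ?d (E i))"
      by (intro suminf_le) auto
    also have "\<dots> = emeasure ?d (\<Union>i. E i)" using sum_d[of E] E by simp
    finally show "(\<Sum>i. ennreal (cmod (\<nu> (E i)))) \<le> emeasure ?d (\<Union>i. E i)" .
  qed
  obtain X :: "complex set" where X: "countable X" "\<And>U. open U \<Longrightarrow> U \<noteq> {} \<Longrightarrow> \<exists>x\<in>X. x \<in> U"
    using countable_dense_exists by blast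
  have Xne: "X \<noteq> {}" using X(2)[of UNIV] by auto
  define c where "c = from_nat_into X"
  have rc: "range c = X" unfolding c_def using range_from_nat_into[OF Xne X(1)] .
  have low: "ennreal z * emeasure ?d B \<le> total_variation N \<nu> B" if z: "0 < z" "z < 1" for z :: real
  proof -
    \<comment> \<open>The choice makes the factor \<open>1 - 2 * \<delta>\<close> of the lower
      estimate equal to \<open>z\<close>.\<close>
    define \<delta> where "\<delta> = (1 - z) / 2"
    have \<delta>: "0 < \<delta>" "1 - 2 * \<delta> = z" using z by (auto simp: \<delta>_def field_simps)
    define C where "C i = {y \<in> space N. cmod (h y - c i * cmod (h y)) \<le> \<delta> * cmod (h y)}" for i
    have [measurable]: "C i \<in> sets N" for i unfolding C_def by measurable
    \<comment> \<open>A zero of \<open>h\<close> lies in every \<open>C i\<close>; elsewhere some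
      direction in the dense range of \<open>c\<close> is close to
      \<open>h y / cmod (h y)\<close>.\<close>
    have cov: "\<exists>i. y \<in> C i" if "y \<in> space N" for y
    proof (cases "h y = 0")
      case True then show ?thesis using that by (auto simp: C_def)
    next
      case False
      have "ball (h y / cmod (h y)) \<delta> \<noteq> {}" using \<delta> by simp
      then obtain i where i: "c i \<in> ball (h y / cmod (h y)) \<delta>" using X(2)[of "ball (h y / cmod (h y)) \<delta>"] rc by (metis open_ball rangeE)
      have "h y - c i * cmod (h y) = (h y / cmod (h y) - c i) * cmod (h y)"
        using False by (simp add: field_simps)
      then have "cmod (h y - c i * cmod (h y)) \<le> \<delta> * cmod (h y)"
        using i by (auto simp: norm_mult dist_norm intro!: mult_right_mono)
      then show ?thesis using that by (auto simp: C_def)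
    qed
    define E where "E i = B \<inter> disjointed C i" for i
    have Em[measurable]: "E i \<in> sets N" for i
      using sets.range_disjointed_sets[of C N] unfolding E_def by (intro sets.Int B) (auto simp: image_subset_iff)
    have disj: "disjoint_family E"
      using disjoint_family_disjointed[of C] unfolding E_def disjoint_family_on_def by blast
    have un: "(\<Union>i. E i) = B"
    proof -
      have "(\<Union>i. E i) = B \<inter> (\<Union>i. C i)" unfolding E_def by (simp add: UN_disjointed_eq flip: Int_UN_distrib)
      then show ?thesis using cov sets.sets_into_space[OF B] by auto
    qed
    have "ennreal z * emeasure ?d (E i) \<le> ennreal (cmod (\<nu> (E i)))" for i
    proof -
      have "z * (LINT y:E i|N. cmod (h y)) \<le> cmod (\<nu> (E i))"
        unfolding nu[OF Em] \<delta>(2)[symmetric]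
        by (rule norm_set_integral_ge_of_nearly_constant_argument[where \<delta> = \<delta> and c = "c i", OF h Em])
          (use \<delta> disjointed_subset[of C i] in \<open>auto simp: E_def C_def\<close>)
      then show ?thesis
        using z by (simp add: emeasure_density_norm[OF h] ennreal_leI flip: ennreal_mult')
    qed
    then have "(\<Sum>i. ennreal z * emeasure ?d (E i)) \<le> (\<Sum>i. ennreal (cmod (\<nu> (E i))))"
      by (intro suminf_le) auto
    also have "\<dots> \<le> total_variation N \<nu> B"
      unfolding total_variation_def by (rule SUP_upper) (use disj un Em in auto)
    finally show ?thesis using sum_d[OF _ disj un] Em by (simp add: image_subset_iff)
  qed
  have fin: "emeasure ?d B = ennreal (LINT y:B|N. cmod (h y))" by (rule emeasure_density_norm[OF h B])
  have "emeasure ?d B \<le> total_variation N \<nu> B"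
  proof -
    \<comment> \<open>Finiteness, known from the upper bound, permits letting \<open>z\<close> tend
      to 1 in the reals.\<close>
    obtain t where t: "total_variation N \<nu> B = ennreal t" "0 \<le> t"
      using up unfolding fin by (cases "total_variation N \<nu> B") (auto simp: top_unique)
    have "z * (LINT y:B|N. cmod (h y)) \<le> t" if "0 < z" "z < 1" for z
      using low[OF that] that t unfolding fin by (simp flip: ennreal_mult')
    then have "(LINT y:B|N. cmod (h y)) \<le> t" by (rule field_le_mult_one_interval)
    then show ?thesis unfolding fin t(1) by (rule ennreal_leI)
  qed
  then show ?thesis using up by (auto simp: emeasure_density)
qed

text \<open>This turns condition (2) of a type B set, a bound on the values \<open>\<nu> B\<close>,
  into a bound on integrals against the variation. Every partition sum inherits the bound by
  countable additivity of the measure, hence so does the total variation, and the inequality between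
  measures passes to integrals.\<close>

lemma nn_integral_le_of_set_function_le:
  fixes h :: "'a \<Rightarrow> complex"
  assumes h: "integrable N h" and nu: "\<And>A. A \<in> sets N \<Longrightarrow> \<nu> A = (LINT y:A|N. h y)"
    and C[measurable]: "C \<in> sets N"
    and le: "\<And>B. B \<in> sets N \<Longrightarrow> B \<subseteq> C \<Longrightarrow> ennreal (cmod (\<nu> B)) \<le> ennreal m * emeasure N B"
    and [measurable]: "g \<in> borel_measurable N"
  shows "(\<integral>\<^sup>+y. ennreal (cmod (h y)) * (indicator C y * g y) \<partial>N) \<le> ennreal m * (\<integral>\<^sup>+y. indicator C y * g y \<partial>N)"
proof -
  have [measurable]: "h \<in> borel_measurable N" using h by auto
  let ?d1 = "density N (\<lambda>y. ennreal (cmod (h y)) * indicator C y)"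
  let ?d2 = "density N (\<lambda>y. ennreal m * indicator C y)"
  have "emeasure ?d1 B \<le> emeasure ?d2 B" if [measurable]: "B \<in> sets N" for B
  proof -
    have "emeasure ?d1 B = total_variation N \<nu> (B \<inter> C)"
      by (simp add: total_variation_eq_nn_integral[OF h nu] emeasure_density)
        (auto intro!: nn_integral_cong split: split_indicator)
    also have "\<dots> \<le> ennreal m * emeasure N (B \<inter> C)"
      unfolding total_variation_def
    proof (rule SUP_least, clarify)
      fix E :: "nat \<Rightarrow> 'a set" assume E: "range E \<subseteq> sets N" "disjoint_family E" "(\<Union>i. E i) = B \<inter> C"
      have "(\<Sum>i. ennreal (cmod (\<nu> (E i)))) \<le> (\<Sum>i. ennreal m * emeasure N (E i))"
        using E by (intro suminf_le le) auto
      then show "(\<Sum>i. ennreal (cmod (\<nu> (E i)))) \<le> ennreal m * emeasure N (B \<inter> C)"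
        using suminf_emeasure[OF E(1,2)] E(3) by simp
    qed
    also have "\<dots> = emeasure ?d2 B"
      by (simp add: emeasure_density mult.assoc nn_integral_cmult flip: indicator_inter_arith)
        (simp add: Int_commute)
    finally show ?thesis .
  qed
  then have "?d1 \<le> ?d2" by (subst le_measure) (auto simp: le_fun_def)
  then have "(\<integral>\<^sup>+y. g y \<partial>?d1) \<le> (\<integral>\<^sup>+y. g y \<partial>?d2)" by (intro nn_integral_mono_measure) auto
  then show ?thesis by (simp add: nn_integral_density mult.assoc nn_integral_cmult)
qed

section \<open>The Neumann series on the complement of the structural set\<close>

lemma
  fixes f :: "nat \<Rightarrow> 'a \<Rightarrow> 'b :: {banach, second_countable_topology}"
  assumes [measurable]: "\<And>i. f i \<in> borel_measurable N"
    and fin: "(\<Sum>i. \<integral>\<^sup>+x. ennreal (norm (f i x)) \<partial>N) < \<infinity>"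
  shows integrable_of_suminf_finite: "integrable N (f i)"
    and integrable_suminf_of_suminf_finite: "integrable N (\<lambda>x. \<Sum>i. f i x)"
    and sums_integral_of_suminf_finite: "(\<lambda>i. integral\<^sup>L N (f i)) sums (\<integral>x. (\<Sum>i. f i x) \<partial>N)"
proof -
  have int: "integrable N (f i)" for i
  proof (rule integrableI_bounded)
    have "(\<integral>\<^sup>+x. ennreal (norm (f i x)) \<partial>N) \<le> (\<Sum>i. \<integral>\<^sup>+x. ennreal (norm (f i x)) \<partial>N)"
      using sum_le_suminf[of "\<lambda>i. \<integral>\<^sup>+x. ennreal (norm (f i x)) \<partial>N" "{i}"] by simp
    then show "(\<integral>\<^sup>+x. ennreal (norm (f i x)) \<partial>N) < \<infinity>" using fin by (rule le_less_trans)
  qed measurable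
  then show "integrable N (f i)" .
  have "(\<integral>\<^sup>+x. (\<Sum>i. ennreal (norm (f i x))) \<partial>N) \<noteq> \<infinity>"
    using fin by (simp add: nn_integral_suminf)
  then have "AE x in N. (\<Sum>i. ennreal (norm (f i x))) \<noteq> \<infinity>"
    by (intro nn_integral_PInf_AE) auto
  then have ae: "AE x in N. summable (\<lambda>i. norm (f i x))"
    by eventually_elim (auto intro: summable_suminf_not_top)
  have "ennreal (\<integral>x. norm (f i x) \<partial>N) = (\<integral>\<^sup>+x. ennreal (norm (f i x)) \<partial>N)" for i
    using int[of i] by (intro nn_integral_eq_integral[symmetric]) auto
  then have "summable (\<lambda>i. \<integral>x. norm (f i x) \<partial>N)"
    using fin by (intro summable_suminf_not_top) auto
  note s = integrable_suminf[OF int ae this] sums_integral[OF int ae this]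
  then show "integrable N (\<lambda>x. \<Sum>i. f i x)" "(\<lambda>i. integral\<^sup>L N (f i)) sums (\<integral>x. (\<Sum>i. f i x) \<partial>N)" by auto
qed

lemma ennreal_le_mult_finite: "a \<le> ennreal c * b \<Longrightarrow> b < \<infinity> \<Longrightarrow> a < \<infinity>"
  by (erule le_less_trans) (simp add: ennreal_mult_less_top)

text \<open>
  \<open>M\<close> is the majorant of condition (2) of a type B set, extended by 0 to \<open>S\<close>. The sets \<open>E n\<close> stand for
  the depth sets; assumptions \<open>E_union\<close> and \<open>h_vanish\<close> are what remains of the pointwise nilpotency
  condition (1), in a form that, unlike \<open>n\<^sub>S\<close>, is measurable.
\<close>
locale reduction = sigma_finite_measure N for N :: "'a measure" +
  fixes h :: "'a \<Rightarrow> 'a \<Rightarrow> complex" and d :: "'a \<Rightarrow> complex" and S :: "'a set" and z0 :: complex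
    and H \<epsilon> D :: real and M :: "'a \<Rightarrow> real" and E :: "nat \<Rightarrow> 'a set"
  assumes h_pair: "case_prod h \<in> borel_measurable (N \<Otimes>\<^sub>M N)"
    and H_nonneg: "0 \<le> H"
    and h_bound: "\<And>y. y \<in> space N \<Longrightarrow> (\<integral>\<^sup>+x. ennreal (cmod (h x y)) \<partial>N) \<le> ennreal H"
    and S_sets[measurable]: "S \<in> sets N"
    and d_measurable[measurable]: "d \<in> borel_measurable N"
    and d_bound: "\<And>x. x \<in> space N \<Longrightarrow> cmod (d x) \<le> D"
    and \<epsilon>_pos: "0 < \<epsilon>"
    and \<epsilon>_le: "\<And>x. x \<in> space N - S \<Longrightarrow> \<epsilon> \<le> cmod (z0 - d x)"
    and M_integrable: "integrable N M"
    and M_nonneg: "\<And>x. x \<in> space N \<Longrightarrow> 0 \<le> M x"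
    and dominated: "\<And>x g. x \<in> space N - S \<Longrightarrow> g \<in> borel_measurable N \<Longrightarrow>
      (\<integral>\<^sup>+y. ennreal (cmod (h x y)) * (indicator (space N - S) y * g y) \<partial>N)
        \<le> ennreal (M x) * (\<integral>\<^sup>+y. indicator (space N - S) y * g y \<partial>N)"
    and E_0: "E 0 = S"
    and E_sets[measurable]: "\<And>n. E n \<in> sets N"
    and E_Suc: "\<And>n. E n \<subseteq> E (Suc n)"
    and E_union: "(\<Union>n. E n) = space N"
    and h_vanish: "\<And>n x. x \<in> E (Suc n) - S \<Longrightarrow> AE y in N. y \<notin> E n \<longrightarrow> h x y = 0"
begin

section \<open>The integral operators and their absolute counterparts\<close>

lemma h_measurable[measurable (raw)]:
  assumes "f \<in> measurable P N" "g \<in> measurable P N"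
  shows "(\<lambda>w. h (f w) (g w)) \<in> borel_measurable P"
  using measurable_compose[OF measurable_Pair[OF assms] h_pair] by simp

definition q :: "'a \<Rightarrow> complex" where
  "q y = indicator (space N - S) y / (z0 - d y)"

text \<open>Convergence is settled first for this \<open>ennreal\<close> companion of
  \<open>Hop\<close>, where Tonelli and monotone convergence ask for no integrability, and is then
  transferred by \<open>Hop_bound\<close> and \<open>Lop_pow_bound\<close>.\<close>

definition absH :: "('a \<Rightarrow> ennreal) \<Rightarrow> 'a \<Rightarrow> ennreal" where
  "absH f x = (\<integral>\<^sup>+y. ennreal (cmod (h x y)) * f y \<partial>N)"

definition absL :: "('a \<Rightarrow> ennreal) \<Rightarrow> 'a \<Rightarrow> ennreal" where
  "absL f = absH (\<lambda>y. ennreal (cmod (q y)) * f y)"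

text \<open>With \<open>dens_int\<close> in place of the Bochner integral of the product, the
  operator agrees with \<open>cm_integral\<close> at every point of the space for measurable
  \<open>f\<close>, even where the product is not integrable.\<close>

definition Hop :: "('a \<Rightarrow> complex) \<Rightarrow> 'a \<Rightarrow> complex" where
  "Hop f x = dens_int N (h x) f"

definition Lop :: "('a \<Rightarrow> complex) \<Rightarrow> 'a \<Rightarrow> complex" where
  "Lop f = Hop (\<lambda>y. q y * f y)"

lemma absL_apply: "absL f x = (\<integral>\<^sup>+y. ennreal (cmod (h x y)) * (ennreal (cmod (q y)) * f y) \<partial>N)"
  unfolding absL_def absH_def ..

lemma Lop_apply: "Lop f x = dens_int N (h x) (\<lambda>y. q y * f y)"
  unfolding Lop_def Hop_def ..

lemma absL_pow_Suc:
  "(absL ^^ Suc n) g x = (\<integral>\<^sup>+y. ennreal (cmod (h x y)) * (ennreal (cmod (q y)) * (absL ^^ n) g y) \<partial>N)"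
  using absL_apply[of "(absL ^^ n) g" x] by simp

lemma Lop_pow_Suc: "(Lop ^^ Suc n) g x = dens_int N (h x) (\<lambda>y. q y * (Lop ^^ n) g y)"
  using Lop_apply[of "(Lop ^^ n) g" x] by simp

lemma q_measurable[measurable]: "q \<in> borel_measurable N"
  unfolding q_def[abs_def] by measurable

lemma q_on_S: "x \<in> S \<Longrightarrow> q x = 0"
  by (simp add: q_def)

lemma q_off_S: "x \<in> space N - S \<Longrightarrow> q x * (z0 - d x) = 1"
  using \<epsilon>_le[of x] \<epsilon>_pos by (auto simp: q_def)

lemma cmod_q_le: "x \<in> space N \<Longrightarrow> cmod (q x) \<le> 1 / \<epsilon>"
  using \<epsilon>_le[of x] \<epsilon>_pos
  by (cases "x \<in> S") (auto simp: q_def norm_divide divide_simps indicator_def)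

lemma absH_measurable[measurable]:
  assumes [measurable]: "f \<in> borel_measurable N"
  shows "absH f \<in> borel_measurable N"
  unfolding absH_def[abs_def] by measurable

lemma absL_measurable[measurable]: "f \<in> borel_measurable N \<Longrightarrow> absL f \<in> borel_measurable N"
  unfolding absL_def by measurable

lemma absL_pow_measurable[measurable]: "f \<in> borel_measurable N \<Longrightarrow> (absL ^^ n) f \<in> borel_measurable N"
  by (induction n) auto

lemma Hop_measurable[measurable]:
  assumes [measurable]: "f \<in> borel_measurable N"
  shows "Hop f \<in> borel_measurable N"
  unfolding Hop_def[abs_def] by (rule measurable_dens_int[OF sigma_finite_measure_axioms]) measurable

lemma Lop_measurable[measurable]: "f \<in> borel_measurable N \<Longrightarrow> Lop f \<in> borel_measurable N"
  unfolding Lop_def by measurable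

lemma Lop_pow_measurable[measurable]: "f \<in> borel_measurable N \<Longrightarrow> (Lop ^^ n) f \<in> borel_measurable N"
  by (induction n) auto

lemma absH_mono: "(\<And>y. y \<in> space N \<Longrightarrow> f y \<le> g y) \<Longrightarrow> absH f x \<le> absH g x"
  unfolding absH_def by (intro nn_integral_mono mult_left_mono) auto

lemma absL_mono: "(\<And>y. y \<in> space N \<Longrightarrow> f y \<le> g y) \<Longrightarrow> absL f x \<le> absL g x"
  unfolding absL_def by (intro absH_mono mult_left_mono) auto

lemma absL_pow_mono:
  "(\<And>y. y \<in> space N \<Longrightarrow> f y \<le> g y) \<Longrightarrow> x \<in> space N \<Longrightarrow> (absL ^^ n) f x \<le> (absL ^^ n) g x"
  by (induction n arbitrary: x) (auto intro!: absL_mono)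

lemma Hop_bound:
  "f \<in> borel_measurable N \<Longrightarrow> x \<in> space N \<Longrightarrow> ennreal (cmod (Hop f x)) \<le> absH (\<lambda>y. ennreal (cmod (f y))) x"
  unfolding Hop_def absH_def by (rule dens_int_bound) auto

lemma Lop_bound:
  "f \<in> borel_measurable N \<Longrightarrow> x \<in> space N \<Longrightarrow> ennreal (cmod (Lop f x)) \<le> absL (\<lambda>y. ennreal (cmod (f y))) x"
  using Hop_bound[of "\<lambda>y. q y * f y" x] unfolding Lop_def absL_def by (simp add: norm_mult ennreal_mult)

lemma Lop_pow_bound:
  assumes "f \<in> borel_measurable N" "x \<in> space N"
  shows "ennreal (cmod ((Lop ^^ n) f x)) \<le> (absL ^^ n) (\<lambda>y. ennreal (cmod (f y))) x"
  using assms
proof (induction n arbitrary: x)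
  case (Suc n)
  have "ennreal (cmod ((Lop ^^ Suc n) f x)) \<le> absL (\<lambda>y. ennreal (cmod ((Lop ^^ n) f y))) x"
    using Lop_bound[of "(Lop ^^ n) f" x] Suc.prems by simp
  also have "\<dots> \<le> (absL ^^ Suc n) (\<lambda>y. ennreal (cmod (f y))) x"
    using Suc by (auto intro!: absL_mono)
  finally show ?case .
qed simp

lemma Hop_integral:
  assumes [measurable]: "f \<in> borel_measurable N" and x: "x \<in> space N"
    and fin: "absH (\<lambda>y. ennreal (cmod (f y))) x < \<infinity>"
  shows "integrable N (\<lambda>y. h x y * f y)" "Hop f x = (\<integral>y. h x y * f y \<partial>N)"
proof -
  show "integrable N (\<lambda>y. h x y * f y)"
    using fin x by (intro integrableI_bounded) (auto simp: norm_mult ennreal_mult absH_def)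
  then show "Hop f x = (\<integral>y. h x y * f y \<partial>N)"
    unfolding Hop_def using x by (intro dens_int_eq_integral) auto
qed

lemma Hop_cong_AE:
  assumes "f \<in> borel_measurable N" "g \<in> borel_measurable N" "AE y in N. f y = g y" "x \<in> space N"
  shows "Hop f x = Hop g x"
  unfolding Hop_def using assms by (intro dens_int_cong_AE) (auto elim!: eventually_mono)

text \<open>After Tonelli the inner integral runs over the first variable of \<open>h\<close>, which
  is exactly what the \<open>(1,\<infinity>)\<close>-norm bounds.\<close>

lemma nn_integral_absH_le:
  assumes [measurable]: "f \<in> borel_measurable N"
  shows "(\<integral>\<^sup>+x. absH f x \<partial>N) \<le> ennreal H * (\<integral>\<^sup>+x. f x \<partial>N)"
proof -
  interpret P: pair_sigma_finite N N ..
  have "(\<integral>\<^sup>+x. absH f x \<partial>N) = (\<integral>\<^sup>+y. (\<integral>\<^sup>+x. ennreal (cmod (h x y)) * f y \<partial>N) \<partial>N)"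
    unfolding absH_def by (rule P.Fubini'[symmetric]) measurable
  also have "\<dots> = (\<integral>\<^sup>+y. (\<integral>\<^sup>+x. ennreal (cmod (h x y)) \<partial>N) * f y \<partial>N)"
    by (intro nn_integral_cong nn_integral_multc) measurable
  also have "\<dots> \<le> (\<integral>\<^sup>+y. ennreal H * f y \<partial>N)"
    by (intro nn_integral_mono mult_right_mono h_bound) auto
  also have "\<dots> = ennreal H * (\<integral>\<^sup>+x. f x \<partial>N)" by (simp add: nn_integral_cmult)
  finally show ?thesis .
qed

lemma AE_absH_finite:
  assumes [measurable]: "f \<in> borel_measurable N" and "(\<integral>\<^sup>+x. f x \<partial>N) < \<infinity>"
  shows "AE x in N. absH f x < \<infinity>"
proof -
  have "(\<integral>\<^sup>+x. absH f x \<partial>N) < \<infinity>"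
    by (rule ennreal_le_mult_finite[OF nn_integral_absH_le]) (use assms in auto)
  then have "AE x in N. absH f x \<noteq> \<infinity>" by (intro nn_integral_PInf_AE) auto
  then show ?thesis by (auto simp: less_top)
qed

section \<open>Decay of the iterates along the depth sets\<close>

lemma E_mono: "m \<le> n \<Longrightarrow> E m \<subseteq> E n"
  using E_Suc by (rule lift_Suc_mono_le)

text \<open>From a point of \<open>E (Suc n)\<close> off \<open>S\<close> the kernel leads only into
  \<open>E n\<close>. After \<open>n\<close> steps from depth \<open>n\<close> every chain has
  therefore reached \<open>E 0 = S\<close>, where \<open>q\<close> is zero.\<close>

lemma absL_pow_vanish:
  assumes [measurable]: "g \<in> borel_measurable N" and x: "x \<in> E n - S"
  shows "(absL ^^ n) g x = 0"
  using x
proof (induction n arbitrary: x)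
  case 0 then show ?case using E_0 by auto
next
  case (Suc n)
  have "AE y in N. ennreal (cmod (h x y)) * (ennreal (cmod (q y)) * (absL ^^ n) g y) = 0"
    using h_vanish[OF Suc.prems]
  proof eventually_elim
    case (elim y)
    then show ?case using Suc.IH[of y] by (cases "y \<in> E n"; cases "y \<in> S") (auto simp: q_on_S)
  qed
  then show ?case
    using sets.sets_into_space[OF E_sets[of "Suc n"]] Suc.prems
    by (simp add: absL_pow_Suc nn_integral_0_iff_AE[THEN iffD2] subset_iff del: funpow.simps)
qed

text \<open>The integral is the mass of the majorant beyond depth \<open>n\<close>; the factor
  \<open>1 / \<epsilon>\<close> bounds \<open>cmod q\<close>.\<close>

definition depth_tail :: "nat \<Rightarrow> real" where
  "depth_tail n = (1 / \<epsilon>) * (\<integral>x. indicator (space N - E n) x * M x \<partial>N)"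

lemma depth_tail_nonneg: "0 \<le> depth_tail n"
  unfolding depth_tail_def using \<epsilon>_pos M_nonneg
  by (intro mult_nonneg_nonneg integral_nonneg_AE AE_I2) auto

lemma depth_tail_tendsto: "depth_tail \<longlonglongrightarrow> 0"
proof -
  have [measurable]: "M \<in> borel_measurable N" using M_integrable by auto
  have "(\<lambda>n. \<integral>x. indicator (space N - E n) x * M x \<partial>N) \<longlonglongrightarrow> (\<integral>x. 0 \<partial>N)"
  proof (rule integral_dominated_convergence[where w = M])
    show "AE x in N. (\<lambda>n. indicator (space N - E n) x * M x) \<longlonglongrightarrow> 0"
    proof (rule AE_I2)
      fix x assume "x \<in> space N"
      then obtain m where m: "x \<in> E m" using E_union by auto
      have "eventually (\<lambda>n. indicator (space N - E n) x * M x = 0) sequentially"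
        using eventually_ge_at_top[of m] by eventually_elim (use m E_mono in \<open>auto split: split_indicator\<close>)
      then show "(\<lambda>n. indicator (space N - E n) x * M x) \<longlonglongrightarrow> 0"
        by (rule tendsto_eventually)
    qed
  qed (auto intro!: M_integrable AE_I2 simp: M_nonneg split: split_indicator)
  then have "(\<lambda>n. (1 / \<epsilon>) * (\<integral>x. indicator (space N - E n) x * M x \<partial>N)) \<longlonglongrightarrow> (1 / \<epsilon>) * 0"
    by (intro tendsto_mult_left) simp
  then show ?thesis by (simp add: depth_tail_def[abs_def])
qed

text \<open>One tail enters for each application of \<open>absL\<close>, beginning with depth 1. The
  sum bounds the whole Neumann series in the norm weighted by \<open>cmod q\<close>.\<close>

definition neumann_norm :: real where
  "neumann_norm = (\<Sum>n. \<Prod>k<n. depth_tail (Suc k))"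

text \<open>The ratio of consecutive products is a tail, and the tails eventually drop below 1/2;
  finitely many large factors do no harm.\<close>

lemma summable_depth_tail_prod: "summable (\<lambda>n. \<Prod>k<n. depth_tail (Suc k))"
proof -
  have "eventually (\<lambda>n. depth_tail n < 1/2) sequentially"
    using depth_tail_tendsto by (rule order_tendstoD) simp
  then obtain n0 where n0: "\<And>n. n \<ge> n0 \<Longrightarrow> depth_tail n < 1/2" by (auto simp: eventually_sequentially)
  show ?thesis
  proof (rule summable_ratio_test[of "1/2" n0])
    fix n assume "n \<ge> n0"
    then have "depth_tail (Suc n) \<le> 1/2" using n0[of "Suc n"] by simp
    then show "norm (\<Prod>k<Suc n. depth_tail (Suc k)) \<le> 1/2 * norm (\<Prod>k<n. depth_tail (Suc k))"
      using depth_tail_nonneg mult_right_mono[of "depth_tail (Suc n)" "1/2" "\<Prod>k<n. depth_tail (Suc k)"]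
      by (simp add: abs_mult prod_nonneg mult.commute)
  qed simp
qed

lemma neumann_norm_nonneg: "0 \<le> neumann_norm"
  unfolding neumann_norm_def
  by (intro suminf_nonneg summable_depth_tail_prod prod_nonneg) (auto simp: depth_tail_nonneg)

text \<open>
  By \<open>absL_pow_vanish\<close> the iterate lives outside \<open>E (Suc n)\<close> as far as \<open>q\<close> can see it, where it is at most
  \<open>M\<close> times the previous weighted norm. The factors \<open>depth_tail\<close> tend to 0, so that the Neumann
  series converges whatever the size of \<open>M\<close>.
\<close>
lemma nn_integral_q_absL_pow_Suc:
  assumes [measurable]: "g \<in> borel_measurable N"
  shows "(\<integral>\<^sup>+x. ennreal (cmod (q x)) * (absL ^^ Suc n) g x \<partial>N)
    \<le> ennreal (depth_tail (Suc n)) * (\<integral>\<^sup>+x. ennreal (cmod (q x)) * (absL ^^ n) g x \<partial>N)"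
    (is "_ \<le> _ * ?p")
proof -
  have [measurable]: "M \<in> borel_measurable N" using M_integrable by auto
  have pt: "ennreal (cmod (q x)) * (absL ^^ Suc n) g x
      \<le> ennreal (1 / \<epsilon> * (indicator (space N - E (Suc n)) x * M x)) * ?p" if x: "x \<in> space N" for x
  proof (cases "x \<in> E (Suc n)")
    case True
    then show ?thesis using absL_pow_vanish[of g x "Suc n"] by (cases "x \<in> S") (auto simp: q_on_S)
  next
    case False
    then have xS: "x \<in> space N - S" using x E_mono[of 0 "Suc n"] E_0 by auto
    \<comment> \<open>Since \<open>q\<close> vanishes on \<open>S\<close>, the indicator of the
      complement may be inserted; \<open>dominated\<close> controls the kernel only there.\<close>
    have "(absL ^^ Suc n) g x
        = (\<integral>\<^sup>+y. ennreal (cmod (h x y)) * (indicator (space N - S) y * (ennreal (cmod (q y)) * (absL ^^ n) g y)) \<partial>N)"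
      unfolding absL_pow_Suc by (intro nn_integral_cong) (auto simp: q_on_S split: split_indicator)
    also have "\<dots> \<le> ennreal (M x) * (\<integral>\<^sup>+y. indicator (space N - S) y * (ennreal (cmod (q y)) * (absL ^^ n) g y) \<partial>N)"
      by (rule dominated[OF xS]) measurable
    also have "(\<integral>\<^sup>+y. indicator (space N - S) y * (ennreal (cmod (q y)) * (absL ^^ n) g y) \<partial>N) = ?p"
      by (intro nn_integral_cong) (auto simp: q_on_S split: split_indicator)
    finally have "ennreal (cmod (q x)) * (absL ^^ Suc n) g x \<le> ennreal (1 / \<epsilon>) * (ennreal (M x) * ?p)"
      using cmod_q_le[OF x] by (intro mult_mono ennreal_leI) auto
    moreover have "ennreal (1 / \<epsilon> * (indicator (space N - E (Suc n)) x * M x)) = ennreal (1 / \<epsilon>) * ennreal (M x)"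
      using False x \<epsilon>_pos M_nonneg[OF x] by (subst ennreal_mult) auto
    ultimately show ?thesis by (simp only: mult.assoc)
  qed
  have "(\<integral>\<^sup>+x. ennreal (cmod (q x)) * (absL ^^ Suc n) g x \<partial>N)
      \<le> (\<integral>\<^sup>+x. ennreal (1 / \<epsilon> * (indicator (space N - E (Suc n)) x * M x)) * ?p \<partial>N)"
    using pt by (rule nn_integral_mono)
  also have "\<dots> = (\<integral>\<^sup>+x. ennreal (1 / \<epsilon> * (indicator (space N - E (Suc n)) x * M x)) \<partial>N) * ?p"
    by (rule nn_integral_multc) measurable
  also have "(\<integral>\<^sup>+x. ennreal (1 / \<epsilon> * (indicator (space N - E (Suc n)) x * M x)) \<partial>N) = ennreal (depth_tail (Suc n))"
  proof -
    have "integrable N (\<lambda>x. 1 / \<epsilon> * (indicator (space N - E (Suc n)) x * M x))"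
      using integrable_mult_indicator[OF _ M_integrable, of "space N - E (Suc n)"] by (intro integrable_mult_right) auto
    then show ?thesis
      using \<epsilon>_pos M_nonneg unfolding depth_tail_def
      by (subst nn_integral_eq_integral) auto
  qed
  finally show ?thesis .
qed

lemma nn_integral_q_absL_pow:
  assumes "g \<in> borel_measurable N"
  shows "(\<integral>\<^sup>+x. ennreal (cmod (q x)) * (absL ^^ n) g x \<partial>N)
    \<le> ennreal (\<Prod>k<n. depth_tail (Suc k)) * (\<integral>\<^sup>+x. ennreal (cmod (q x)) * g x \<partial>N)"
proof (induction n)
  case (Suc n)
  have "(\<integral>\<^sup>+x. ennreal (cmod (q x)) * (absL ^^ Suc n) g x \<partial>N)
      \<le> ennreal (depth_tail (Suc n)) * (ennreal (\<Prod>k<n. depth_tail (Suc k)) * (\<integral>\<^sup>+x. ennreal (cmod (q x)) * g x \<partial>N))"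
    using nn_integral_q_absL_pow_Suc[OF assms] by (rule order_trans) (intro mult_left_mono Suc, simp)
  then show ?case
    by (simp add: ennreal_mult prod_nonneg depth_tail_nonneg mult_ac)
qed simp

section \<open>The Neumann series with absolute values\<close>

definition neumann_abs :: "('a \<Rightarrow> ennreal) \<Rightarrow> 'a \<Rightarrow> ennreal" where
  "neumann_abs g x = (\<Sum>n. (absL ^^ n) g x)"

lemma neumann_abs_measurable[measurable]: "g \<in> borel_measurable N \<Longrightarrow> neumann_abs g \<in> borel_measurable N"
  unfolding neumann_abs_def[abs_def] by measurable

lemma neumann_abs_mono:
  "(\<And>y. y \<in> space N \<Longrightarrow> f y \<le> g y) \<Longrightarrow> x \<in> space N \<Longrightarrow> neumann_abs f x \<le> neumann_abs g x"
  unfolding neumann_abs_def by (intro suminf_le absL_pow_mono) auto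

text \<open>Monotone convergence moves the sum out of \<open>absL\<close>, so the equation holds
  also where both sides are infinite.\<close>

lemma neumann_abs_eq:
  assumes [measurable]: "g \<in> borel_measurable N"
  shows "x \<in> space N \<Longrightarrow> neumann_abs g x = g x + absL (neumann_abs g) x"
proof -
  assume x[measurable]: "x \<in> space N"
  have "absL (neumann_abs g) x = (\<integral>\<^sup>+y. (\<Sum>n. ennreal (cmod (h x y)) * (ennreal (cmod (q y)) * (absL ^^ n) g y)) \<partial>N)"
    unfolding absL_def absH_def neumann_abs_def by simp
  also have "\<dots> = (\<Sum>n. (absL ^^ Suc n) g x)"
    unfolding absL_pow_Suc by (rule nn_integral_suminf) measurable
  finally show ?thesis
    using suminf_offset[of "\<lambda>n. (absL ^^ n) g x" 1] unfolding neumann_abs_def by simp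
qed

text \<open>The summand 1 belongs to \<open>g\<close> itself. In the other one, \<open>H\<close> is
  the norm of the last integration, \<open>neumann_norm\<close> bounds the weighted series, and
  \<open>1 / \<epsilon>\<close> compares the weighted norm of \<open>g\<close> with its plain
  norm.\<close>

definition solution_norm :: real where
  "solution_norm = 1 + H * (neumann_norm / \<epsilon>)"

lemma solution_norm_nonneg: "0 \<le> solution_norm"
  unfolding solution_norm_def using H_nonneg \<epsilon>_pos neumann_norm_nonneg by auto

text \<open>The decay estimate controls the series only after multiplication by \<open>q\<close>,
  hence not on \<open>S\<close>. One use of the fixed point equation recovers the full norm, because
  \<open>absL\<close> depends on its argument only through the product with
  \<open>q\<close>.\<close>

lemma nn_integral_neumann_abs:
  assumes [measurable]: "g \<in> borel_measurable N"
  shows "(\<integral>\<^sup>+x. neumann_abs g x \<partial>N) \<le> ennreal solution_norm * (\<integral>\<^sup>+x. g x \<partial>N)"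
proof -
  have "(\<integral>\<^sup>+x. ennreal (cmod (q x)) * neumann_abs g x \<partial>N) = (\<Sum>n. \<integral>\<^sup>+x. ennreal (cmod (q x)) * (absL ^^ n) g x \<partial>N)"
    unfolding neumann_abs_def by (subst nn_integral_suminf[symmetric]) auto
  also have "\<dots> \<le> (\<Sum>n. ennreal (\<Prod>k<n. depth_tail (Suc k)) * (\<integral>\<^sup>+x. ennreal (cmod (q x)) * g x \<partial>N))"
    by (intro suminf_le nn_integral_q_absL_pow) auto
  also have "\<dots> = ennreal neumann_norm * (\<integral>\<^sup>+x. ennreal (cmod (q x)) * g x \<partial>N)"
    unfolding neumann_norm_def using summable_depth_tail_prod
    by (simp add: suminf_ennreal2 prod_nonneg depth_tail_nonneg)
  also have "(\<integral>\<^sup>+x. ennreal (cmod (q x)) * g x \<partial>N) \<le> (\<integral>\<^sup>+x. ennreal (1 / \<epsilon>) * g x \<partial>N)"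
    by (intro nn_integral_mono mult_right_mono ennreal_leI cmod_q_le) auto
  also have "\<dots> = ennreal (1 / \<epsilon>) * (\<integral>\<^sup>+x. g x \<partial>N)" by (rule nn_integral_cmult) simp
  finally have qW: "(\<integral>\<^sup>+x. ennreal (cmod (q x)) * neumann_abs g x \<partial>N)
      \<le> ennreal (neumann_norm / \<epsilon>) * (\<integral>\<^sup>+x. g x \<partial>N)"
    using \<epsilon>_pos neumann_norm_nonneg by (simp add: mult_left_mono mult.assoc[symmetric] flip: ennreal_mult)
  have "(\<integral>\<^sup>+x. neumann_abs g x \<partial>N) = (\<integral>\<^sup>+x. g x + absL (neumann_abs g) x \<partial>N)"
    by (intro nn_integral_cong neumann_abs_eq) auto
  also have "\<dots> = (\<integral>\<^sup>+x. g x \<partial>N) + (\<integral>\<^sup>+x. absL (neumann_abs g) x \<partial>N)"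
    by (rule nn_integral_add) measurable
  also have "(\<integral>\<^sup>+x. absL (neumann_abs g) x \<partial>N) \<le> ennreal H * (ennreal (neumann_norm / \<epsilon>) * (\<integral>\<^sup>+x. g x \<partial>N))"
    unfolding absL_def by (rule order_trans[OF nn_integral_absH_le]) (auto intro!: mult_left_mono qW)
  finally have "(\<integral>\<^sup>+x. neumann_abs g x \<partial>N)
      \<le> (\<integral>\<^sup>+x. g x \<partial>N) + ennreal H * (ennreal (neumann_norm / \<epsilon>) * (\<integral>\<^sup>+x. g x \<partial>N))"
    by (simp add: add_left_mono)
  also have "\<dots> = ennreal solution_norm * (\<integral>\<^sup>+x. g x \<partial>N)"
  proof -
    have "ennreal solution_norm = 1 + ennreal H * ennreal (neumann_norm / \<epsilon>)"
      unfolding solution_norm_def using H_nonneg \<epsilon>_pos neumann_norm_nonneg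
      by (simp only: ennreal_plus ennreal_mult divide_nonneg_pos mult_nonneg_nonneg zero_le_one ennreal_1)
    then show ?thesis by (simp only: distrib_right mult.assoc mult_1_left)
  qed
  finally show ?thesis .
qed

lemma AE_neumann_abs_finite:
  assumes [measurable]: "g \<in> borel_measurable N" and fin: "(\<integral>\<^sup>+x. g x \<partial>N) < \<infinity>"
  shows "AE x in N. neumann_abs g x < \<infinity>"
proof -
  have "(\<integral>\<^sup>+x. neumann_abs g x \<partial>N) < \<infinity>"
    by (rule ennreal_le_mult_finite[OF nn_integral_neumann_abs]) (use assms in auto)
  then have "AE x in N. neumann_abs g x \<noteq> \<infinity>" by (intro nn_integral_PInf_AE) auto
  then show ?thesis by (auto simp: less_top)
qed

section \<open>The solution operator of the fixed point equation\<close>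

definition sol :: "('a \<Rightarrow> complex) \<Rightarrow> 'a \<Rightarrow> complex" where
  "sol g x = (\<Sum>n. (Lop ^^ n) g x)"

lemma sol_measurable[measurable]: "g \<in> borel_measurable N \<Longrightarrow> sol g \<in> borel_measurable N"
  unfolding sol_def[abs_def] by measurable

lemma summable_Lop_pow:
  assumes "g \<in> borel_measurable N" "x \<in> space N" "neumann_abs (\<lambda>y. ennreal (cmod (g y))) x < \<infinity>"
  shows "summable (\<lambda>n. norm ((Lop ^^ n) g x))"
proof (rule summable_suminf_not_top)
  have "(\<Sum>n. ennreal (norm ((Lop ^^ n) g x))) \<le> neumann_abs (\<lambda>y. ennreal (cmod (g y))) x"
    unfolding neumann_abs_def using assms by (intro suminf_le Lop_pow_bound) auto
  then show "(\<Sum>n. ennreal (norm ((Lop ^^ n) g x))) \<noteq> top" using assms(3) by (auto simp: top_unique)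
qed simp

lemma sol_bound:
  assumes "g \<in> borel_measurable N" "x \<in> space N"
  shows "ennreal (cmod (sol g x)) \<le> neumann_abs (\<lambda>y. ennreal (cmod (g y))) x"
proof (cases "neumann_abs (\<lambda>y. ennreal (cmod (g y))) x < \<infinity>")
  case True
  note s = summable_Lop_pow[OF assms True]
  have "ennreal (cmod (sol g x)) \<le> ennreal (\<Sum>n. norm ((Lop ^^ n) g x))"
    unfolding sol_def by (intro ennreal_leI summable_norm s)
  also have "\<dots> = (\<Sum>n. ennreal (norm ((Lop ^^ n) g x)))"
    using s by (intro suminf_ennreal2[symmetric]) auto
  also have "\<dots> \<le> neumann_abs (\<lambda>y. ennreal (cmod (g y))) x"
    unfolding neumann_abs_def using assms by (intro suminf_le Lop_pow_bound) auto
  finally show ?thesis .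
qed (simp add: top_unique not_less)

lemma nn_integral_sol:
  assumes [measurable]: "g \<in> borel_measurable N"
  shows "(\<integral>\<^sup>+x. ennreal (cmod (sol g x)) \<partial>N) \<le> ennreal solution_norm * (\<integral>\<^sup>+x. ennreal (cmod (g x)) \<partial>N)"
  using nn_integral_neumann_abs[of "\<lambda>y. ennreal (cmod (g y))"]
  by (intro order_trans[OF nn_integral_mono[OF sol_bound]]) auto

text \<open>Wherever the dominating series is finite, it justifies integrating the Neumann series
  term by term; shifting the index by one gives the equation.\<close>

lemma sol_eq:
  assumes [measurable]: "g \<in> borel_measurable N" and x[measurable]: "x \<in> space N"
    and fin: "neumann_abs (\<lambda>y. ennreal (cmod (g y))) x < \<infinity>"
  shows "sol g x = g x + Lop (sol g) x"
proof -
  let ?W = "neumann_abs (\<lambda>y. ennreal (cmod (g y)))"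
  let ?f = "\<lambda>n y. h x y * (q y * (Lop ^^ n) g y)"
  have LW: "absL ?W x < \<infinity>" using fin neumann_abs_eq[of "\<lambda>y. ennreal (cmod (g y))" x] by (auto simp: x)
  have f_le: "(\<Sum>n. ennreal (norm (?f n y))) \<le> ennreal (cmod (h x y)) * (ennreal (cmod (q y)) * ?W y)" if "y \<in> space N" for y
    using that unfolding neumann_abs_def
    by (simp add: norm_mult ennreal_mult) (intro mult_left_mono suminf_le Lop_pow_bound, auto)
  have "(\<Sum>n. \<integral>\<^sup>+y. ennreal (norm (?f n y)) \<partial>N) = (\<integral>\<^sup>+y. (\<Sum>n. ennreal (norm (?f n y))) \<partial>N)"
    by (subst nn_integral_suminf) auto
  also have "\<dots> \<le> absL ?W x" unfolding absL_def absH_def by (intro nn_integral_mono f_le)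
  finally have fin': "(\<Sum>n. \<integral>\<^sup>+y. ennreal (norm (?f n y)) \<partial>N) < \<infinity>" using LW by (rule le_less_trans)
  have step: "(Lop ^^ Suc n) g x = (\<integral>y. ?f n y \<partial>N)" for n
  proof -
    have "integrable N (?f n)" by (rule integrable_of_suminf_finite[OF _ fin']) measurable
    then show ?thesis unfolding Lop_pow_Suc by (intro dens_int_eq_integral) auto
  qed
  have sm: "(\<lambda>n. (Lop ^^ Suc n) g x) sums (\<integral>y. (\<Sum>n. ?f n y) \<partial>N)"
    unfolding step by (rule sums_integral_of_suminf_finite[OF _ fin']) measurable
  have "AE y in N. ennreal (cmod (h x y)) * (ennreal (cmod (q y)) * ?W y) \<noteq> \<infinity>"
    using LW unfolding absL_def absH_def by (intro nn_integral_PInf_AE) auto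
  then have "AE y in N. (\<Sum>n. ?f n y) = h x y * (q y * sol g y)"
    using AE_space
  proof eventually_elim
    case (elim y)
    \<comment> \<open>The series for \<open>sol g y\<close> may diverge where
      \<open>h x y * q y = 0\<close>, but then all terms and the right-hand side are 0.\<close>
    show ?case
    proof (cases "h x y * q y = 0")
      case True then show ?thesis by auto
    next
      case False
      then have "?W y < \<infinity>" using elim(1) by (auto simp: ennreal_mult_eq_top_iff less_top)
      then have "summable (\<lambda>n. (Lop ^^ n) g y)" using elim(2) by (intro summable_norm_cancel[OF summable_Lop_pow]) auto
      then have "(\<Sum>n. (h x y * q y) * (Lop ^^ n) g y) = (h x y * q y) * sol g y"
        unfolding sol_def by (rule suminf_mult)
      then show ?thesis by (simp add: mult.assoc)
    qed
  qed
  then have "(\<integral>y. (\<Sum>n. ?f n y) \<partial>N) = (\<integral>y. h x y * (q y * sol g y) \<partial>N)"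
    by (intro integral_cong_AE) auto
  also have "\<dots> = Lop (sol g) x"
  proof -
    have "absH (\<lambda>y. ennreal (cmod (q y * sol g y))) x \<le> absL ?W x"
      unfolding absL_def using sol_bound
      by (intro absH_mono) (auto simp: norm_mult ennreal_mult intro!: mult_left_mono)
    then show ?thesis unfolding Lop_def using LW x by (intro Hop_integral(2)[symmetric]) auto
  qed
  finally have "(\<lambda>n. (Lop ^^ Suc n) g x) sums Lop (sol g) x" using sm by simp
  then have "(\<lambda>n. (Lop ^^ n) g x) sums (Lop (sol g) x + (Lop ^^ 0) g x)"
    by (rule sums_Suc)
  then show ?thesis unfolding sol_def by (simp add: sums_iff)
qed

lemma AE_sol_eq:
  assumes "integrable N g"
  shows "AE x in N. sol g x = g x + Lop (sol g) x" "integrable N (sol g)"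
proof -
  have [measurable]: "g \<in> borel_measurable N" using assms by auto
  have fin: "(\<integral>\<^sup>+x. ennreal (cmod (g x)) \<partial>N) < \<infinity>" using assms by (simp add: integrable_iff_bounded)
  have "AE x in N. neumann_abs (\<lambda>y. ennreal (cmod (g y))) x < \<infinity>" using fin by (intro AE_neumann_abs_finite) auto
  then show "AE x in N. sol g x = g x + Lop (sol g) x"
    using AE_space by eventually_elim (rule sol_eq, auto)
  have "(\<integral>\<^sup>+x. ennreal (cmod (sol g x)) \<partial>N) < \<infinity>"
    by (rule ennreal_le_mult_finite[OF nn_integral_sol]) (use fin in auto)
  then show "integrable N (sol g)" by (intro integrableI_bounded) auto
qed

text \<open>The induction follows \<open>q \<phi>\<close> and not \<open>\<phi>\<close>, because at
  depth 0 only \<open>q\<close> is known to vanish. At a point of the next depth set off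
  \<open>S\<close>, \<open>Lop \<phi>\<close> integrates \<open>q \<phi>\<close> over the previous
  set alone. Once \<open>q \<phi>\<close> is null, \<open>Lop \<phi>\<close> is zero at all points,
  and so \<open>\<phi>\<close> vanishes also on \<open>S\<close>.\<close>

lemma fixpoint_zero:
  assumes [measurable]: "\<phi> \<in> borel_measurable N" and eq: "AE x in N. \<phi> x = Lop \<phi> x"
  shows "AE x in N. \<phi> x = 0"
proof -
  have z: "AE x in N. x \<in> E n \<longrightarrow> q x * \<phi> x = 0" for n
  proof (induction n)
    case 0 then show ?case by (simp add: E_0 q_on_S)
  next
    case (Suc n)
    have v: "Lop \<phi> x = 0" if x: "x \<in> E (Suc n) - S" for x
    proof -
      have [measurable]: "x \<in> space N" using x sets.sets_into_space[OF E_sets[of "Suc n"]] by auto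
      have "AE y in N. h x y = 0 \<or> q y * \<phi> y = 0"
        using h_vanish[OF x] Suc by eventually_elim auto
      then have "Lop \<phi> x = dens_int N (h x) (\<lambda>y. 0)"
        unfolding Lop_def Hop_def by (intro dens_int_cong_AE) auto
      then show ?thesis by (simp add: dens_int_def)
    qed
    show ?case using eq
    proof eventually_elim
      case (elim x)
      then show ?case using v[of x] by (cases "x \<in> S") (auto simp: q_on_S)
    qed
  qed
  have "AE x in N. \<forall>n. x \<in> E n \<longrightarrow> q x * \<phi> x = 0" unfolding AE_all_countable using z by blast
  then have q0: "AE x in N. q x * \<phi> x = 0" using AE_space by eventually_elim (use E_union in auto)
  have L0: "Lop \<phi> x = 0" if "x \<in> space N" for x
  proof -
    have "Lop \<phi> x = Hop (\<lambda>y. 0) x" unfolding Lop_def using q0 that by (intro Hop_cong_AE) auto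
    then show ?thesis by (simp add: Hop_def dens_int_def)
  qed
  show ?thesis using eq AE_space by eventually_elim (simp add: L0)
qed

end

section \<open>The density of the reduced kernel\<close>

lemma cm_integral_cong:
  assumes "\<And>y. y \<in> space N \<Longrightarrow> f y = f' y"
  shows "cm_integral N D \<nu> f = cm_integral N D \<nu> f'"
proof -
  have [simp]: "space (upper_variation N D \<rho>) = space N" for \<rho>
    unfolding upper_variation_def by (rule space_measure_of) (rule sets.space_closed)
  have "(\<integral>y. f y \<partial>upper_variation N D \<rho>) = (\<integral>y. f' y \<partial>upper_variation N D \<rho>)" for \<rho>
    by (rule Bochner_Integration.integral_cong) (auto simp: assms)
  then show ?thesis unfolding cm_integral_def by simp
qed

locale kernel_reduction = reduction +
  fixes K :: "'a \<Rightarrow> 'a set \<Rightarrow> complex"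
  assumes h_integrable: "\<And>x. x \<in> space N \<Longrightarrow> integrable N (h x)"
    and K_eq: "\<And>x B. x \<in> space N \<Longrightarrow> B \<in> sets N \<Longrightarrow> K x B = (LINT y:B|N. h x y)"
begin

section \<open>Integrals against the kernel and the terms of its series\<close>

lemma cm_integral_K:
  assumes [measurable]: "f \<in> borel_measurable N" and x[measurable]: "x \<in> space N"
  shows "cm_integral N (sets N) (K x) f = Hop f x"
  unfolding Hop_def
proof (rule cm_integral_eq_dens_int[where C = "\<lambda>_. space N"])
  fix A assume A: "A \<in> sets N"
  show "set_integrable N A (h x) \<and> K x A = (LINT y:A|N. h x y)"
    using integrable_mult_indicator[OF A h_integrable[OF x]] K_eq[OF x A] by (simp add: set_integrable_def)
qed (auto simp: incseq_def)

lemma total_variation_K: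
  assumes x[measurable]: "x \<in> space N" and [measurable]: "B \<in> sets N"
  shows "total_variation N (K x) B = (\<integral>\<^sup>+y. ennreal (cmod (h x y)) * indicator B y \<partial>N)"
  using x by (intro total_variation_eq_nn_integral h_integrable K_eq) auto

lemma total_variation_measure_K:
  assumes x[measurable]: "x \<in> space N"
  shows "total_variation_measure N (K x) = density N (\<lambda>y. ennreal (cmod (h x y)))"
proof -
  have "total_variation_measure N (K x)
      = measure_of (space N) (sets N) (emeasure (density N (\<lambda>y. ennreal (cmod (h x y)))))"
    unfolding total_variation_measure_def
    by (rule measure_of_eq) (auto simp: sets.space_closed sets.sigma_sets_eq total_variation_K x emeasure_density)
  then show ?thesis
    using measure_of_of_measure[of "density N (\<lambda>y. ennreal (cmod (h x y)))"] by simp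
qed

lemma K_abs_term_eq:
  assumes [measurable]: "B \<in> sets N"
  shows "x \<in> space N \<Longrightarrow> K_abs_term N d K S z0 n x B = (absL ^^ n) (absH (indicator B)) x"
proof (induction n arbitrary: x)
  case 0 then show ?case by (simp add: total_variation_K absH_def)
next
  case (Suc n)
  note x[measurable] = \<open>x \<in> space N\<close>
  have q: "indicator (space N - S) y * (a / ennreal (cmod (z0 - d y))) = ennreal (cmod (q y)) * a"
    if "y \<in> space N" for y and a :: ennreal
  proof (cases "y \<in> S")
    case False
    then have p: "0 < cmod (z0 - d y)" using \<epsilon>_le[of y] \<epsilon>_pos that by auto
    then have "a / ennreal (cmod (z0 - d y)) = ennreal (1 / cmod (z0 - d y)) * a"
      by (simp add: divide_ennreal_def inverse_ennreal mult.commute inverse_eq_divide)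
    then show ?thesis using False that by (simp add: q_def norm_divide)
  qed (simp add: q_on_S)
  have "K_abs_term N d K S z0 (Suc n) x B = (\<integral>\<^sup>+y. indicator (space N - S) y *
      (K_abs_term N d K S z0 n y B / ennreal (cmod (z0 - d y))) \<partial>density N (\<lambda>y. ennreal (cmod (h x y))))"
    by (simp add: total_variation_measure_K x)
  also have "\<dots> = (\<integral>\<^sup>+y. ennreal (cmod (q y)) * (absL ^^ n) (absH (indicator B)) y \<partial>density N (\<lambda>y. ennreal (cmod (h x y))))"
    by (intro nn_integral_cong) (simp add: q Suc.IH)
  also have "\<dots> = (absL ^^ Suc n) (absH (indicator B)) x"
    unfolding absL_pow_Suc by (rule nn_integral_density) measurable
  finally show ?case .
qed

lemma K_term_eq:
  assumes [measurable]: "B \<in> sets N"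
  shows "x \<in> space N \<Longrightarrow> K_term N d K S z0 n x B = (Lop ^^ n) (Hop (indicator B)) x"
proof (induction n arbitrary: x)
  case 0
  note x[measurable] = \<open>x \<in> space N\<close>
  have i: "integrable N (\<lambda>y. h x y * indicator B y)"
    using integrable_mult_indicator[OF assms h_integrable[OF x]] by (simp add: scaleR_conv_of_real mult.commute of_real_indicator)
  show ?case
    using x by (simp add: K_eq Hop_def dens_int_eq_integral[OF _ _ i] set_lebesgue_integral_def
      scaleR_conv_of_real mult.commute of_real_indicator)
next
  case (Suc n)
  have "K_term N d K S z0 (Suc n) x B = cm_integral N (sets N) (K x) (\<lambda>y. q y * (Lop ^^ n) (Hop (indicator B)) y)"
    by (auto simp: Suc.IH q_def intro!: cm_integral_cong)
  also have "\<dots> = (Lop ^^ Suc n) (Hop (indicator B)) x"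
    using Suc.prems by (simp add: cm_integral_K Lop_def)
  finally show ?case .
qed

text \<open>This is the density of \<open>K_term\<close> with index \<open>n\<close>, a chain of
  \<open>n + 1\<close> kernels: the operators act on the first variable and \<open>y\<close> stays a
  parameter.\<close>

definition kc :: "nat \<Rightarrow> 'a \<Rightarrow> 'a \<Rightarrow> complex" where
  "kc n x y = (Lop ^^ n) (\<lambda>x. h x y) x"

definition kabs :: "nat \<Rightarrow> 'a \<Rightarrow> 'a \<Rightarrow> ennreal" where
  "kabs n x y = (absL ^^ n) (\<lambda>x. ennreal (cmod (h x y))) x"

lemma kc_0: "kc 0 x y = h x y" and kabs_0: "kabs 0 x y = ennreal (cmod (h x y))"
  by (simp_all add: kc_def kabs_def)

lemma kc_Suc: "kc (Suc n) x y = dens_int N (h x) (\<lambda>z. q z * kc n z y)"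
  unfolding kc_def by (rule Lop_pow_Suc)

lemma kabs_Suc: "kabs (Suc n) x y = (\<integral>\<^sup>+z. ennreal (cmod (h x z)) * (ennreal (cmod (q z)) * kabs n z y) \<partial>N)"
  unfolding kabs_def by (rule absL_pow_Suc)

text \<open>Joint measurability is carried through the induction, since the next kernel integrates
  over the first argument of this one while the second remains a parameter.\<close>

lemma kc_measurable[measurable (raw)]:
  assumes "f \<in> measurable P N" "g \<in> measurable P N"
  shows "(\<lambda>w. kc n (f w) (g w)) \<in> borel_measurable P"
proof -
  have "case_prod (kc n) \<in> borel_measurable (N \<Otimes>\<^sub>M N)"
  proof (induction n)
    case 0 show ?case by (simp add: kc_0 split_beta' ) measurable
  next
    case (Suc n)
    have comp: "(\<lambda>w. kc n (f w) (g w)) \<in> borel_measurable P"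
      if "f \<in> measurable P N" "g \<in> measurable P N" for f g and P :: "(('a \<times> 'a) \<times> 'a) measure"
      using measurable_compose[OF measurable_Pair[OF that] Suc] by simp
    have kn: "(\<lambda>w. kc n (snd w) (snd (fst w))) \<in> borel_measurable ((N \<Otimes>\<^sub>M N) \<Otimes>\<^sub>M N)"
      by (rule comp) measurable
    have "(\<lambda>p. dens_int N (h (fst p)) (\<lambda>z. q z * kc n z (snd p))) \<in> borel_measurable (N \<Otimes>\<^sub>M N)"
      by (rule measurable_dens_int[OF sigma_finite_measure_axioms]) (use kn in \<open>simp_all add: split_beta'\<close>)
    then show ?case by (simp add: kc_Suc split_beta')
  qed
  from measurable_compose[OF measurable_Pair[OF assms] this] show ?thesis by simp
qed

lemma kabs_measurable[measurable (raw)]: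
  assumes "f \<in> measurable P N" "g \<in> measurable P N"
  shows "(\<lambda>w. kabs n (f w) (g w)) \<in> borel_measurable P"
proof -
  have "case_prod (kabs n) \<in> borel_measurable (N \<Otimes>\<^sub>M N)"
  proof (induction n)
    case 0 show ?case by (simp add: kabs_0 split_beta') measurable
  next
    case (Suc n)
    have comp: "(\<lambda>w. kabs n (f w) (g w)) \<in> borel_measurable P"
      if "f \<in> measurable P N" "g \<in> measurable P N" for f g and P :: "(('a \<times> 'a) \<times> 'a) measure"
      using measurable_compose[OF measurable_Pair[OF that] Suc] by simp
    have [measurable]: "(\<lambda>w. kabs n (snd w) (snd (fst w))) \<in> borel_measurable ((N \<Otimes>\<^sub>M N) \<Otimes>\<^sub>M N)"
      by (rule comp) measurable
    have "(\<lambda>p. \<integral>\<^sup>+z. ennreal (cmod (h (fst p) z)) * (ennreal (cmod (q z)) * kabs n z (snd p)) \<partial>N) \<in> borel_measurable (N \<Otimes>\<^sub>M N)"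
      by (rule borel_measurable_nn_integral) (simp add: split_beta')
    then show ?case by (simp add: kabs_Suc split_beta')
  qed
  from measurable_compose[OF measurable_Pair[OF assms] this] show ?thesis by simp
qed

lemma kc_bound: "x \<in> space N \<Longrightarrow> y \<in> space N \<Longrightarrow> ennreal (cmod (kc n x y)) \<le> kabs n x y"
  unfolding kc_def kabs_def by (rule Lop_pow_bound) auto

text \<open>By Tonelli the last variable can be integrated first, which leaves iterates of
  \<open>absL\<close> applied to \<open>absH g\<close>.\<close>

lemma nn_integral_kabs:
  assumes [measurable]: "g \<in> borel_measurable N"
  shows "x \<in> space N \<Longrightarrow> (\<integral>\<^sup>+y. kabs n x y * g y \<partial>N) = (absL ^^ n) (absH g) x"
proof (induction n arbitrary: x)
  case 0 then show ?case by (simp add: kabs_0 absH_def)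
next
  case (Suc n)
  interpret P: pair_sigma_finite N N ..
  note x[measurable] = \<open>x \<in> space N\<close>
  have "(\<integral>\<^sup>+y. kabs (Suc n) x y * g y \<partial>N)
      = (\<integral>\<^sup>+y. (\<integral>\<^sup>+z. ennreal (cmod (h x z)) * (ennreal (cmod (q z)) * kabs n z y) * g y \<partial>N) \<partial>N)"
    unfolding kabs_Suc by (intro nn_integral_cong nn_integral_multc[symmetric]) measurable
  also have "\<dots> = (\<integral>\<^sup>+z. (\<integral>\<^sup>+y. ennreal (cmod (h x z)) * (ennreal (cmod (q z)) * kabs n z y) * g y \<partial>N) \<partial>N)"
    by (rule P.Fubini') measurable
  also have "\<dots> = (\<integral>\<^sup>+z. ennreal (cmod (h x z)) * (ennreal (cmod (q z)) * (\<integral>\<^sup>+y. kabs n z y * g y \<partial>N)) \<partial>N)"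
    by (intro nn_integral_cong) (simp add: mult.assoc nn_integral_cmult)
  also have "\<dots> = (absL ^^ Suc n) (absH g) x"
    unfolding absL_pow_Suc by (intro nn_integral_cong) (simp add: Suc.IH)
  finally show ?case .
qed

text \<open>The signed version needs Fubini; its integrability condition comes from the absolute
  iterates, which are assumed finite at \<open>x\<close> and dominate the double integral.\<close>

lemma integral_kc:
  assumes [measurable]: "f \<in> borel_measurable N"
  shows "x \<in> space N \<Longrightarrow> (absL ^^ n) (absH (\<lambda>y. ennreal (cmod (f y)))) x < \<infinity> \<Longrightarrow>
    (\<integral>y. kc n x y * f y \<partial>N) = (Lop ^^ n) (Hop f) x"
proof (induction n arbitrary: x)
  case 0 then show ?case by (simp add: kc_0 Hop_integral)
next
  case (Suc n)
  interpret P: pair_sigma_finite N N ..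
  note x[measurable] = \<open>x \<in> space N\<close>
  let ?G = "(absL ^^ n) (absH (\<lambda>y. ennreal (cmod (f y))))"
  let ?F = "\<lambda>y z. h x z * (q z * (kc n z y * f y))"
  have "(\<integral>\<^sup>+p. ennreal (norm (case_prod ?F p)) \<partial>(N \<Otimes>\<^sub>M N))
      = (\<integral>\<^sup>+z. (\<integral>\<^sup>+y. ennreal (cmod (?F y z)) \<partial>N) \<partial>N)"
    by (subst P.nn_integral_snd[symmetric]) auto
  also have "\<dots> \<le> (\<integral>\<^sup>+z. (\<integral>\<^sup>+y. ennreal (cmod (h x z)) * (ennreal (cmod (q z)) * (kabs n z y * ennreal (cmod (f y)))) \<partial>N) \<partial>N)"
    by (intro nn_integral_mono) (auto simp: norm_mult ennreal_mult intro!: mult_left_mono mult_right_mono kc_bound)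
  also have "\<dots> = (\<integral>\<^sup>+z. ennreal (cmod (h x z)) * (ennreal (cmod (q z)) * ?G z) \<partial>N)"
    by (intro nn_integral_cong) (simp add: nn_integral_cmult nn_integral_kabs)
  also have "\<dots> < \<infinity>" using Suc.prems(2) unfolding absL_pow_Suc .
  finally have int: "integrable (N \<Otimes>\<^sub>M N) (case_prod ?F)"
    by (intro integrableI_bounded) auto
  have Gfin: "AE z in N. ennreal (cmod (h x z)) * (ennreal (cmod (q z)) * ?G z) \<noteq> \<infinity>"
    using Suc.prems(2) unfolding absL_pow_Suc by (intro nn_integral_PInf_AE) auto
  have "(\<integral>y. kc (Suc n) x y * f y \<partial>N) = (\<integral>y. (\<integral>z. ?F y z \<partial>N) \<partial>N)"
  proof (rule integral_cong_AE)
    have "AE y in N. integrable N (\<lambda>z. ?F y z)" using P.AE_integrable_fst'[OF int] by simp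
    then show "AE y in N. kc (Suc n) x y * f y = (\<integral>z. ?F y z \<partial>N)" using AE_space
    proof eventually_elim
      case (elim y)
      note [measurable] = elim(2)
      show ?case
      proof (cases "f y = 0")
        \<comment> \<open>Dividing by \<open>f y\<close> gives integrability of the inner integrand
          without the factor \<open>f y\<close>, as needed to rewrite \<open>dens_int\<close> as one
          integral.\<close>
        case False
        have "integrable N (\<lambda>z. (h x z * (q z * kc n z y)) * f y)" using elim(1) by (simp add: mult.assoc)
        then have "integrable N (\<lambda>z. (h x z * (q z * kc n z y)) * f y * inverse (f y))"
          by (rule integrable_mult_left)
        then have "integrable N (\<lambda>z. h x z * (q z * kc n z y))" using False by (simp add: mult.assoc)
        then have "kc (Suc n) x y * f y = (\<integral>z. h x z * (q z * kc n z y) \<partial>N) * f y"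
          unfolding kc_Suc by (subst dens_int_eq_integral) auto
        then show ?thesis by (simp add: mult.assoc flip: integral_mult_left_zero)
      qed simp
    qed
  qed measurable
  also have "\<dots> = (\<integral>z. (\<integral>y. ?F y z \<partial>N) \<partial>N)"
    using P.Fubini_integral[OF int] by simp
  also have "\<dots> = (\<integral>z. h x z * (q z * (\<integral>y. kc n z y * f y \<partial>N)) \<partial>N)"
    by simp
  also have "\<dots> = (\<integral>z. h x z * (q z * (Lop ^^ n) (Hop f) z) \<partial>N)"
  proof (rule integral_cong_AE)
    \<comment> \<open>The induction hypothesis needs \<open>?G z < \<infinity>\<close>.
      \<open>Gfin\<close> supplies this unless \<open>h x z * q z = 0\<close>, and there both sides
      vanish.\<close>
    show "AE z in N. h x z * (q z * (\<integral>y. kc n z y * f y \<partial>N)) = h x z * (q z * (Lop ^^ n) (Hop f) z)"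
      using Gfin AE_space
    proof eventually_elim
      case (elim z)
      then show ?case using Suc.IH[of z] by (cases "h x z * q z = 0") (auto simp: ennreal_mult_eq_top_iff less_top)
    qed
  qed measurable
  also have "\<dots> = (Lop ^^ Suc n) (Hop f) x"
  proof -
    have "ennreal (cmod ((Lop ^^ n) (Hop f) z)) \<le> ?G z" if "z \<in> space N" for z
      using that Hop_bound[of f] by (intro order_trans[OF Lop_pow_bound absL_pow_mono]) auto
    then have "(\<integral>\<^sup>+z. ennreal (norm (h x z * (q z * (Lop ^^ n) (Hop f) z))) \<partial>N)
        \<le> (\<integral>\<^sup>+z. ennreal (cmod (h x z)) * (ennreal (cmod (q z)) * ?G z) \<partial>N)"
      by (intro nn_integral_mono) (auto simp: norm_mult ennreal_mult intro!: mult_left_mono)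
    also have "\<dots> < \<infinity>" using Suc.prems(2) unfolding absL_pow_Suc .
    finally have "integrable N (\<lambda>z. h x z * (q z * (Lop ^^ n) (Hop f) z))"
      by (intro integrableI_bounded) auto
    then show ?thesis unfolding Lop_pow_Suc by (subst dens_int_eq_integral) auto
  qed
  finally show ?case .
qed

section \<open>Summation of the iterated densities\<close>

definition rabs :: "'a \<Rightarrow> 'a \<Rightarrow> ennreal" where
  "rabs x y = (\<Sum>n. kabs n x y)"

text \<open>
  The cut-off makes \<open>rdens x\<close> represent the reduced kernel on its domain for \<^emph>\<open>every\<close> \<open>x\<close>, not just for
  almost every \<open>x\<close>. This yields the measurability of \<open>opR v\<close>, which a description almost everywhere
  would not give, as \<open>N\<close> need not be complete.
\<close>
definition rdens :: "'a \<Rightarrow> 'a \<Rightarrow> complex" where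
  "rdens x y = (if rabs x y < \<infinity> then \<Sum>n. kc n x y else 0)"

lemma rabs_measurable[measurable (raw)]:
  assumes [measurable]: "f \<in> measurable P N" "g \<in> measurable P N"
  shows "(\<lambda>w. rabs (f w) (g w)) \<in> borel_measurable P"
  unfolding rabs_def by measurable

lemma rdens_measurable[measurable (raw)]:
  assumes [measurable]: "f \<in> measurable P N" "g \<in> measurable P N"
  shows "(\<lambda>w. rdens (f w) (g w)) \<in> borel_measurable P"
  unfolding rdens_def by measurable

lemma nn_integral_rabs:
  assumes [measurable]: "g \<in> borel_measurable N" and x[measurable]: "x \<in> space N"
  shows "(\<integral>\<^sup>+y. rabs x y * g y \<partial>N) = neumann_abs (absH g) x"
proof -
  have "(\<integral>\<^sup>+y. rabs x y * g y \<partial>N) = (\<integral>\<^sup>+y. (\<Sum>n. kabs n x y * g y) \<partial>N)"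
    unfolding rabs_def by simp
  also have "\<dots> = (\<Sum>n. (absL ^^ n) (absH g) x)"
    by (subst nn_integral_suminf) (auto simp: nn_integral_kabs x)
  finally show ?thesis unfolding neumann_abs_def .
qed

lemma integral_rdens:
  assumes [measurable]: "f \<in> borel_measurable N" and x[measurable]: "x \<in> space N"
    and fin: "neumann_abs (absH (\<lambda>y. ennreal (cmod (f y)))) x < \<infinity>"
  shows "integrable N (\<lambda>y. rdens x y * f y)" "(\<integral>y. rdens x y * f y \<partial>N) = sol (Hop f) x"
proof -
  let ?f = "\<lambda>n y. kc n x y * f y"
  have "(\<Sum>n. \<integral>\<^sup>+y. ennreal (norm (?f n y)) \<partial>N) \<le> (\<Sum>n. \<integral>\<^sup>+y. kabs n x y * ennreal (cmod (f y)) \<partial>N)"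
    by (intro suminf_le nn_integral_mono) (auto simp: norm_mult ennreal_mult x intro!: mult_right_mono kc_bound)
  also have "\<dots> = neumann_abs (absH (\<lambda>y. ennreal (cmod (f y)))) x"
    unfolding neumann_abs_def using x by (simp add: nn_integral_kabs)
  finally have fin': "(\<Sum>n. \<integral>\<^sup>+y. ennreal (norm (?f n y)) \<partial>N) < \<infinity>" using fin by (rule le_less_trans)
  have "(\<integral>\<^sup>+y. rabs x y * ennreal (cmod (f y)) \<partial>N) \<noteq> \<infinity>"
    using fin x by (simp add: nn_integral_rabs less_top)
  then have "AE y in N. rabs x y * ennreal (cmod (f y)) \<noteq> \<infinity>"
    by (intro nn_integral_PInf_AE) auto
  then have ae: "AE y in N. (\<Sum>n. ?f n y) = rdens x y * f y" using AE_space
  proof eventually_elim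
    case (elim y)
    show ?case
    proof (cases "f y = 0")
      case False
      \<comment> \<open>At such a point the cut-off in \<open>rdens\<close> is inactive.\<close>
      then have r: "rabs x y < \<infinity>" using elim(1) by (auto simp: ennreal_mult_eq_top_iff less_top)
      have "(\<Sum>n. ennreal (norm (kc n x y))) \<le> rabs x y"
        unfolding rabs_def using x elim(2) by (intro suminf_le kc_bound) auto
      then have "(\<Sum>n. ennreal (norm (kc n x y))) \<noteq> top" using r by (auto simp: top_unique)
      then have "summable (\<lambda>n. kc n x y)"
        by (intro summable_norm_cancel[OF summable_suminf_not_top]) auto
      then show ?thesis using r by (simp add: rdens_def suminf_mult2)
    qed simp
  qed
  have "integrable N (\<lambda>y. \<Sum>n. ?f n y)" by (rule integrable_suminf_of_suminf_finite[OF _ fin']) measurable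
  then show "integrable N (\<lambda>y. rdens x y * f y)"
    using ae by (subst integrable_cong_AE[symmetric]) auto
  have "(\<integral>y. rdens x y * f y \<partial>N) = (\<integral>y. (\<Sum>n. ?f n y) \<partial>N)"
    using ae by (intro integral_cong_AE) (auto elim!: eventually_mono)
  also have "\<dots> = (\<Sum>n. \<integral>y. ?f n y \<partial>N)"
    by (rule sums_unique[OF sums_integral_of_suminf_finite[OF _ fin']]) measurable
  also have "\<dots> = sol (Hop f) x"
  proof -
    have "(absL ^^ n) (absH (\<lambda>y. ennreal (cmod (f y)))) x < \<infinity>" for n
      using fin sum_le_suminf[of "\<lambda>n. (absL ^^ n) (absH (\<lambda>y. ennreal (cmod (f y)))) x" "{n}"]
      unfolding neumann_abs_def by (auto intro: le_less_trans)
    then show ?thesis unfolding sol_def using x by (simp add: integral_kc)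
  qed
  finally show "(\<integral>y. rdens x y * f y \<partial>N) = sol (Hop f) x" .
qed

section \<open>The reduced operator in terms of the summed density\<close>

lemma measurable_extend_S[measurable]:
  assumes "v \<in> borel_measurable (restrict_space N S)"
  shows "(\<lambda>y. indicator S y * v y :: complex) \<in> borel_measurable N"
  using assms S_sets by (subst (asm) borel_measurable_restrict_space_iff) (auto simp: scaleR_conv_of_real of_real_indicator)

lemma R_domain_iff:
  assumes x: "x \<in> space N"
  shows "B \<in> R_domain N d K S z0 x \<longleftrightarrow> B \<in> sets N \<and> B \<subseteq> S \<and> neumann_abs (absH (indicator B)) x < \<infinity>"
  using x by (auto simp: R_domain_def sets_restrict_space_iff neumann_abs_def K_abs_term_eq)

lemma cm_integral_R:
  assumes v: "v \<in> borel_measurable (restrict_space N S)" and x[measurable]: "x \<in> S"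
  shows "cm_integral (restrict_space N S) (R_domain N d K S z0 x) (R_kernel N d K S z0 x) v
    = dens_int N (rdens x) (\<lambda>y. indicator S y * v y)"
proof -
  have S_sub: "S \<subseteq> space N" by (rule sets.sets_into_space[OF S_sets])
  then have SN: "S \<inter> space N = S" by auto
  have xN[measurable]: "x \<in> space N" using x S_sub by auto
  obtain U :: "nat \<Rightarrow> 'a set" where U: "range U \<subseteq> sets N" "(\<Union>i. U i) = space N"
    "\<And>i. emeasure N (U i) \<noteq> \<infinity>" "incseq U"
    using sigma_finite_incseq by blast
  have [measurable]: "U n \<in> sets N" for n using U(1) by auto
  \<comment> \<open>The mass of \<open>rabs x\<close> on \<open>C n\<close> is at most
    \<open>n\<close> times the finite measure of \<open>U n\<close>, so \<open>C n\<close> belongs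
    to the domain. Points with \<open>rabs x y = \<infinity>\<close> are never reached, and there
    \<open>rdens x y\<close> is 0 by its cut-off.\<close>
  define C where "C n = {y \<in> space N. rabs x y \<le> of_nat n} \<inter> S \<inter> U n" for n
  have Cm[measurable]: "C n \<in> sets N" for n unfolding C_def by measurable
  have "cm_integral (restrict_space N S) (R_domain N d K S z0 x) (R_kernel N d K S z0 x) v
      = dens_int (restrict_space N S) (rdens x) v"
  proof (rule cm_integral_eq_dens_int[where C = C])
    show "R_domain N d K S z0 x \<subseteq> sets (restrict_space N S)" by (auto simp: R_domain_def)
  next
    fix A B assume A: "A \<in> R_domain N d K S z0 x" and B: "B \<in> sets (restrict_space N S)" "B \<subseteq> A"
    have "neumann_abs (absH (indicator B)) x \<le> neumann_abs (absH (indicator A)) x"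
      using B(2) xN by (intro neumann_abs_mono absH_mono) (auto split: split_indicator)
    then show "B \<in> R_domain N d K S z0 x"
      using A B SN by (auto simp: R_domain_iff[OF xN] sets_restrict_space_iff intro: le_less_trans)
  next
    fix A assume "A \<in> R_domain N d K S z0 x"
    then have A[measurable]: "A \<in> sets N" and AS: "A \<subseteq> S" and fin: "neumann_abs (absH (indicator A)) x < \<infinity>"
      by (auto simp: R_domain_iff[OF xN])
    have eq: "(indicat_real S y * indicat_real A y) *\<^sub>R rdens x y = rdens x y * indicator A y" for y
      using AS by (auto split: split_indicator)
    have cm: "(\<lambda>y. ennreal (cmod (indicator A y :: complex))) = indicator A"
      by (auto split: split_indicator)
    have i: "integrable N (\<lambda>y. rdens x y * indicator A y)" "(\<integral>y. rdens x y * indicator A y \<partial>N) = sol (Hop (indicator A)) x"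
      using integral_rdens[of "indicator A" x] fin xN by (simp_all add: cm)
    have "R_kernel N d K S z0 x A = sol (Hop (indicator A)) x"
      unfolding R_kernel_def sol_def using xN by (simp add: K_term_eq)
    then show "set_integrable (restrict_space N S) A (rdens x) \<and>
        R_kernel N d K S z0 x A = (LINT y:A|restrict_space N S. rdens x y)"
      using i by (simp add: set_integrable_def set_lebesgue_integral_def integrable_restrict_space
        integral_restrict_space eq)
  next
    show "range C \<subseteq> R_domain N d K S z0 x"
    proof clarify
      fix n
      have "neumann_abs (absH (indicator (C n))) x = (\<integral>\<^sup>+y. rabs x y * indicator (C n) y \<partial>N)"
        using xN by (simp add: nn_integral_rabs)
      also have "\<dots> \<le> (\<integral>\<^sup>+y. of_nat n * indicator (U n) y \<partial>N)"
        by (intro nn_integral_mono) (auto simp: C_def split: split_indicator)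
      also have "\<dots> < \<infinity>" using U(3)[of n] by (simp add: nn_integral_cmult ennreal_mult_less_top less_top of_nat_less_top)
      finally show "C n \<in> R_domain N d K S z0 x" by (auto simp: R_domain_iff[OF xN] C_def[of n])
    qed
  next
    show "incseq C"
      using U(4) unfolding incseq_def C_def by (fastforce intro: order_trans)
  next
    fix y assume y: "y \<in> space (restrict_space N S)" "rdens x y \<noteq> 0"
    then have "y \<in> S" "y \<in> space N" "rabs x y < \<infinity>" using S_sub by (auto simp: space_restrict_space rdens_def split: if_splits)
    obtain i where i: "y \<in> U i" using U(2) \<open>y \<in> space N\<close> by auto
    obtain j where j: "rabs x y \<le> of_nat j" using \<open>rabs x y < \<infinity>\<close> ennreal_Ex_less_of_nat[of "rabs x y"] by (auto intro: less_imp_le)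
    have "rabs x y \<le> of_nat (max i j)" using j by (rule order_trans) simp
    moreover have "y \<in> U (max i j)" using i U(4) monoD[of U i "max i j"] by auto
    ultimately show "y \<in> (\<Union>n. C n)" using \<open>y \<in> S\<close> \<open>y \<in> space N\<close> by (auto simp: C_def)
  next
    show "rdens x \<in> borel_measurable (restrict_space N S)" by (rule measurable_restrict_space1) measurable
  qed (rule v)
  then show ?thesis using dens_int_restrict_space[of S N] SN by simp
qed

lemma opR_eq:
  assumes "v \<in> borel_measurable (restrict_space N S)" "x \<in> S"
  shows "opR N d K S z0 v x = d x * v x + dens_int N (rdens x) (\<lambda>y. indicator S y * v y)"
  unfolding opR_def by (simp add: cm_integral_R assms)

lemma integrable_extend_S:
  "integrable (restrict_space N S) v \<longleftrightarrow> integrable N (\<lambda>y. indicator S y * v y :: complex)"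
  by (subst integrable_restrict_space) (auto simp: scaleR_conv_of_real of_real_indicator)

lemma opR_measurable:
  assumes v[measurable]: "v \<in> borel_measurable (restrict_space N S)"
  shows "opR N d K S z0 v \<in> borel_measurable (restrict_space N S)"
proof -
  have "(\<lambda>x. dens_int N (rdens x) (\<lambda>y. indicator S y * v y)) \<in> borel_measurable N"
    by (rule measurable_dens_int[OF sigma_finite_measure_axioms]) measurable
  then have "(\<lambda>x. d x * v x + dens_int N (rdens x) (\<lambda>y. indicator S y * v y)) \<in> borel_measurable (restrict_space N S)"
    by (intro borel_measurable_add borel_measurable_times measurable_restrict_space1 v d_measurable)
  then show ?thesis
    by (rule measurable_cong[THEN iffD1, rotated]) (auto simp: space_restrict_space opR_eq[OF v])
qed

text \<open>For integrable \<open>v\<close> the absolute Neumann series of \<open>Hop\<close>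
  applied to the extension by 0 is finite almost everywhere, and there the integral against the
  reduced density is the Neumann series itself. This is the passage from the reduced kernel to the
  Schur complement.\<close>

lemma AE_opR:
  assumes "integrable (restrict_space N S) v"
  shows "AE x in N. x \<in> S \<longrightarrow> opR N d K S z0 v x = d x * v x + sol (Hop (\<lambda>y. indicator S y * v y)) x"
proof -
  let ?v = "\<lambda>y. indicator S y * v y"
  have vm: "v \<in> borel_measurable (restrict_space N S)" using assms by auto
  have [measurable]: "?v \<in> borel_measurable N" by (rule measurable_extend_S[OF vm])
  have "(\<integral>\<^sup>+y. ennreal (cmod (?v y)) \<partial>N) < \<infinity>"
    using assms[unfolded integrable_extend_S] unfolding integrable_iff_bounded by simp
  then have "(\<integral>\<^sup>+y. absH (\<lambda>y. ennreal (cmod (?v y))) y \<partial>N) < \<infinity>"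
    by (intro ennreal_le_mult_finite[OF nn_integral_absH_le]) auto
  then have "AE x in N. neumann_abs (absH (\<lambda>y. ennreal (cmod (?v y)))) x < \<infinity>"
    by (intro AE_neumann_abs_finite) auto
  then show ?thesis using AE_space
  proof eventually_elim
    case (elim x)
    note [measurable] = elim(2)
    have "dens_int N (rdens x) ?v = sol (Hop ?v) x"
      using integral_rdens[OF _ elim(2,1)] by (subst dens_int_eq_integral) auto
    then show ?case by (auto simp: opR_eq[OF vm])
  qed
qed

end

section \<open>The Schur complement\<close>

lemma L1_norm_eq_nn_integral: "integrable N f \<Longrightarrow> ennreal (L1_norm N f) = (\<integral>\<^sup>+x. ennreal (cmod (f x)) \<partial>N)"
  unfolding L1_norm_def by (rule nn_integral_eq_integral[symmetric]) auto

lemma L1_norm_nonneg: "0 \<le> L1_norm N f"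
  unfolding L1_norm_def by simp

lemma L1_norm_le_of_nn_integral:
  assumes "integrable N f" "integrable N g" "0 \<le> c"
    and "(\<integral>\<^sup>+x. ennreal (cmod (f x)) \<partial>N) \<le> ennreal c * (\<integral>\<^sup>+x. ennreal (cmod (g x)) \<partial>N)"
  shows "L1_norm N f \<le> c * L1_norm N g"
  using assms(4) unfolding L1_norm_eq_nn_integral[OF assms(1), symmetric] L1_norm_eq_nn_integral[OF assms(2), symmetric]
  using assms(3) L1_norm_nonneg[of N g] by (simp flip: ennreal_mult)

lemma L1_norm_add_le:
  "integrable N f \<Longrightarrow> integrable N g \<Longrightarrow> L1_norm N (\<lambda>x. f x + g x) \<le> L1_norm N f + L1_norm N g"
proof -
  assume fg: "integrable N f" "integrable N g"
  then have "(\<integral>x. cmod (f x + g x) \<partial>N) \<le> (\<integral>x. cmod (f x) + cmod (g x) \<partial>N)"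
    by (intro integral_mono) (auto intro: norm_triangle_ineq)
  then show ?thesis using fg by (simp add: L1_norm_def)
qed

lemma L1_norm_diff_le:
  "integrable N f \<Longrightarrow> integrable N g \<Longrightarrow> L1_norm N (\<lambda>x. f x - g x) \<le> L1_norm N f + L1_norm N g"
proof -
  assume fg: "integrable N f" "integrable N g"
  then have "(\<integral>x. cmod (f x - g x) \<partial>N) \<le> (\<integral>x. cmod (f x) + cmod (g x) \<partial>N)"
    by (intro integral_mono) (auto intro: norm_triangle_ineq4)
  then show ?thesis using fg by (simp add: L1_norm_def)
qed

text \<open>The inverse is chosen separately for each right-hand side. Injectivity modulo null sets
  forces this choice to be linear and compatible with equality almost everywhere, and the bound in
  \<open>surj\<close> makes it bounded.\<close>

lemma L1_invertibleI:
  assumes T: "bounded_L1_operator N T"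
    and surj: "\<And>g. g \<in> L1 N \<Longrightarrow> \<exists>f\<in>L1 N. (AE x in N. T f x = g x) \<and> L1_norm N f \<le> C * L1_norm N g"
    and inj: "\<And>f. f \<in> L1 N \<Longrightarrow> AE x in N. T f x = 0 \<Longrightarrow> AE x in N. f x = 0"
  shows "L1_invertible N T"
proof -
  have TL: "T f \<in> L1 N" if "f \<in> L1 N" for f using T that by (auto simp: bounded_L1_operator_def)
  have Tadd: "AE x in N. T (\<lambda>y. f y + g y) x = T f x + T g x" if "f \<in> L1 N" "g \<in> L1 N" for f g
    using T that by (auto simp: bounded_L1_operator_def)
  have Tmul: "AE x in N. T (\<lambda>y. c * f y) x = c * T f x" if "f \<in> L1 N" for f c
    using T that by (auto simp: bounded_L1_operator_def)
  have L1add: "(\<lambda>y. f y + g y) \<in> L1 N" if "f \<in> L1 N" "g \<in> L1 N" for f g using that by (auto simp: L1_def)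
  have L1mul: "(\<lambda>y. c * f y) \<in> L1 N" if "f \<in> L1 N" for f c using that by (auto simp: L1_def)
  have uniq: "AE x in N. f x = g x" if f: "f \<in> L1 N" and g: "g \<in> L1 N" and eq: "AE x in N. T f x = T g x" for f g
  proof -
    have g': "(\<lambda>y. - 1 * g y) \<in> L1 N" by (rule L1mul[OF g])
    have "AE x in N. T (\<lambda>y. f y + (- 1) * g y) x = 0"
      using Tadd[OF f g'] Tmul[OF g, of "- 1"] eq by eventually_elim simp
    then have "AE x in N. f x + (- 1) * g x = 0" by (rule inj[OF L1add[OF f g']])
    then show ?thesis by eventually_elim simp
  qed
  define Q where "Q g = (SOME f. f \<in> L1 N \<and> (AE x in N. T f x = g x) \<and> L1_norm N f \<le> C * L1_norm N g)" for g
  have Q: "Q g \<in> L1 N" "AE x in N. T (Q g) x = g x" "L1_norm N (Q g) \<le> C * L1_norm N g" if "g \<in> L1 N" for g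
  proof -
    have "Q g \<in> L1 N \<and> (AE x in N. T (Q g) x = g x) \<and> L1_norm N (Q g) \<le> C * L1_norm N g"
      using someI_ex[OF surj[OF that, unfolded Bex_def]] unfolding Q_def .
    then show "Q g \<in> L1 N" "AE x in N. T (Q g) x = g x" "L1_norm N (Q g) \<le> C * L1_norm N g" by auto
  qed
  have "bounded_L1_operator N Q"
    unfolding bounded_L1_operator_def
  proof (intro conjI ballI allI impI)
    fix f g assume f: "f \<in> L1 N" and g: "g \<in> L1 N"
    show "AE x in N. Q f x = Q g x" if "AE x in N. f x = g x"
    proof (rule uniq[OF Q(1)[OF f] Q(1)[OF g]])
      show "AE x in N. T (Q f) x = T (Q g) x"
        using that Q(2)[OF f] Q(2)[OF g] by eventually_elim simp
    qed
    show "AE x in N. Q (\<lambda>y. f y + g y) x = Q f x + Q g x"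
    proof (rule uniq[OF Q(1)[OF L1add[OF f g]] L1add[OF Q(1)[OF f] Q(1)[OF g]]])
      show "AE x in N. T (Q (\<lambda>y. f y + g y)) x = T (\<lambda>x. Q f x + Q g x) x"
        using Q(2)[OF f] Q(2)[OF g] Q(2)[OF L1add[OF f g]] Tadd[OF Q(1)[OF f] Q(1)[OF g]]
        by eventually_elim simp
    qed
  next
    fix c f assume f: "f \<in> L1 N"
    show "AE x in N. Q (\<lambda>y. c * f y) x = c * Q f x"
    proof (rule uniq[OF Q(1)[OF L1mul[OF f]] L1mul[OF Q(1)[OF f]]])
      show "AE x in N. T (Q (\<lambda>y. c * f y)) x = T (\<lambda>x. c * Q f x) x"
        using Q(2)[OF f] Q(2)[OF L1mul[OF f, of c]] Tmul[OF Q(1)[OF f], of c]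
        by eventually_elim simp
    qed
  next
    show "\<exists>C. \<forall>f\<in>L1 N. L1_norm N (Q f) \<le> C * L1_norm N f" using Q(3) by auto
  qed (rule Q(1))
  moreover have "AE x in N. Q (T f) x = f x" if "f \<in> L1 N" for f
    by (rule uniq[OF Q(1)[OF TL[OF that]] that Q(2)[OF TL[OF that]]])
  ultimately show ?thesis unfolding L1_invertible_def using Q(2) by blast
qed

context reduction
begin

section \<open>Bounds and linearity of the operators\<close>

lemma integrable_q_mult:
  assumes f: "integrable N f"
  shows "integrable N (\<lambda>x. q x * f x)" "L1_norm N (\<lambda>x. q x * f x) \<le> (1 / \<epsilon>) * L1_norm N f"
proof -
  have b: "cmod (q x * f x) \<le> (1 / \<epsilon>) * cmod (f x)" if "x \<in> space N" for x
    using cmod_q_le[OF that] by (simp add: norm_mult mult_right_mono del: times_divide_eq_left)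
  have i: "integrable N (\<lambda>x. (1 / \<epsilon>) * cmod (f x))" using f by (intro integrable_mult_right integrable_norm)
  have [measurable]: "f \<in> borel_measurable N" using f by auto
  show 1: "integrable N (\<lambda>x. q x * f x)"
    by (rule Bochner_Integration.integrable_bound[OF i]) (use b \<epsilon>_pos in \<open>auto intro!: AE_I2\<close>)
  have "L1_norm N (\<lambda>x. q x * f x) \<le> (\<integral>x. (1 / \<epsilon>) * cmod (f x) \<partial>N)"
    unfolding L1_norm_def using 1 i b by (intro integral_mono) auto
  then show "L1_norm N (\<lambda>x. q x * f x) \<le> (1 / \<epsilon>) * L1_norm N f" by (simp add: L1_norm_def)
qed

lemma integrable_d_mult:
  assumes f: "integrable N f"
  shows "integrable N (\<lambda>x. d x * f x)" "L1_norm N (\<lambda>x. d x * f x) \<le> D * L1_norm N f"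
proof -
  have b: "cmod (d x * f x) \<le> D * cmod (f x)" if "x \<in> space N" for x
    using d_bound[OF that] by (simp add: norm_mult mult_right_mono)
  have i: "integrable N (\<lambda>x. D * cmod (f x))" using f by (intro integrable_mult_right integrable_norm)
  have [measurable]: "f \<in> borel_measurable N" using f by auto
  show 1: "integrable N (\<lambda>x. d x * f x)"
    by (rule Bochner_Integration.integrable_bound[OF i]) (use b in \<open>fastforce intro!: AE_I2 intro: order_trans abs_ge_self\<close>)+
  have "L1_norm N (\<lambda>x. d x * f x) \<le> (\<integral>x. D * cmod (f x) \<partial>N)"
    unfolding L1_norm_def using 1 i b by (intro integral_mono) auto
  then show "L1_norm N (\<lambda>x. d x * f x) \<le> D * L1_norm N f" by (simp add: L1_norm_def)
qed

lemma integrable_Hop: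
  assumes f: "integrable N f"
  shows "integrable N (Hop f)" "L1_norm N (Hop f) \<le> H * L1_norm N f"
proof -
  have [measurable]: "f \<in> borel_measurable N" using f by auto
  have le: "(\<integral>\<^sup>+x. ennreal (cmod (Hop f x)) \<partial>N) \<le> ennreal H * (\<integral>\<^sup>+x. ennreal (cmod (f x)) \<partial>N)"
    by (rule order_trans[OF nn_integral_mono nn_integral_absH_le]) (auto intro: Hop_bound)
  have "(\<integral>\<^sup>+x. ennreal (cmod (Hop f x)) \<partial>N) < \<infinity>"
    by (rule ennreal_le_mult_finite[OF le]) (use f in \<open>simp add: integrable_iff_bounded\<close>)
  then show i: "integrable N (Hop f)" by (intro integrableI_bounded) auto
  show "L1_norm N (Hop f) \<le> H * L1_norm N f"
    by (rule L1_norm_le_of_nn_integral[OF i f H_nonneg le])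
qed

text \<open>Additivity may fail where one of the integrals diverges and takes a default value; such
  points form a null set when \<open>f\<close> and \<open>g\<close> are integrable.\<close>

lemma Hop_add:
  assumes f: "integrable N f" and g: "integrable N g"
  shows "AE x in N. Hop (\<lambda>y. f y + g y) x = Hop f x + Hop g x"
proof -
  have [measurable]: "f \<in> borel_measurable N" "g \<in> borel_measurable N" using f g by auto
  have "AE x in N. absH (\<lambda>y. ennreal (cmod (f y))) x < \<infinity>" "AE x in N. absH (\<lambda>y. ennreal (cmod (g y))) x < \<infinity>"
    by (intro AE_absH_finite; use f g in \<open>simp add: integrable_iff_bounded\<close>)+
  then show ?thesis using AE_space
  proof eventually_elim
    case (elim x)
    note [measurable] = elim(3)
    note F = Hop_integral[OF _ elim(3,1)] and G = Hop_integral[OF _ elim(3,2)]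
    have i: "integrable N (\<lambda>y. h x y * (f y + g y))"
      using F(1) G(1) by (simp add: distrib_left)
    have "Hop (\<lambda>y. f y + g y) x = (\<integral>y. h x y * (f y + g y) \<partial>N)"
      unfolding Hop_def using i by (intro dens_int_eq_integral) auto
    then show ?case using F G by (simp add: distrib_left)
  qed
qed

lemma Hop_cmult: "Hop (\<lambda>y. c * f y) x = c * Hop f x"
  unfolding Hop_def by (rule dens_int_cmult)

lemma Hop_diff:
  assumes f: "integrable N f" and g: "integrable N g"
  shows "AE x in N. Hop (\<lambda>y. f y - g y) x = Hop f x - Hop g x"
  using Hop_add[OF f, of "\<lambda>y. (- 1) * g y"] g Hop_cmult[of "- 1" g] by simp

lemma Hop_zero:
  assumes "f \<in> borel_measurable N" "AE y in N. f y = 0" "x \<in> space N"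
  shows "Hop f x = 0"
proof -
  have "Hop f x = Hop (\<lambda>_. 0) x" using assms by (intro Hop_cong_AE) auto
  then show ?thesis by (simp add: Hop_def dens_int_def)
qed

lemma integrable_sol:
  assumes g: "integrable N g"
  shows "integrable N (sol g)" "L1_norm N (sol g) \<le> solution_norm * L1_norm N g"
  using AE_sol_eq(2)[OF g] borel_measurable_integrable[OF g]
  by (auto intro!: L1_norm_le_of_nn_integral nn_integral_sol solution_norm_nonneg g)

lemma solution_unique:
  assumes f: "integrable N \<phi>" and g: "integrable N g" and eq: "AE x in N. \<phi> x = g x + Lop \<phi> x"
  shows "AE x in N. \<phi> x = sol g x"
proof -
  note s = AE_sol_eq[OF g]
  have "AE x in N. Lop (\<lambda>y. \<phi> y - sol g y) x = Lop \<phi> x - Lop (sol g) x"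
    using Hop_diff[OF integrable_q_mult(1)[OF f] integrable_q_mult(1)[OF s(2)]]
    unfolding Lop_def by (simp add: right_diff_distrib)
  with eq s(1) have "AE x in N. \<phi> x - sol g x = Lop (\<lambda>y. \<phi> y - sol g y) x"
    by eventually_elim simp
  then have "AE x in N. \<phi> x - sol g x = 0"
    using f s(2) by (intro fixpoint_zero) auto
  then show ?thesis by eventually_elim simp
qed

lemma Hop_split:
  assumes u: "integrable N u" and eq: "AE x in N. x \<notin> S \<longrightarrow> u x = q x * Hop u x"
  shows "AE x in N. Hop u x = Hop (\<lambda>y. indicator S y * u y) x + Lop (Hop u) x"
proof -
  have uS: "integrable N (\<lambda>y. indicator S y * u y)"
    using integrable_mult_indicator[OF S_sets u] by (simp add: scaleR_conv_of_real of_real_indicator)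
  have qH: "integrable N (\<lambda>x. q x * Hop u x)" by (intro integrable_q_mult integrable_Hop u)
  have "AE x in N. u x = indicator S x * u x + q x * Hop u x"
    using eq by eventually_elim (auto simp: q_on_S split: split_indicator)
  then have "Hop u x = Hop (\<lambda>x. indicator S x * u x + q x * Hop u x) x" if "x \<in> space N" for x
    using u uS qH that by (intro Hop_cong_AE) auto
  with Hop_add[OF uS qH] AE_space show ?thesis
    unfolding Lop_def by (auto elim!: eventually_mono)
qed

lemma Hop_eq_sol:
  assumes u: "integrable N u" and eq: "AE x in N. x \<notin> S \<longrightarrow> u x = q x * Hop u x"
  shows "AE x in N. Hop u x = sol (Hop (\<lambda>y. indicator S y * u y)) x"
proof (rule solution_unique[OF _ _ Hop_split[OF assms]])
  show "integrable N (Hop u)" by (rule integrable_Hop[OF u])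
  show "integrable N (Hop (\<lambda>y. indicator S y * u y))"
    using integrable_mult_indicator[OF S_sets u] by (intro integrable_Hop) (simp add: scaleR_conv_of_real of_real_indicator)
qed

text \<open>Functions satisfying the equation off \<open>S\<close> are determined by their values on
  \<open>S\<close>. This keeps restricted eigenfunctions nonzero, makes \<open>A - z0\<close>
  injective and yields uniqueness of the extension almost everywhere.\<close>

lemma zero_of_zero_on_S:
  assumes u: "integrable N u" and eq: "AE x in N. x \<notin> S \<longrightarrow> u x = q x * Hop u x"
    and z: "AE x in N. x \<in> S \<longrightarrow> u x = 0"
  shows "AE x in N. u x = 0"
proof -
  have [measurable]: "u \<in> borel_measurable N" using u by auto
  have "Hop (\<lambda>y. indicator S y * u y) x = 0" if "x \<in> space N" for x
    using z that by (intro Hop_zero) (auto elim!: eventually_mono split: split_indicator)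
  with Hop_split[OF u eq] AE_space have "AE x in N. Hop u x = Lop (Hop u) x"
    by (auto elim!: eventually_mono)
  then have "AE x in N. Hop u x = 0" by (intro fixpoint_zero) auto
  with eq z show ?thesis by eventually_elim auto
qed

end

context kernel_reduction
begin

section \<open>Comparison of the full and the reduced operator\<close>

lemma opA_eq:
  "f \<in> borel_measurable N \<Longrightarrow> x \<in> space N \<Longrightarrow> opA N d K f x = d x * f x + Hop f x"
  unfolding opA_def by (simp add: cm_integral_K)

lemma bounded_shifted_opA: "bounded_L1_operator N (shifted (opA N d K) z0)"
proof -
  let ?T = "\<lambda>f x. d x * f x + Hop f x - z0 * f x"
  have T: "shifted (opA N d K) z0 f x = ?T f x" if "f \<in> L1 N" "x \<in> space N" for f x
    using that by (simp add: shifted_def opA_eq L1_def)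
  have int: "integrable N (?T f)" if "integrable N f" for f
    using that by (intro Bochner_Integration.integrable_diff Bochner_Integration.integrable_add
        integrable_d_mult integrable_Hop integrable_mult_right)
  have L1T: "shifted (opA N d K) z0 f \<in> L1 N" if "f \<in> L1 N" for f
    using int[of f] that T[OF that] by (auto simp: L1_def cong: Bochner_Integration.integrable_cong)
  show ?thesis unfolding bounded_L1_operator_def
  proof (intro conjI ballI allI impI)
    fix f g assume f: "f \<in> L1 N" and g: "g \<in> L1 N"
    show "AE x in N. shifted (opA N d K) z0 f x = shifted (opA N d K) z0 g x" if eq: "AE x in N. f x = g x"
    proof -
      have "Hop f x = Hop g x" if "x \<in> space N" for x using f g eq that by (intro Hop_cong_AE) (auto simp: L1_def)
      note H = this
      show ?thesis using eq AE_space by eventually_elim (simp add: T f g H)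
    qed
    have "(\<lambda>y. f y + g y) \<in> L1 N" using f g by (auto simp: L1_def)
    then show "AE x in N. shifted (opA N d K) z0 (\<lambda>y. f y + g y) x
        = shifted (opA N d K) z0 f x + shifted (opA N d K) z0 g x"
      using Hop_add[of f g] f g AE_space
      by (auto simp: L1_def T elim!: eventually_mono) (simp add: T L1_def algebra_simps)
  next
    fix c f assume f: "f \<in> L1 N"
    then have "(\<lambda>y. c * f y) \<in> L1 N" by (auto simp: L1_def)
    then show "AE x in N. shifted (opA N d K) z0 (\<lambda>y. c * f y) x = c * shifted (opA N d K) z0 f x"
      using f by (intro AE_I2) (simp add: T Hop_cmult algebra_simps)
  next
    show "\<exists>C. \<forall>f\<in>L1 N. L1_norm N (shifted (opA N d K) z0 f) \<le> C * L1_norm N f"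
    proof (intro exI ballI)
      fix f assume f: "f \<in> L1 N"
      then have fi: "integrable N f" by (simp add: L1_def)
      have "L1_norm N (shifted (opA N d K) z0 f) = L1_norm N (?T f)"
        unfolding L1_norm_def by (intro Bochner_Integration.integral_cong) (auto simp: T f)
      also have "\<dots> \<le> L1_norm N (\<lambda>x. d x * f x + Hop f x) + L1_norm N (\<lambda>x. z0 * f x)"
        by (intro L1_norm_diff_le Bochner_Integration.integrable_add integrable_d_mult integrable_Hop integrable_mult_right fi)
      also have "\<dots> \<le> (L1_norm N (\<lambda>x. d x * f x) + L1_norm N (Hop f)) + L1_norm N (\<lambda>x. z0 * f x)"
        by (intro add_right_mono L1_norm_add_le integrable_d_mult integrable_Hop fi)
      also have "L1_norm N (\<lambda>x. z0 * f x) = cmod z0 * L1_norm N f"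
        by (simp add: L1_norm_def norm_mult)
      also have "(L1_norm N (\<lambda>x. d x * f x) + L1_norm N (Hop f)) + cmod z0 * L1_norm N f
          \<le> (D + H + cmod z0) * L1_norm N f"
        using integrable_d_mult(2)[OF fi] integrable_Hop(2)[OF fi] by (simp add: algebra_simps)
      finally show "L1_norm N (shifted (opA N d K) z0 f) \<le> (D + H + cmod z0) * L1_norm N f" .
    qed
  qed (rule L1T)
qed

lemma AE_restrict_S: "(AE x in restrict_space N S. P x) \<longleftrightarrow> (AE x in N. x \<in> S \<longrightarrow> P x)"
  by (rule AE_restrict_space_iff) auto

lemma eigen_off_S:
  assumes u: "integrable N u" and eig: "AE x in N. opA N d K u x = z0 * u x"
  shows "AE x in N. x \<notin> S \<longrightarrow> u x = q x * Hop u x"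
  using eig AE_space
proof eventually_elim
  case (elim x)
  have "Hop u x = (z0 - d x) * u x"
    using elim u by (simp add: opA_eq algebra_simps)
  then show ?case using q_off_S[of x] elim(2) by (auto simp flip: mult.assoc)
qed

text \<open>Only the equation off \<open>S\<close> is assumed, so the identity serves restriction,
  extension and injectivity alike. As \<open>v\<close> is prescribed only on \<open>S\<close>, it
  may be \<open>restrict u S\<close>, which is \<open>undefined\<close> elsewhere.\<close>

lemma AE_opR_eq_opA:
  assumes u: "integrable N u" and eq: "AE x in N. x \<notin> S \<longrightarrow> u x = q x * Hop u x"
    and v: "\<And>x. x \<in> S \<Longrightarrow> v x = u x"
  shows "AE x in N. x \<in> S \<longrightarrow> opR N d K S z0 v x = opA N d K u x"
proof -
  have vu: "(\<lambda>y. indicator S y * v y) = (\<lambda>y. indicator S y * u y)" by (auto simp: v split: split_indicator)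
  have "integrable (restrict_space N S) v"
    unfolding integrable_extend_S vu
    using integrable_mult_indicator[OF S_sets u] by (simp add: scaleR_conv_of_real of_real_indicator)
  from AE_opR[OF this] Hop_eq_sol[OF u eq] AE_space show ?thesis
    unfolding vu by eventually_elim (use u in \<open>auto simp: v opA_eq\<close>)
qed

lemma eigenfunction_restrict:
  assumes "eigenfunction N (opA N d K) z0 u"
  shows "eigenfunction (restrict_space N S) (opR N d K S z0) z0 (restrict u S)"
proof -
  have u: "integrable N u" and nz: "\<not> (AE x in N. u x = 0)" and eig: "AE x in N. opA N d K u x = z0 * u x"
    using assms by (auto simp: eigenfunction_def L1_def)
  note off = eigen_off_S[OF u eig]
  have "(\<lambda>y. indicator S y * restrict u S y) = (\<lambda>y. indicator S y * u y)" by (auto split: split_indicator)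
  then have "integrable (restrict_space N S) (restrict u S)"
    unfolding integrable_extend_S
    using integrable_mult_indicator[OF S_sets u] by (simp add: scaleR_conv_of_real of_real_indicator)
  moreover have "AE x in restrict_space N S. opR N d K S z0 (restrict u S) x = z0 * restrict u S x"
    unfolding AE_restrict_S using AE_opR_eq_opA[OF u off, of "restrict u S"] eig by auto
  moreover have "\<not> (AE x in restrict_space N S. restrict u S x = 0)"
    unfolding AE_restrict_S using zero_of_zero_on_S[OF u off] nz by (auto simp: restrict_def cong: conj_cong)
  ultimately show ?thesis by (simp add: eigenfunction_def L1_def)
qed

lemma L1_norm_restrict: "L1_norm (restrict_space N S) v = L1_norm N (\<lambda>y. indicator S y * v y)"
  unfolding L1_norm_def by (subst integral_restrict_space) (auto intro!: Bochner_Integration.integral_cong split: split_indicator)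

text \<open>
  To solve \<open>(A - z0) u = f\<close>, note that it forces \<open>u = q (\<phi> - f)\<close> off \<open>S\<close> with \<open>\<phi> = Hop u\<close>. Inserting this into
  \<open>\<phi> = Hop u\<close> gives a fixed point equation for \<open>\<phi>\<close> in terms of \<open>u\<close> on \<open>S\<close> and \<open>f\<close>, and on \<open>S\<close> there remains
  \<open>(R - z0) u = f + sol (Hop (q f))\<close>.
\<close>
lemma invertible_opA:
  assumes "L1_invertible (restrict_space N S) (shifted (opR N d K S z0) z0)"
  shows "L1_invertible N (shifted (opA N d K) z0)"
proof -
  let ?NS = "restrict_space N S" and ?R = "shifted (opR N d K S z0) z0" and ?A = "shifted (opA N d K) z0"
  obtain Q where bQ: "bounded_L1_operator ?NS Q"
    and RQ: "\<And>f. f \<in> L1 ?NS \<Longrightarrow> AE x in ?NS. ?R (Q f) x = f x"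
    and QR: "\<And>f. f \<in> L1 ?NS \<Longrightarrow> AE x in ?NS. Q (?R f) x = f x"
    using assms by (auto simp: L1_invertible_def)
  have QL: "Q f \<in> L1 ?NS" if "f \<in> L1 ?NS" for f using bQ that by (auto simp: bounded_L1_operator_def)
  have Qcong: "AE x in ?NS. Q f x = Q g x" if "f \<in> L1 ?NS" "g \<in> L1 ?NS" "AE x in ?NS. f x = g x" for f g
    using bQ that by (auto simp: bounded_L1_operator_def)
  have Qmul: "AE x in ?NS. Q (\<lambda>y. c * f y) x = c * Q f x" if "f \<in> L1 ?NS" for c f
    using bQ that by (auto simp: bounded_L1_operator_def)
  obtain C' where C': "\<And>f. f \<in> L1 ?NS \<Longrightarrow> L1_norm ?NS (Q f) \<le> C' * L1_norm ?NS f"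
    using bQ unfolding bounded_L1_operator_def by blast
  \<comment> \<open>Nothing forces the given bound to be nonnegative, as the estimates below
    require.\<close>
  define CQ where "CQ = \<bar>C'\<bar>"
  have CQ: "L1_norm ?NS (Q f) \<le> CQ * L1_norm ?NS f" if "f \<in> L1 ?NS" for f
    using C'[OF that] mult_right_mono[OF abs_ge_self[of C'] L1_norm_nonneg[of ?NS f]] by (simp add: CQ_def)
  have CQ0: "0 \<le> CQ" by (simp add: CQ_def)
  \<comment> \<open>\<open>Cv\<close> bounds the part of \<open>u\<close> on \<open>S\<close>, that
    is \<open>Q\<close> applied to \<open>f + sol (Hop (q f))\<close>. The second summand of
    \<open>C\<close> bounds the part \<open>q (\<phi> - f)\<close> off \<open>S\<close>.\<close>
  define Cv where "Cv = CQ * (1 + solution_norm * (H * (1 / \<epsilon>)))"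
  define C where "C = Cv + 1 / \<epsilon> * (solution_norm * (H * (Cv + 1 / \<epsilon>)) + 1)"
  show ?thesis
  proof (rule L1_invertibleI[OF bounded_shifted_opA, of C])
    fix f assume "f \<in> L1 N"
    then have f: "integrable N f" by (simp add: L1_def)
    have [measurable]: "f \<in> borel_measurable N" using f by auto
    let ?qf = "\<lambda>y. q y * f y"
    note qf = integrable_q_mult[OF f]
    define w where "w = Hop ?qf"
    have w: "integrable N w" "L1_norm N w \<le> H * (1 / \<epsilon> * L1_norm N f)"
      unfolding w_def
      using integrable_Hop(1)[OF qf(1)] order_trans[OF integrable_Hop(2)[OF qf(1)] mult_left_mono[OF qf(2) H_nonneg]] by auto
    note sw = integrable_sol[OF w(1)]
    define g where "g x = f x + sol w x" for x
    have g: "integrable N g" unfolding g_def using f sw(1) by (rule Bochner_Integration.integrable_add)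
    have Sind: "integrable N (\<lambda>y. indicator S y * g y)" if "integrable N g" for g :: "'a \<Rightarrow> complex"
      using integrable_mult_indicator[OF S_sets that] by (simp add: scaleR_conv_of_real of_real_indicator)
    have gS: "g \<in> L1 ?NS" using Sind[OF g] by (simp add: L1_def integrable_extend_S)
    define v where "v = Q g"
    define v0 where "v0 y = indicator S y * v y" for y
    have v: "integrable ?NS v" using QL[OF gS] by (simp add: v_def L1_def)
    then have v0: "integrable N v0" unfolding v0_def integrable_extend_S .
    \<comment> \<open>Inserting \<open>u = v0 + q (\<phi> - f)\<close> into
      \<open>\<phi> = Hop u\<close> leaves \<open>\<phi> = \<psi> + Lop \<phi>\<close>.\<close>
    define \<psi> where "\<psi> = Hop (\<lambda>y. v0 y - ?qf y)"
    have \<psi>: "integrable N \<psi>" unfolding \<psi>_def by (intro integrable_Hop Bochner_Integration.integrable_diff v0 qf)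
    define \<phi> where "\<phi> = sol \<psi>"
    have \<phi>: "integrable N \<phi>" "AE x in N. \<phi> x = \<psi> x + Lop \<phi> x"
      unfolding \<phi>_def using AE_sol_eq[OF \<psi>] by auto
    define u where "u x = v0 x + q x * (\<phi> x - f x)" for x
    have \<phi>f: "integrable N (\<lambda>x. \<phi> x - f x)" using \<phi>(1) f by (rule Bochner_Integration.integrable_diff)
    have u: "integrable N u" unfolding u_def by (intro Bochner_Integration.integrable_add v0 integrable_q_mult \<phi>f)
    have Hu: "AE x in N. Hop u x = \<phi> x"
    proof -
      have "u = (\<lambda>x. (v0 x - ?qf x) + q x * \<phi> x)" by (auto simp: u_def algebra_simps)
      then have "AE x in N. Hop u x = \<psi> x + Lop \<phi> x"
        unfolding Lop_def \<psi>_def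
        using Hop_add[OF Bochner_Integration.integrable_diff[OF v0 qf(1)] integrable_q_mult(1)[OF \<phi>(1)]] by simp
      with \<phi>(2) show ?thesis by eventually_elim simp
    qed
    \<comment> \<open>Adding \<open>sol w\<close> cancels the contribution of \<open>f\<close> to
      \<open>\<psi>\<close>. Uniqueness of the fixed point thus replaces additivity of
      \<open>sol\<close> and links \<open>\<phi>\<close> with the series in the reduced
      operator.\<close>
    have key: "AE x in N. \<phi> x + sol w x = sol (Hop v0) x"
    proof (rule solution_unique)
      show "integrable N (\<lambda>x. \<phi> x + sol w x)" using \<phi>(1) sw(1) by (rule Bochner_Integration.integrable_add)
      show "integrable N (Hop v0)" by (rule integrable_Hop[OF v0])
      have "AE x in N. Lop (\<lambda>x. \<phi> x + sol w x) x = Lop \<phi> x + Lop (sol w) x"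
        unfolding Lop_def using Hop_add[OF integrable_q_mult(1)[OF \<phi>(1)] integrable_q_mult(1)[OF sw(1)]]
        by (simp add: distrib_left)
      moreover have "AE x in N. \<psi> x = Hop v0 x - w x"
        unfolding \<psi>_def w_def by (rule Hop_diff[OF v0 qf(1)])
      ultimately show "AE x in N. \<phi> x + sol w x = Hop v0 x + Lop (\<lambda>x. \<phi> x + sol w x) x"
        using \<phi>(2) AE_sol_eq(1)[OF w(1)] by eventually_elim simp
    qed
    have Rv: "AE x in N. x \<in> S \<longrightarrow> ?R v x = g x"
      using RQ[OF gS] unfolding AE_restrict_S v_def .
    have "AE x in N. ?A u x = f x"
      using Hu key Rv AE_opR[OF v] AE_space
    proof eventually_elim
      case (elim x)
      have A: "?A u x = d x * u x + \<phi> x - z0 * u x"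
        using elim u by (simp add: shifted_def opA_eq)
      show ?case
      proof (cases "x \<in> S")
        case True
        have ux: "u x = v x" using True by (simp add: u_def v0_def q_on_S)
        have "d x * v x + sol (Hop v0) x - z0 * v x = f x + sol w x"
          using elim(3,4) True by (simp add: shifted_def g_def v0_def[abs_def])
        then show ?thesis using A[unfolded ux] elim(2) by algebra
      next
        case False
        then have "u x * (z0 - d x) = \<phi> x - f x"
          using q_off_S[of x] elim(5) by (simp add: u_def v0_def mult.assoc mult.left_commute mult.commute)
        then show ?thesis using A by algebra
      qed
    qed
    moreover have "L1_norm N u \<le> C * L1_norm N f"
    proof -
      define a where "a = L1_norm N f"
      have a0: "0 \<le> a" by (simp add: a_def L1_norm_nonneg)
      have "L1_norm ?NS g \<le> L1_norm N g"
        unfolding L1_norm_restrict unfolding L1_norm_def using g Sind[OF g]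
        by (intro integral_mono integrable_norm) (auto split: split_indicator)
      also have "\<dots> \<le> L1_norm N f + L1_norm N (sol w)" unfolding g_def by (rule L1_norm_add_le[OF f sw(1)])
      also have "\<dots> \<le> a + solution_norm * (H * (1 / \<epsilon> * a))"
        using sw(2) mult_left_mono[OF w(2) solution_norm_nonneg] by (simp add: a_def)
      finally have "L1_norm ?NS v \<le> CQ * (a + solution_norm * (H * (1 / \<epsilon> * a)))"
        unfolding v_def using CQ[OF gS] mult_left_mono[OF _ CQ0] by (blast intro: order_trans)
      then have nv: "L1_norm N v0 \<le> Cv * a"
        unfolding v0_def L1_norm_restrict[symmetric] by (simp add: Cv_def algebra_simps)
      have "L1_norm N \<psi> \<le> H * (L1_norm N v0 + L1_norm N ?qf)"
        unfolding \<psi>_def using H_nonneg v0 qf(1)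
        by (intro order_trans[OF integrable_Hop(2)] mult_left_mono L1_norm_diff_le) auto
      also have "\<dots> \<le> H * (Cv * a + 1 / \<epsilon> * a)"
        using nv qf(2) H_nonneg by (intro mult_left_mono add_mono) (auto simp: a_def)
      finally have "L1_norm N \<phi> \<le> solution_norm * (H * (Cv * a + 1 / \<epsilon> * a))"
        unfolding \<phi>_def using solution_norm_nonneg
        by (intro order_trans[OF integrable_sol(2)[OF \<psi>]] mult_left_mono)
      then have "L1_norm N (\<lambda>x. \<phi> x - f x) \<le> solution_norm * (H * (Cv * a + 1 / \<epsilon> * a)) + a"
        using L1_norm_diff_le[OF \<phi>(1) f] by (simp add: a_def)
      then have "1 / \<epsilon> * L1_norm N (\<lambda>x. \<phi> x - f x) \<le> 1 / \<epsilon> * (solution_norm * (H * (Cv * a + 1 / \<epsilon> * a)) + a)"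
        using \<epsilon>_pos by (intro mult_left_mono) auto
      then have "L1_norm N u \<le> Cv * a + 1 / \<epsilon> * (solution_norm * (H * (Cv * a + 1 / \<epsilon> * a)) + a)"
        using L1_norm_add_le[OF v0 integrable_q_mult(1)[OF \<phi>f]] integrable_q_mult(2)[OF \<phi>f] nv
        unfolding u_def by linarith
      then show ?thesis unfolding C_def a_def[symmetric] by (simp add: algebra_simps)
    qed
    ultimately show "\<exists>u\<in>L1 N. (AE x in N. ?A u x = f x) \<and> L1_norm N u \<le> C * L1_norm N f"
      using u by (auto simp: L1_def)
  next
    fix u assume "u \<in> L1 N" and z: "AE x in N. ?A u x = 0"
    then have u: "integrable N u" by (simp add: L1_def)
    have eig: "AE x in N. opA N d K u x = z0 * u x" using z by eventually_elim (simp add: shifted_def)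
    note off = eigen_off_S[OF u eig]
    have uS: "u \<in> L1 ?NS"
      using integrable_mult_indicator[OF S_sets u] by (simp add: L1_def integrable_extend_S scaleR_conv_of_real of_real_indicator)
    \<comment> \<open>Zero is written as \<open>0 * u x\<close> so that homogeneity of
      \<open>Q\<close> with factor 0 gives the value of \<open>Q\<close> at zero.\<close>
    have Ru: "AE x in ?NS. ?R u x = 0 * u x"
      unfolding AE_restrict_S using AE_opR_eq_opA[OF u off, of u] eig by (auto simp: shifted_def)
    have um: "u \<in> borel_measurable ?NS" using uS by (auto simp: L1_def)
    \<comment> \<open>Vanishing almost everywhere does not by itself give measurability when the
      measure is not complete.\<close>
    have "?R u \<in> borel_measurable ?NS"
      unfolding shifted_def[abs_def] using opR_measurable[OF um] um by measurable
    then have "?R u \<in> L1 ?NS"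
      unfolding L1_def using Ru by (auto simp: integrable_cong_AE[of _ _ "\<lambda>_. 0"])
    moreover have "(\<lambda>x. 0 * u x) \<in> L1 ?NS" by (simp add: L1_def)
    ultimately have "AE x in ?NS. Q (?R u) x = Q (\<lambda>x. 0 * u x) x" using Ru by (intro Qcong)
    with Qmul[OF uS, of 0] QR[OF uS] have "AE x in ?NS. u x = 0" by eventually_elim simp
    then show "AE x in N. u x = 0" unfolding AE_restrict_S by (rule zero_of_zero_on_S[OF u off])
  qed
qed

end

section \<open>Extension of eigenfunctions along the depth sets\<close>

context kernel_reduction
begin

text \<open>Stage \<open>n\<close> settles the values on \<open>E n\<close> and is 0 elsewhere, so
  that every stage is a measurable function on the whole space.\<close>

primrec extension_step :: "('a \<Rightarrow> complex) \<Rightarrow> nat \<Rightarrow> 'a \<Rightarrow> complex" where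
  "extension_step v 0 x = indicator S x * v x"
| "extension_step v (Suc n) x =
    (if x \<in> E n then extension_step v n x
     else indicator (E (Suc n)) x * (q x * Hop (\<lambda>y. indicator (E n) y * extension_step v n y) x))"

definition extension :: "('a \<Rightarrow> complex) \<Rightarrow> 'a \<Rightarrow> complex" where
  "extension v x = extension_step v (LEAST n. x \<in> E n) x"

lemma extension_step_add: "x \<in> E n \<Longrightarrow> extension_step v (n + k) x = extension_step v n x"
  using E_mono[OF le_add1, of n] by (induction k) (auto dest!: subsetD)

lemma extension_eq_step:
  assumes "x \<in> E n"
  shows "extension v x = extension_step v n x"
proof -
  let ?m = "LEAST n. x \<in> E n"
  have "x \<in> E ?m" using assms by (rule LeastI)
  moreover have "?m \<le> n" using assms by (rule Least_le)
  ultimately show ?thesis unfolding extension_def using extension_step_add[of x ?m v "n - ?m"] by simp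
qed

lemma extension_on_S: "x \<in> S \<Longrightarrow> extension v x = v x"
  using extension_eq_step[of x 0 v] by (simp add: E_0)

lemma extension_off:
  assumes "x \<in> E (Suc n)" "x \<notin> E n"
  shows "extension v x = q x * Hop (\<lambda>y. indicator (E n) y * extension v y) x"
proof -
  have "(\<lambda>y. indicator (E n) y * extension v y) = (\<lambda>y. indicator (E n) y * extension_step v n y)"
    by (auto simp: extension_eq_step split: split_indicator)
  then show ?thesis using assms extension_eq_step[OF assms(1), of v] by simp
qed

lemma ex_depth:
  assumes "x \<in> space N - S"
  obtains n where "x \<in> E (Suc n)" "x \<notin> E n"
proof -
  let ?m = "LEAST n. x \<in> E n"
  have "\<exists>n. x \<in> E n" using assms E_union by auto
  then have m: "x \<in> E ?m" by (rule LeastI_ex)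
  moreover have "?m \<noteq> 0" using m E_0 assms by (metis DiffD2)
  ultimately obtain k where "?m = Suc k" by (cases ?m) auto
  moreover from this have "x \<notin> E k" using not_less_Least[of k "\<lambda>n. x \<in> E n"] by simp
  ultimately show ?thesis using m that[of k] by simp
qed

text \<open>At a point of \<open>E (Suc n)\<close> off \<open>S\<close> the kernel has no mass
  outside \<open>E n\<close>. The integral over a depth set in the recursion is therefore a full
  integral, and all depths share the equation \<open>u = q H u\<close>.\<close>

lemma Hop_indicator_E:
  assumes [measurable]: "f \<in> borel_measurable N" and x: "x \<in> E (Suc n) - S"
  shows "Hop (\<lambda>y. indicator (E n) y * f y) x = Hop f x"
proof -
  have [measurable]: "x \<in> space N" using x sets.sets_into_space[OF E_sets[of "Suc n"]] by auto
  have "AE y in N. h x y = 0 \<or> indicator (E n) y * f y = f y"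
    using h_vanish[OF x] by eventually_elim (auto split: split_indicator)
  then show ?thesis unfolding Hop_def by (intro dens_int_cong_AE) auto
qed

context
  fixes v :: "'a \<Rightarrow> complex"
  assumes v: "integrable (restrict_space N S) v"
begin

lemma v_measurable: "v \<in> borel_measurable (restrict_space N S)"
  using v by auto

lemma extension_step_measurable[measurable]: "extension_step v n \<in> borel_measurable N"
proof (induction n)
  case 0
  show ?case using measurable_extend_S[OF v_measurable] by simp
next
  case (Suc n)
  note [measurable] = Suc
  show ?case unfolding extension_step.simps(2)[abs_def] by measurable
qed

text \<open>The stages are eventually constant at each point, so the extension is their pointwise
  limit.\<close>

lemma extension_measurable[measurable]: "extension v \<in> borel_measurable N"
proof (rule borel_measurable_LIMSEQ_metric[of "\<lambda>n. extension_step v n"])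
  fix x assume "x \<in> space N"
  then obtain m where m: "x \<in> E m" using E_union by auto
  have "eventually (\<lambda>n. extension_step v n x = extension v x) sequentially"
    using eventually_ge_at_top[of m]
  proof eventually_elim
    case (elim n)
    then have "x \<in> E n" using m E_mono by auto
    then show ?case by (simp add: extension_eq_step)
  qed
  then show "(\<lambda>n. extension_step v n x) \<longlonglongrightarrow> extension v x" by (rule tendsto_eventually)
qed measurable

lemma extension_off_S:
  assumes x: "x \<in> space N - S"
  shows "extension v x = q x * Hop (extension v) x"
proof -
  obtain n where "x \<in> E (Suc n)" "x \<notin> E n" by (rule ex_depth[OF x])
  then show ?thesis using extension_off[of x n v] Hop_indicator_E[of "extension v" x n] x by simp
qed

text \<open>
  \<open>W\<close> solves the recursion with absolute values, hence dominates the extension at every depth.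
\<close>
lemma extension_bound:
  defines "W \<equiv> neumann_abs (absH (\<lambda>y. ennreal (cmod (indicator S y * v y))))"
  shows "x \<in> E n \<Longrightarrow> ennreal (cmod (extension v x)) \<le> ennreal (cmod (indicator S x * v x)) + ennreal (cmod (q x)) * W x"
proof (induction n arbitrary: x)
  case 0
  then show ?case by (simp add: E_0 extension_on_S)
next
  case (Suc n)
  have [measurable]: "(\<lambda>y. indicator S y * v y) \<in> borel_measurable N" by (rule measurable_extend_S[OF v_measurable])
  have [measurable]: "W \<in> borel_measurable N" unfolding W_def by measurable
  have [measurable]: "x \<in> space N" using Suc.prems sets.sets_into_space[OF E_sets[of "Suc n"]] by auto
  show ?case
  proof (cases "x \<in> E n")
    case True then show ?thesis by (rule Suc.IH)
  next
    case False
    let ?v0 = "\<lambda>y. ennreal (cmod (indicator S y * v y))"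
    have "ennreal (cmod (Hop (\<lambda>y. indicator (E n) y * extension v y) x))
        \<le> absH (\<lambda>y. ennreal (cmod (indicator (E n) y * extension v y))) x"
      by (rule Hop_bound) measurable
    also have "\<dots> \<le> absH (\<lambda>y. ?v0 y + ennreal (cmod (q y)) * W y) x"
      by (rule absH_mono) (auto simp: Suc.IH split: split_indicator)
    also have "\<dots> = absH ?v0 x + absL W x"
      unfolding absL_def absH_def by (subst nn_integral_add[symmetric]) (auto simp: distrib_left)
    also have "\<dots> = W x"
      unfolding W_def by (rule neumann_abs_eq[symmetric]) measurable
    finally have "ennreal (cmod (extension v x)) \<le> ennreal (cmod (q x)) * W x"
      unfolding extension_off[OF Suc.prems False] by (simp add: norm_mult ennreal_mult mult_left_mono)
    then show ?thesis by (rule order_trans) simp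
  qed
qed

lemma integrable_extension: "integrable N (extension v)"
proof (rule integrableI_bounded)
  let ?v0 = "\<lambda>y. ennreal (cmod (indicator S y * v y))"
  have [measurable]: "(\<lambda>y. indicator S y * v y) \<in> borel_measurable N" by (rule measurable_extend_S[OF v_measurable])
  have f0: "(\<integral>\<^sup>+y. ?v0 y \<partial>N) < \<infinity>"
    using v[unfolded integrable_extend_S] unfolding integrable_iff_bounded by simp
  have "(\<integral>\<^sup>+y. absH ?v0 y \<partial>N) < \<infinity>" by (rule ennreal_le_mult_finite[OF nn_integral_absH_le f0]) measurable
  then have fW: "(\<integral>\<^sup>+y. neumann_abs (absH ?v0) y \<partial>N) < \<infinity>"
    by (rule ennreal_le_mult_finite[OF nn_integral_neumann_abs, rotated]) measurable
  have "(\<integral>\<^sup>+x. ennreal (norm (extension v x)) \<partial>N)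
      \<le> (\<integral>\<^sup>+x. ?v0 x + ennreal (1 / \<epsilon>) * neumann_abs (absH ?v0) x \<partial>N)"
  proof (rule nn_integral_mono)
    fix x assume x: "x \<in> space N"
    then obtain n where "x \<in> E n" using E_union by auto
    from extension_bound[OF this] show "ennreal (norm (extension v x)) \<le> ?v0 x + ennreal (1 / \<epsilon>) * neumann_abs (absH ?v0) x"
      by (rule order_trans) (intro add_left_mono mult_right_mono ennreal_leI cmod_q_le x, simp)
  qed
  also have "\<dots> = (\<integral>\<^sup>+x. ?v0 x \<partial>N) + ennreal (1 / \<epsilon>) * (\<integral>\<^sup>+x. neumann_abs (absH ?v0) x \<partial>N)"
    by (simp add: nn_integral_add nn_integral_cmult)
  also have "\<dots> < \<infinity>" using f0 fW by (simp add: ennreal_mult_less_top)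
  finally show "(\<integral>\<^sup>+x. ennreal (norm (extension v x)) \<partial>N) < \<infinity>" .
qed measurable

lemma eigenfunction_extension:
  assumes eig: "eigenfunction (restrict_space N S) (opR N d K S z0) z0 v"
  shows "eigenfunction N (opA N d K) z0 (extension v)"
proof -
  have nz: "\<not> (AE x in N. x \<in> S \<longrightarrow> v x = 0)" and ev: "AE x in N. x \<in> S \<longrightarrow> opR N d K S z0 v x = z0 * v x"
    using eig by (auto simp: eigenfunction_def AE_restrict_S)
  have off: "AE x in N. x \<notin> S \<longrightarrow> extension v x = q x * Hop (extension v) x"
    by (rule AE_I2) (auto simp: extension_off_S)
  have "AE x in N. x \<in> S \<longrightarrow> opR N d K S z0 v x = opA N d K (extension v) x"
    by (rule AE_opR_eq_opA[OF integrable_extension off]) (simp add: extension_on_S)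
  with ev AE_space have "AE x in N. opA N d K (extension v) x = z0 * extension v x"
  proof eventually_elim
    case (elim x)
    show ?case
    proof (cases "x \<in> S")
      case True then show ?thesis using elim by (simp add: extension_on_S)
    next
      case False
      then have e: "extension v x = q x * Hop (extension v) x" using extension_off_S elim(2) by blast
      have "q x * (z0 - d x) = 1" using False elim(2) by (intro q_off_S) auto
      moreover have "opA N d K (extension v) x = d x * extension v x + Hop (extension v) x"
        using elim(2) by (intro opA_eq) auto
      ultimately show ?thesis using e by algebra
    qed
  qed
  moreover have "\<not> (AE x in N. extension v x = 0)"
  proof
    assume "AE x in N. extension v x = 0"
    then have "AE x in N. x \<in> S \<longrightarrow> v x = 0" by eventually_elim (auto simp: extension_on_S)
    with nz show False by simp
  qed
  ultimately show ?thesis using integrable_extension by (simp add: eigenfunction_def L1_def)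
qed

end

end

text \<open>The abstract sets \<open>E n\<close> are identified with the depth sets only here, where
  the recursive relations mention these by name.\<close>

locale depth_reduction = kernel_reduction +
  assumes E_eq_depth: "E n = depth_set N K S n"
begin

text \<open>A point off \<open>S\<close> enters the depth sets at exactly one index, and there
  \<open>Hop_indicator_E\<close> turns its relation into the equation off \<open>S\<close>.
  Measurability of \<open>u\<close> lets \<open>cm_integral\<close> be read as
  \<open>Hop\<close>.\<close>

lemma depth_relation_iff:
  assumes u[measurable]: "u \<in> borel_measurable N" and x: "x \<in> space N"
  shows "depth_relation N d K S z0 v u x \<longleftrightarrow> (if x \<in> S then u x = v x else u x = q x * Hop u x)"
proof (cases "x \<in> S")
  case True
  then have "x \<in> E n" for n using E_mono[of 0 n] E_0 by auto
  then show ?thesis using True by (auto simp: depth_relation_def simp flip: E_eq_depth)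
next
  case False
  then have xS: "x \<in> space N - S" using x by simp
  have cm: "cm_integral N (sets N) (K x) (\<lambda>y. indicator (E n) y * (u y / (z0 - d x))) = q x * Hop u x"
    if "x \<in> E (Suc n)" for n
  proof -
    have "(\<lambda>y. indicator (E n) y * (u y / (z0 - d x))) = (\<lambda>y. q x * (indicator (E n) y * u y))"
      using False x by (auto simp: q_def)
    then have "cm_integral N (sets N) (K x) (\<lambda>y. indicator (E n) y * (u y / (z0 - d x)))
        = q x * Hop (\<lambda>y. indicator (E n) y * u y) x"
      using x by (simp add: cm_integral_K Hop_cmult)
    then show ?thesis using Hop_indicator_E[OF u, of x n] that False by simp
  qed
  obtain m where m: "x \<in> E (Suc m)" "x \<notin> E m" by (rule ex_depth[OF xS])
  have "depth_relation N d K S z0 v u x \<longleftrightarrow>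
      (\<forall>n\<ge>1. x \<in> E n - E (n - 1) \<longrightarrow>
        u x = cm_integral N (sets N) (K x) (\<lambda>y. indicator (E (n - 1)) y * (u y / (z0 - d x))))"
    using False by (simp add: depth_relation_def E_eq_depth)
  also have "\<dots> \<longleftrightarrow> u x = q x * Hop u x"
  proof
    assume "\<forall>n\<ge>1. x \<in> E n - E (n - 1) \<longrightarrow>
        u x = cm_integral N (sets N) (K x) (\<lambda>y. indicator (E (n - 1)) y * (u y / (z0 - d x)))"
    from this[rule_format, of "Suc m"] m cm[of m] show "u x = q x * Hop u x" by simp
  next
    assume eq: "u x = q x * Hop u x"
    show "\<forall>n\<ge>1. x \<in> E n - E (n - 1) \<longrightarrow>
        u x = cm_integral N (sets N) (K x) (\<lambda>y. indicator (E (n - 1)) y * (u y / (z0 - d x)))"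
    proof (intro allI impI)
      fix n assume n: "1 \<le> n" "x \<in> E n - E (n - 1)"
      then show "u x = cm_integral N (sets N) (K x) (\<lambda>y. indicator (E (n - 1)) y * (u y / (z0 - d x)))"
        using cm[of "n - 1"] eq by simp
    qed
  qed
  finally show ?thesis using False by simp
qed

lemma depth_relation_extension:
  assumes "integrable (restrict_space N S) v" "x \<in> space N"
  shows "depth_relation N d K S z0 v (extension v) x"
  using assms extension_off_S[OF assms(1)] extension_measurable[OF assms(1)]
  by (simp add: depth_relation_iff extension_on_S)

text \<open>Neither function has to be measurable: by induction on the depth the two integrands
  coincide as functions, so \<open>cm_integral\<close> gives them the same value, whatever it
  is.\<close>

lemma depth_relation_unique:
  assumes u: "\<And>x. x \<in> space N \<Longrightarrow> depth_relation N d K S z0 v u x"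
    and w: "\<And>x. x \<in> space N \<Longrightarrow> depth_relation N d K S z0 v w x"
  shows "x \<in> space N \<Longrightarrow> w x = u x"
proof -
  have "w x = u x" if "x \<in> E n" for n x
    using that
  proof (induction n arbitrary: x)
    case 0
    then show ?case
      using u[of x] w[of x] sets.sets_into_space[OF S_sets] by (auto simp: depth_relation_def E_0)
  next
    case (Suc n)
    have xN: "x \<in> space N" using Suc.prems E_union by auto
    show ?case
    proof (cases "x \<in> E n")
      case False
      have "w x = cm_integral N (sets N) (K x) (\<lambda>y. indicator (E n) y * (w y / (z0 - d x)))"
        "u x = cm_integral N (sets N) (K x) (\<lambda>y. indicator (E n) y * (u y / (z0 - d x)))"
        using u[OF xN] w[OF xN] Suc.prems False
        unfolding depth_relation_def E_eq_depth[symmetric] by (auto dest!: spec[of _ "Suc n"])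
      moreover have "(\<lambda>y. indicator (E n) y * (w y / (z0 - d x))) = (\<lambda>y. indicator (E n) y * (u y / (z0 - d x)))"
        by (auto simp: Suc.IH split: split_indicator)
      ultimately show ?thesis by simp
    qed (rule Suc.IH)
  qed
  then show "x \<in> space N \<Longrightarrow> w x = u x" using E_union by blast
qed

lemma depth_relation_unique_AE:
  assumes v: "integrable (restrict_space N S) v" and w: "integrable N w"
    and rel: "AE x in N. depth_relation N d K S z0 v w x"
  shows "AE x in N. w x = extension v x"
proof -
  note ext = integrable_extension[OF v]
  have wm: "w \<in> borel_measurable N" using w by auto
  have H: "AE x in N. Hop (\<lambda>y. w y - extension v y) x = Hop w x - Hop (extension v) x"
    by (rule Hop_diff[OF w ext])
  have "AE x in N. w x - extension v x = 0"
  proof (rule zero_of_zero_on_S)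
    show "integrable N (\<lambda>x. w x - extension v x)" using w ext by simp
    show "AE x in N. x \<notin> S \<longrightarrow> w x - extension v x = q x * Hop (\<lambda>x. w x - extension v x) x"
      using rel H AE_space
      by eventually_elim (auto simp: depth_relation_iff[OF wm] extension_off_S[OF v] right_diff_distrib)
    show "AE x in N. x \<in> S \<longrightarrow> w x - extension v x = 0"
      using rel AE_space by eventually_elim (auto simp: depth_relation_iff[OF wm] extension_on_S)
  qed
  then show ?thesis by eventually_elim simp
qed

end

text \<open>This links the pointwise nilpotency of type B with the depth sets. The latter ignore
  null sets, so only this implication is claimed.\<close>

lemma phi_iter_empty_depth_set:
  assumes vanish: "\<And>x n. x \<in> space N - S \<Longrightarrow> (\<And>y. y \<in> space N \<Longrightarrow> y \<notin> depth_set N K S n \<Longrightarrow> h x y = 0) \<Longrightarrow>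
      x \<in> depth_set N K S (Suc n)"
  shows "x \<in> space N \<Longrightarrow> phi_iter N h S n x = {} \<Longrightarrow> x \<in> depth_set N K S n"
proof -
  \<comment> \<open>The definition peels off the last step of a chain, whereas the induction needs
    the first one.\<close>
  have shift: "phi_iter N h S (Suc n) x = (\<Union>y\<in>phi N h S x. phi_iter N h S n y)" for n x
    by (induction n) auto
  show "x \<in> space N \<Longrightarrow> phi_iter N h S n x = {} \<Longrightarrow> x \<in> depth_set N K S n"
  proof (induction n arbitrary: x)
    case 0 then show ?case by simp
  next
    case (Suc n)
    have S_depth: "S \<subseteq> depth_set N K S m" for m by (induction m) auto
    show ?case
    proof (cases "x \<in> S")
      case True then show ?thesis using S_depth by blast
    next
      case False
      have e: "phi_iter N h S n y = {}" if "y \<in> phi N h S x" for y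
        using Suc.prems(2) that unfolding shift by blast
      show ?thesis
      proof (rule vanish)
        show "x \<in> space N - S" using False Suc.prems by auto
        fix y assume y: "y \<in> space N" "y \<notin> depth_set N K S n"
        show "h x y = 0"
        proof (rule ccontr)
          assume "h x y \<noteq> 0"
          then have "y \<in> phi N h S x" using y S_depth[of n] by (auto simp: phi_def kernel_supp_def)
          from e[OF this] Suc.IH[OF y(1)] y(2) show False by simp
        qed
      qed
    qed
  qed
qed

lemma depth_reductionI:
  fixes \<mu> :: "'a measure"
  assumes "sigma_finite_measure \<mu>" "kernel_density \<mu> K h" "d \<in> Linf \<mu>"
    and type_B: "structural_type_B \<mu> K h S" and z0: "z0 \<notin> Sigma_d \<mu> d S"
  shows "\<exists>H \<epsilon> D M. depth_reduction \<mu> h d S z0 H \<epsilon> D M (depth_set \<mu> K S) K"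
proof -
  interpret sigma_finite_measure \<mu> by fact
  have hp: "case_prod h \<in> borel_measurable (\<mu> \<Otimes>\<^sub>M \<mu>)"
    and hb: "(SUP y \<in> space \<mu>. \<integral>\<^sup>+ x. ennreal (cmod (h x y)) \<partial>\<mu>) < \<infinity>"
    and hint: "\<And>x. x \<in> space \<mu> \<Longrightarrow> integrable \<mu> (h x)"
    and K: "\<And>x B. x \<in> space \<mu> \<Longrightarrow> B \<in> sets \<mu> \<Longrightarrow> K x B = (LINT y:B|\<mu>. h x y)"
    using assms(2) by (auto simp: kernel_density_def L1inf_def)
  have hm[measurable (raw)]: "(\<lambda>w. h (f w) (g w)) \<in> borel_measurable P"
    if "f \<in> measurable P \<mu>" "g \<in> measurable P \<mu>" for f g and P :: "'b measure"
    using measurable_compose[OF measurable_Pair[OF that] hp] by simp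
  have dm: "d \<in> borel_measurable \<mu>" and db: "bounded (d ` space \<mu>)" using assms(3) by (auto simp: Linf_def)
  obtain D where D: "\<And>x. x \<in> space \<mu> \<Longrightarrow> cmod (d x) \<le> D" using db by (auto simp: bounded_iff)
  obtain M0 :: "'a \<Rightarrow> real" where S[measurable]: "S \<in> sets \<mu>"
    and M0m: "M0 \<in> borel_measurable (restrict_space \<mu> (space \<mu> - S))"
    and "\<forall>x \<in> space \<mu> - S. 0 \<le> M0 x"
    and "\<forall>x \<in> space \<mu> - S. \<exists>n. phi_iter \<mu> h S n x = {}"
    and "\<forall>x \<in> space \<mu> - S. \<forall>B \<in> sets \<mu>. B \<subseteq> space \<mu> - S \<longrightarrow>
           ennreal (cmod (K x B)) \<le> ennreal (M0 x) * emeasure \<mu> B"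
    and M0int: "integrable (restrict_space \<mu> (space \<mu> - S)) (\<lambda>x. real (nS \<mu> h S x) * M0 x)"
    using type_B unfolding structural_type_B_def by (elim conjE exE) (rule that)
  note M0 = this(3)[rule_format] and nilp = this(4)[rule_format] and dom = this(5)[rule_format]
  define M where "M x = indicator (space \<mu> - S) x * M0 x" for x
  have M_int: "integrable \<mu> M"
  proof -
    have "integrable (restrict_space \<mu> (space \<mu> - S)) M0"
    proof (rule Bochner_Integration.integrable_bound[OF M0int M0m], rule AE_I2)
      fix x assume "x \<in> space (restrict_space \<mu> (space \<mu> - S))"
      then have x: "x \<in> space \<mu> - S" by (simp add: space_restrict_space)
      have "phi_iter \<mu> h S (nS \<mu> h S x) x = {}" unfolding nS_def using nilp[OF x] by (rule LeastI_ex)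
      \<comment> \<open>The zeroth iterate is \<open>{x}\<close>, so the index is at least 1 and
        \<open>M0\<close> is bounded by the integrable product.\<close>
      then have "nS \<mu> h S x \<noteq> 0" by (metis insert_not_empty phi_iter.simps(1))
      then have "1 * M0 x \<le> real (nS \<mu> h S x) * M0 x" using M0[OF x] by (intro mult_right_mono) auto
      then show "norm (M0 x) \<le> norm (real (nS \<mu> h S x) * M0 x)" using M0[OF x] by simp
    qed
    then show ?thesis unfolding M_def[abs_def] by (subst (asm) integrable_restrict_space) auto
  qed
  have tv: "total_variation \<mu> (K x) B = (\<integral>\<^sup>+y. ennreal (cmod (h x y)) * indicator B y \<partial>\<mu>)"
    if "x \<in> space \<mu>" "B \<in> sets \<mu>" for x B
    using that by (intro total_variation_eq_nn_integral hint K) auto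
  let ?E = "depth_set \<mu> K S"
  have E_sets: "?E n \<in> sets \<mu>" for n
  proof (induction n)
    case (Suc n)
    note [measurable] = Suc
    have "{x \<in> space \<mu>. total_variation \<mu> (K x) (space \<mu> - ?E n) = 0}
        = {x \<in> space \<mu>. (\<integral>\<^sup>+y. ennreal (cmod (h x y)) * indicator (space \<mu> - ?E n) y \<partial>\<mu>) = 0}"
      by (rule Collect_cong) (simp add: tv cong: conj_cong)
    also have "\<dots> \<in> sets \<mu>" by measurable
    finally show ?case by simp
  qed simp
  have depth_zero_iff: "total_variation \<mu> (K x) (space \<mu> - ?E n) = 0 \<longleftrightarrow> (AE y in \<mu>. y \<notin> ?E n \<longrightarrow> h x y = 0)"
    if x[measurable]: "x \<in> space \<mu>" for x n
  proof -
    have [measurable]: "?E n \<in> sets \<mu>" by (rule E_sets)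
    have [measurable]: "h x \<in> borel_measurable \<mu>" using hint[OF x] by auto
    have "total_variation \<mu> (K x) (space \<mu> - ?E n) = 0 \<longleftrightarrow>
        (AE y in \<mu>. ennreal (cmod (h x y)) * indicator (space \<mu> - ?E n) y = 0)"
      using x by (simp add: tv nn_integral_0_iff_AE)
    also have "\<dots> \<longleftrightarrow> (AE y in \<mu>. y \<notin> ?E n \<longrightarrow> h x y = 0)"
      by (rule AE_cong) (auto split: split_indicator)
    finally show ?thesis .
  qed
  have E_union: "(\<Union>n. ?E n) = space \<mu>"
  proof
    show "(\<Union>n. ?E n) \<subseteq> space \<mu>" using sets.sets_into_space[OF E_sets] by auto
    show "space \<mu> \<subseteq> (\<Union>n. ?E n)"
    proof
      fix x assume x: "x \<in> space \<mu>"
      show "x \<in> (\<Union>n. ?E n)"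
      proof (cases "x \<in> S")
        case True then have "x \<in> ?E 0" by simp
        then show ?thesis by blast
      next
        case False
        then obtain n where n: "phi_iter \<mu> h S n x = {}" using nilp[of x] x by auto
        have "z \<in> ?E (Suc m)"
          if "z \<in> space \<mu> - S" "\<And>y. y \<in> space \<mu> \<Longrightarrow> y \<notin> ?E m \<Longrightarrow> h z y = 0" for z m
        proof -
          have "AE y in \<mu>. y \<notin> ?E m \<longrightarrow> h z y = 0" using that(2) by (intro AE_I2) auto
          then show ?thesis using that(1) by (simp add: depth_zero_iff)
        qed
        from phi_iter_empty_depth_set[OF this x n] show ?thesis by blast
      qed
    qed
  qed
  have h_vanish: "x \<in> ?E (Suc n) - S \<Longrightarrow> AE y in \<mu>. y \<notin> ?E n \<longrightarrow> h x y = 0" for x n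
  proof (induction n)
    case 0
    then have x: "x \<in> space \<mu>" and "total_variation \<mu> (K x) (space \<mu> - ?E 0) = 0" by auto
    then show ?case by (simp only: depth_zero_iff[OF x])
  next
    case (Suc n)
    show ?case
    proof (cases "x \<in> ?E (Suc n)")
      \<comment> \<open>The depth sets are cumulative: a point that entered earlier has its kernel
        concentrated on an earlier, smaller set.\<close>
      case True
      then have "x \<in> ?E (Suc n) - S" using Suc.prems by blast
      then have "AE y in \<mu>. y \<notin> ?E n \<longrightarrow> h x y = 0" by (rule Suc.IH)
      then show ?thesis by eventually_elim auto
    next
      case False
      have "?E (Suc (Suc n)) = {x \<in> space \<mu>. total_variation \<mu> (K x) (space \<mu> - ?E (Suc n)) = 0} \<union> ?E (Suc n)"
        by (rule depth_set.simps(2))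
      then have x: "x \<in> space \<mu>" and "total_variation \<mu> (K x) (space \<mu> - ?E (Suc n)) = 0"
        using Suc.prems False by blast+
      then show ?thesis by (simp only: depth_zero_iff[OF x])
    qed
  qed
  \<comment> \<open>A ball around \<open>z0\<close> avoids the closed set \<open>Sigma_d\<close>;
    its radius serves as \<open>\<epsilon>\<close>.\<close>
  obtain \<epsilon> where \<epsilon>: "0 < \<epsilon>" "\<And>x. x \<in> space \<mu> - S \<Longrightarrow> \<epsilon> \<le> cmod (z0 - d x)"
  proof -
    have "open (- Sigma_d \<mu> d S)" by (simp add: Sigma_d_def open_Compl)
    moreover have "z0 \<in> - Sigma_d \<mu> d S" using z0 by simp
    ultimately obtain e where e: "0 < e" "ball z0 e \<subseteq> - Sigma_d \<mu> d S" by (rule openE)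
    have le: "e \<le> cmod (z0 - d x)" if x: "x \<in> space \<mu> - S" for x
    proof (rule ccontr)
      assume "\<not> e \<le> cmod (z0 - d x)"
      then have "d x \<in> ball z0 e" by (simp add: dist_norm)
      moreover have "d x \<in> Sigma_d \<mu> d S"
        unfolding Sigma_d_def using x by (intro subsetD[OF closure_subset] imageI)
      ultimately show False using e(2) by blast
    qed
    show ?thesis by (rule that[OF e(1) le])
  qed
  obtain H where H: "0 \<le> H" "(SUP y \<in> space \<mu>. \<integral>\<^sup>+ x. ennreal (cmod (h x y)) \<partial>\<mu>) = ennreal H"
    using hb by (cases "SUP y \<in> space \<mu>. \<integral>\<^sup>+ x. ennreal (cmod (h x y)) \<partial>\<mu>") auto
  have "depth_reduction \<mu> h d S z0 H \<epsilon> D M ?E K"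
  proof unfold_locales
    show "(\<integral>\<^sup>+x. ennreal (cmod (h x y)) \<partial>\<mu>) \<le> ennreal H" if "y \<in> space \<mu>" for y
      unfolding H(2)[symmetric] using that by (rule SUP_upper)
    show "0 \<le> M x" if "x \<in> space \<mu>" for x using M0[of x] that by (auto simp: M_def split: split_indicator)
    show "(\<integral>\<^sup>+y. ennreal (cmod (h x y)) * (indicator (space \<mu> - S) y * g y) \<partial>\<mu>)
        \<le> ennreal (M x) * (\<integral>\<^sup>+y. indicator (space \<mu> - S) y * g y \<partial>\<mu>)"
      if x: "x \<in> space \<mu> - S" and g: "g \<in> borel_measurable \<mu>" for x g
    proof -
      have "M x = M0 x" using x by (simp add: M_def)
      then show ?thesis
        using x g dom[OF x] by (simp only:) (rule nn_integral_le_of_set_function_le[where \<nu> = "K x"], auto intro: hint K)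
    qed
    show "?E n \<subseteq> ?E (Suc n)" for n by simp
    show "?E 0 = S" by simp
  qed (fact hp H(1) S dm \<epsilon> D M_int E_sets E_union h_vanish hint K refl)+
  then show ?thesis by blast
qed

theorem theorem3p8:
  fixes \<mu> :: "'a measure"
    and K :: "'a \<Rightarrow> 'a set \<Rightarrow> complex"
    and h :: "'a \<Rightarrow> 'a \<Rightarrow> complex"
    and d :: "'a \<Rightarrow> complex"
    and S :: "'a set"
  assumes "sigma_finite_measure \<mu>"
    and "is_kernel \<mu> K"
    and "kernel_density \<mu> K h"
    and "d \<in> Linf \<mu>"
    and "structural_type_B \<mu> K h S"
  shows
    "(L1_spectrum \<mu> (opA \<mu> d K) - Sigma_d \<mu> d S \<subseteq> R_spectrum \<mu> d K S) \<and>
     (\<forall>z0. z0 \<notin> Sigma_d \<mu> d S \<longrightarrow>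
        (eigenvalue \<mu> (opA \<mu> d K) z0 \<longleftrightarrow>
         eigenvalue (restrict_space \<mu> S) (opR \<mu> d K S z0) z0)) \<and>
     (\<forall>z0 u. z0 \<notin> Sigma_d \<mu> d S \<longrightarrow>
        eigenfunction \<mu> (opA \<mu> d K) z0 u \<longrightarrow>
        eigenfunction (restrict_space \<mu> S) (opR \<mu> d K S z0) z0 (restrict u S)) \<and>
     (\<forall>z0 v. z0 \<notin> Sigma_d \<mu> d S \<longrightarrow>
        eigenfunction (restrict_space \<mu> S) (opR \<mu> d K S z0) z0 v \<longrightarrow>
        (\<exists>u. eigenfunction \<mu> (opA \<mu> d K) z0 u \<and>
             (\<forall>x \<in> space \<mu>. depth_relation \<mu> d K S z0 v u x) \<and>
             (\<forall>w. (\<forall>x \<in> space \<mu>. depth_relation \<mu> d K S z0 v w x) \<longrightarrow>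
                  (\<forall>x \<in> space \<mu>. w x = u x)) \<and>
             (\<forall>w \<in> L1 \<mu>. (AE x in \<mu>. depth_relation \<mu> d K S z0 v w x) \<longrightarrow>
                  (AE x in \<mu>. w x = u x))))"
proof -
  \<comment> \<open>Both \<open>q\<close> and \<open>\<epsilon>\<close> depend on \<open>z0\<close>,
    so the locale is interpreted anew for each parameter.\<close>
  note red = depth_reductionI[OF assms(1,3,4,5)]
  have inv: "L1_invertible \<mu> (shifted (opA \<mu> d K) z0)"
    if z0: "z0 \<notin> Sigma_d \<mu> d S" and "L1_invertible (restrict_space \<mu> S) (shifted (opR \<mu> d K S z0) z0)" for z0
  proof -
    obtain H \<epsilon> D M where "depth_reduction \<mu> h d S z0 H \<epsilon> D M (depth_set \<mu> K S) K" using red[OF z0] by blast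
    then interpret depth_reduction \<mu> h d S z0 H \<epsilon> D M "depth_set \<mu> K S" K .
    show ?thesis by (rule invertible_opA) fact
  qed
  have restr: "eigenfunction (restrict_space \<mu> S) (opR \<mu> d K S z0) z0 (restrict u S)"
    if z0: "z0 \<notin> Sigma_d \<mu> d S" and "eigenfunction \<mu> (opA \<mu> d K) z0 u" for z0 u
  proof -
    obtain H \<epsilon> D M where "depth_reduction \<mu> h d S z0 H \<epsilon> D M (depth_set \<mu> K S) K" using red[OF z0] by blast
    then interpret depth_reduction \<mu> h d S z0 H \<epsilon> D M "depth_set \<mu> K S" K .
    show ?thesis by (rule eigenfunction_restrict) fact
  qed
  have ext: "\<exists>u. eigenfunction \<mu> (opA \<mu> d K) z0 u \<and>
             (\<forall>x \<in> space \<mu>. depth_relation \<mu> d K S z0 v u x) \<and>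
             (\<forall>w. (\<forall>x \<in> space \<mu>. depth_relation \<mu> d K S z0 v w x) \<longrightarrow>
                  (\<forall>x \<in> space \<mu>. w x = u x)) \<and>
             (\<forall>w \<in> L1 \<mu>. (AE x in \<mu>. depth_relation \<mu> d K S z0 v w x) \<longrightarrow>
                  (AE x in \<mu>. w x = u x))"
    if z0: "z0 \<notin> Sigma_d \<mu> d S" and eig: "eigenfunction (restrict_space \<mu> S) (opR \<mu> d K S z0) z0 v" for z0 v
  proof -
    obtain H \<epsilon> D M where "depth_reduction \<mu> h d S z0 H \<epsilon> D M (depth_set \<mu> K S) K" using red[OF z0] by blast
    then interpret depth_reduction \<mu> h d S z0 H \<epsilon> D M "depth_set \<mu> K S" K .
    have v: "integrable (restrict_space \<mu> S) v" using eig by (simp add: eigenfunction_def L1_def)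
    show ?thesis
    proof (intro exI[of _ "extension v"] conjI allI ballI impI)
      show "eigenfunction \<mu> (opA \<mu> d K) z0 (extension v)" by (rule eigenfunction_extension[OF v eig])
    next
      fix x assume "x \<in> space \<mu>"
      then show "depth_relation \<mu> d K S z0 v (extension v) x" by (rule depth_relation_extension[OF v])
    next
      fix w x assume "\<forall>x\<in>space \<mu>. depth_relation \<mu> d K S z0 v w x" "x \<in> space \<mu>"
      then show "w x = extension v x" by (intro depth_relation_unique[OF depth_relation_extension[OF v]]) auto
    next
      fix w assume "w \<in> L1 \<mu>" "AE x in \<mu>. depth_relation \<mu> d K S z0 v w x"
      then show "AE x in \<mu>. w x = extension v x" by (intro depth_relation_unique_AE[OF v]) (auto simp: L1_def)
    qed
  qed
  have "L1_spectrum \<mu> (opA \<mu> d K) - Sigma_d \<mu> d S \<subseteq> R_spectrum \<mu> d K S"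
    using inv by (auto simp: L1_spectrum_def R_spectrum_def)
  moreover have "eigenvalue \<mu> (opA \<mu> d K) z0 \<longleftrightarrow> eigenvalue (restrict_space \<mu> S) (opR \<mu> d K S z0) z0"
    if "z0 \<notin> Sigma_d \<mu> d S" for z0
    unfolding eigenvalue_def using restr[OF that] ext[OF that] by blast
  ultimately show ?thesis using restr ext by (intro conjI allI impI) auto
qed

end
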